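(* Let $d\geq5$ and let $\lambda_k=\mu_k!$, where $(\mu_k)_{k\ge1}$ is a strictly increasing sequence of positive integers. Suppose that, for some $C_0<\infty$, $$\#\{x\in\mathbb{Z}^d:A_\star f(x)>\alpha\}\leq C_0\sum_{x\in\mathbb{Z}^d}\frac{|f(x)|}{\alpha}\,\mathcal{L}\left(\frac{|f(x)|}{\alpha}\right)$$ for every $\alpha>0$ and every finitely supported $f:\mathbb{Z}^d\to\mathbb{C}$. Then $$\mathcal{N}_\mu(N)\leq C_{d,C_0}(1+\log N)\qquad\text{for all } N\geq2,$$ where $C_{d,C_0}$ is a finite constant depending only on $d$ and $C_0$. In particular, $C_{\log}\leq C_d(1+C_0)<\infty$, where $C_d$ is a finite constant depending only on $d$.
   Context: For $\lambda\in\mathbb{N}$ (positive integers), $s_\lambda=\#\{n\in\mathbb{Z}^d:|n|^2=\lambda\}$ (where $|\cdot|$ is the Euclidean norm; $s_\lambda>0$ since $d\ge5$) and $$A_\lambda f(x)=\frac{1}{s_\lambda}\sum_{n\in\mathbb{Z}^d,\,|n|^2=\lambda}f(x-n).$$ The maximal operator is $A_\star f(x)=\sup_{k\ge1}|A_{\lambda_k}f(x)|$. For real $N\geq2$, $\mathcal{N}_\mu(N)=\#\{k\geq1:\mu_k\leq N\}$, and $$C_{\log}=\sup_{N\geq2}\frac{\mathcal{N}_\mu(N)}{1+\log N}.$$ Logarithms are natural; $\log^+t=\max\{0,\log t\}$ for $t>0$; $\mathcal{L}(t)=1+\log^+t$ for $t>0$ and $\mathcal{L}(0)=1$. *)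

theory Defs
  imports "HOL-Analysis.Analysis"
begin

text \<open>The lattice of dimension \<open>d = CARD('d)\<close> is the type \<open>int ^ 'd\<close>. It carries no norm of its own,
  so the Euclidean norm is taken in \<open>real ^ 'd\<close>.\<close>

definition lattice_norm :: "int ^ 'd \<Rightarrow> real" where
  "lattice_norm n = norm (\<chi> i. real_of_int (n $ i))"

definition lattice_sphere :: "nat \<Rightarrow> (int ^ 'd) set" where
  "lattice_sphere l = {n. (lattice_norm n)\<^sup>2 = real l}"

definition sphere_avg :: "nat \<Rightarrow> (int ^ 'd \<Rightarrow> complex) \<Rightarrow> int ^ 'd \<Rightarrow> complex" where
  "sphere_avg l f x =
     (1 / of_nat (card (lattice_sphere l :: (int ^ 'd) set))) * (\<Sum>n\<in>lattice_sphere l. f (x - n))"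

text \<open>Sequences are indexed by \<open>k \<ge> 1\<close>; the value at \<open>0\<close> is irrelevant throughout. Suprema are taken in
  \<open>ereal\<close>, so that they are meaningful without a prior boundedness proof.\<close>

definition maximal_avg :: "(nat \<Rightarrow> nat) \<Rightarrow> (int ^ 'd \<Rightarrow> complex) \<Rightarrow> int ^ 'd \<Rightarrow> ereal" where
  "maximal_avg l f x = (SUP k\<in>{1..}. ereal (norm (sphere_avg (l k) f x)))"

definition log_plus :: "real \<Rightarrow> real" where
  "log_plus t = max 0 (ln t)"

definition LL :: "real \<Rightarrow> real" where
  "LL t = (if t = 0 then 1 else 1 + log_plus t)"

definition counting :: "(nat \<Rightarrow> nat) \<Rightarrow> real \<Rightarrow> nat" where
  "counting \<mu> N = card {k. k \<ge> 1 \<and> real (\<mu> k) \<le> N}"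

definition C_log :: "(nat \<Rightarrow> nat) \<Rightarrow> ereal" where
  "C_log \<mu> = (SUP N\<in>{2..}. ereal (real (counting \<mu> N) / (1 + ln N)))"

text \<open>Since \<open>card\<close> of an infinite set is \<open>0\<close>, a bound of a cardinality by a real number has to assert
  finiteness explicitly.\<close>

definition card_le :: "'a set \<Rightarrow> real \<Rightarrow> bool" where
  "card_le S r \<longleftrightarrow> finite S \<and> real (card S) \<le> r"

definition weak_LlogL_bound ::
    "'d::finite itself \<Rightarrow> (nat \<Rightarrow> nat) \<Rightarrow> real \<Rightarrow> bool" where
  "weak_LlogL_bound _ l C \<longleftrightarrow>
     (\<forall>\<alpha>>0. \<forall>f :: int ^ 'd \<Rightarrow> complex. finite {x. f x \<noteq> 0} \<longrightarrow>
        card_le {x. maximal_avg l f x > ereal \<alpha>}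
          (C * (\<Sum>\<^sub>\<infinity>x\<in>UNIV. norm (f x) / \<alpha> * LL (norm (f x) / \<alpha>))))"

lemma lattice_norm_sq: "(lattice_norm n)\<^sup>2 = real_of_int (\<Sum>i\<in>UNIV. (n $ i)\<^sup>2)"
  by (simp add: lattice_norm_def norm_vec_def L2_set_def sum_nonneg)

lemma finite_lattice_sphere: "finite (lattice_sphere l :: (int ^ 'd) set)"
proof -
  have "(lattice_sphere l :: (int ^ 'd) set) \<subseteq> vec_lambda ` (UNIV \<rightarrow>\<^sub>E {- int l..int l})"
  proof
    fix n :: "int ^ 'd"
    assume "n \<in> lattice_sphere l"
    then have s: "(\<Sum>i\<in>UNIV. (n $ i)\<^sup>2) = int l"
      unfolding lattice_sphere_def lattice_norm_sq mem_Collect_eq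
      by (metis of_int_eq_iff of_int_of_nat_eq)
    have "n $ i \<in> {- int l..int l}" for i
    proof -
      have "(n $ i)\<^sup>2 \<le> (\<Sum>i\<in>UNIV. (n $ i)\<^sup>2)"
        by (rule member_le_sum) auto
      moreover have "\<bar>n $ i\<bar> \<le> (n $ i)\<^sup>2"
        using self_le_power[of "\<bar>n $ i\<bar>" 2] by (cases "n $ i = 0") auto
      ultimately show ?thesis using s by auto
    qed
    then have "vec_nth n \<in> UNIV \<rightarrow>\<^sub>E {- int l..int l}" by auto
    then show "n \<in> vec_lambda ` (UNIV \<rightarrow>\<^sub>E {- int l..int l})"
      by (metis image_eqI vec_nth_inverse)
  qed
  then show ?thesis
    by (rule finite_subset) (auto intro!: finite_PiE)
qed

end

theory Submission
  imports Defs "HOL-Computational_Algebra.Primes"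
begin

text \<open>Choose a prime \<open>p\<close> between \<open>N\<close> and \<open>N^7\<close> such that the numbers \<open>\<mu> k!\<close> with \<open>\<mu> k \<le> N\<close> are
  distinct modulo \<open>p\<close>, and test the inequality on the indicator function of the multiples of \<open>p\<close> in a large box.
  If \<open>l = \<mu> k!\<close> exceeds a fixed power of \<open>p\<close>, which fails only for \<open>O(1 + log N)\<close> indices, the average of
  this function over the sphere \<open>\<bar>n\<bar>^2 = l\<close> is comparable to \<open>p^(1 - d)\<close> on a positive proportion of the
  points with \<open>\<bar>x\<bar>^2 \<equiv> l\<close> modulo \<open>p\<close>. These sets have density comparable to \<open>1 / p\<close> and are disjoint
  for distinct \<open>k\<close>, so the number of indices is \<open>O(C\<^sub>0 LL (p^(d - 1)))\<close>, that is, \<open>O(C\<^sub>0 (1 + log N))\<close>.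

  The positive proportion comes from two estimates. For even \<open>l\<close> the sphere has at least \<open>c l^(d/2 - 1)\<close>
  points, by Jacobi's four square theorem. A residue class modulo \<open>p\<close> with nonzero components
  contains at most \<open>C l^(d/2 - 1) p^(1 - d)\<close> of them, by the circle method: no asymptotic formula is
  needed, only a sharp bound for the fifth moment of a quadratic exponential sum, and Weyl
  differencing gives it without logarithmic loss because its logarithms do not affect the
  neighbourhoods of rationals with small denominator. Hence many residues are attained about as
  often as on average.\<close>

section \<open>Sums of four squares\<close>

text \<open>Counting only the range of each coordinate, about sqrt l / p values, bounds a residue
  class by l^(d/2 - 1) p^(2 - d). The missing factor p reflects the congruence for l modulo p, and
  recovering it shapes the analytic part. The general estimate allows the exponential sum over n0 +
  p j to be large near every h / (2 p^2 q), but for small q its linear phase makes it small unless p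
  divides h. This requires that p does not divide n0, hence the nonzero components; points with a
  component divisible by p are discarded by a cruder bound that saves only a small power of p. The
  fifth power is what d >= 5 offers: a fraction of denominator q contributes q^(-5/2), there are of
  order q numerators for fixed p, and the sum of q^(-3/2) converges. Jacobi's theorem enters through
  a lower bound that fails for numbers highly divisible by 2. With l even, one odd value among the
  other d - 4 coordinates leaves an odd number for the four squares. The prime must be at most a
  power of N because the L log L cost of a function of relative height p^(d - 1) is of order log p.
  The exponent 7 is what an elementary lower bound for the number of primes gives.\<close>

definition Tri :: "int \<Rightarrow> int \<Rightarrow> (int \<times> int \<times> int) set" where
  "Tri c n = {(u, d, e). u^2 + d * e = n \<and> d > 0 \<and> e > 0 \<and> c dvd d \<and> c dvd e}"

lemma abs_le_of_square_le:
  fixes u n :: int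
  assumes "u^2 \<le> n"
  shows "\<bar>u\<bar> \<le> n"
proof -
  have "\<bar>u\<bar> \<le> u^2" using self_le_power[of "\<bar>u\<bar>" 2] by (cases "u = 0") auto
  then show ?thesis using assms by simp
qed

lemma finite_square_le: "finite {u::int. u^2 \<le> n}"
proof (rule finite_subset)
  show "{u::int. u^2 \<le> n} \<subseteq> {-n..n}" using abs_le_of_square_le abs_le_iff by fastforce
qed auto

lemma finite_Tri: "finite (Tri c n)"
proof -
  have "Tri c n \<subseteq> {-\<bar>n\<bar>..\<bar>n\<bar>} \<times> {-\<bar>n\<bar>..\<bar>n\<bar>} \<times> {-\<bar>n\<bar>..\<bar>n\<bar>}"
  proof
    fix t assume "t \<in> Tri c n"
    then obtain u d e where t: "t = (u, d, e)" and eq: "u^2 + d * e = n" and pos: "d > 0" "e > 0"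
      by (auto simp: Tri_def)
    have "\<bar>u\<bar> \<le> u^2" by (rule abs_le_of_square_le) simp
    moreover have "d \<le> d * e" "e \<le> d * e" "0 \<le> u^2" using pos by auto
    ultimately have "\<bar>u\<bar> \<le> n" "d \<le> n" "e \<le> n" using eq pos by linarith+
    then show "t \<in> {-\<bar>n\<bar>..\<bar>n\<bar>} \<times> {-\<bar>n\<bar>..\<bar>n\<bar>} \<times> {-\<bar>n\<bar>..\<bar>n\<bar>}"
      using pos by (auto simp: t)
  qed
  then show ?thesis by (rule finite_subset) auto
qed

text \<open>The case \<open>F(x, y, z) = x y^2\<close> of Liouville's elementary method.\<close>

lemma liouville_identity:
  fixes n :: int
  assumes c: "c = 1 \<or> c = 2"
  shows "2 * (\<Sum>(u,d,e)\<in>Tri c n. d * (d * e - 4 * u^2)) =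
    2 * (\<Sum>(u,d,e)\<in>{(u,d,e)\<in>Tri c n. 2*u + d = e}. (e - 2*u) * (u + d)^2)
    - (\<Sum>(u,d,e)\<in>{(u,d,e)\<in>Tri c n. e + 2*u = d}. (d + e) * u^2)"
proof -
  let ?S = "Tri c n"
  let ?F = "\<lambda>(u::int,d::int,e::int). (e - 2*u) * (u + d)^2"
  let ?a = "\<lambda>(u::int,d::int,e::int). (d + e) * u^2"
  define Sp Sm S0 where "Sp = {(u,d,e)\<in>?S. 2*u + d > e}"
    and "Sm = {(u,d,e)\<in>?S. 2*u + d < e}" and "S0 = {(u,d,e)\<in>?S. 2*u + d = e}"
  define Ap Am A0 where "Ap = {(u,d,e)\<in>?S. e + 2*u > d}"
    and "Am = {(u,d,e)\<in>?S. e + 2*u < d}" and "A0 = {(u,d,e)\<in>?S. e + 2*u = d}"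
  have fin: "finite ?S" by (rule finite_Tri)
  have split: "sum f ?S = sum f {t\<in>?S. g t > 0} + (sum f {t\<in>?S. g t < 0} + sum f {t\<in>?S. g t = 0})"
    for f g :: "int \<times> int \<times> int \<Rightarrow> int"
  proof -
    let ?B = "{t\<in>?S. g t < 0} \<union> {t\<in>?S. g t = 0}"
    have "sum f ?S = sum f ({t\<in>?S. g t > 0} \<union> ?B)" by (rule arg_cong[where f = "sum f"]) auto
    also have "... = sum f {t\<in>?S. g t > 0} + sum f ?B"
      by (rule sum.union_disjoint) (use finite_Tri in auto)
    also have "sum f ?B = sum f {t\<in>?S. g t < 0} + sum f {t\<in>?S. g t = 0}"
      by (rule sum.union_disjoint) (use finite_Tri in auto)
    finally show ?thesis .
  qed
  let ?x = "\<lambda>(u,d,e). 2*u + d - e" and ?y = "\<lambda>(u,d,e). e + 2*u - d"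
  have "Sp = {t\<in>?S. ?x t > 0}" "Sm = {t\<in>?S. ?x t < 0}" "S0 = {t\<in>?S. ?x t = 0}"
    by (auto simp: Sp_def Sm_def S0_def)
  then have sumS: "sum ?F ?S = sum ?F Sp + (sum ?F Sm + sum ?F S0)" by (simp only: split[of ?F ?x])
  have "Ap = {t\<in>?S. ?y t > 0}" "Am = {t\<in>?S. ?y t < 0}" "A0 = {t\<in>?S. ?y t = 0}"
    by (auto simp: Ap_def Am_def A0_def)
  then have sumA: "sum ?a ?S = sum ?a Ap + (sum ?a Am + sum ?a A0)" by (simp only: split[of ?a ?y])
  \<comment> \<open>This involution fixes u + d and sends e - 2 u to its negative, so the weight
    changes sign.\<close>
  have "sum ?F Sp = sum (\<lambda>t. - ?F t) Sp"
    by (rule sum.reindex_bij_witness[where i = "\<lambda>(u,d,e). (e - u, 2*u + d - e, e)" and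
          j = "\<lambda>(u,d,e). (e - u, 2*u + d - e, e)"])
       (use c in \<open>auto simp: Sp_def Tri_def algebra_simps power2_eq_square\<close>)
  then have Sp0: "sum ?F Sp = 0" by (simp add: sum_negf)
  \<comment> \<open>With u + d as the new first entry, e - 2 u becomes the sum of the new second and
    third entries, which turns \<open>?F\<close> into \<open>?a\<close>. Positivity of the new third
    entry is the condition that defines \<open>Sm\<close>.\<close>
  have SmAp: "sum ?F Sm = sum ?a Ap"
    by (rule sum.reindex_bij_witness[where j = "\<lambda>(u::int,d::int,e::int). (u + d, d, e - d - 2*u)" and
          i = "\<lambda>(w::int,d::int,e::int). (w - d, d, e + 2*w - d)"])
       (use c in \<open>auto simp: Sm_def Ap_def Tri_def algebra_simps power2_eq_square\<close>)
  have ApAm: "sum ?a Ap = sum ?a Am"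
    by (rule sum.reindex_bij_witness[where j = "\<lambda>(u,d,e). (- u, e, d)" and
          i = "\<lambda>(u,d,e). (- u, e, d)"])
       (auto simp: Ap_def Am_def Tri_def add.commute mult.commute)
  \<comment> \<open>The sums of \<open>?a\<close> over \<open>Ap\<close> and \<open>Am\<close>
    agree, so each is half of the full sum without \<open>A0\<close>.\<close>
  have "2 * sum ?F ?S = sum ?a ?S + 2 * sum ?F S0 - sum ?a A0"
    using sumS sumA Sp0 SmAp ApAm by simp
  moreover have "sum ?F ?S = (\<Sum>(u,d,e)\<in>?S. d * (d * e - 4 * u^2) + d * u^2)"
  proof -
    have neg: "sum ?F ?S = (\<Sum>(u,d,e)\<in>?S. (e + 2*u) * (d - u)^2)"
      by (rule sum.reindex_bij_witness[where j = "\<lambda>(u,d,e). (- u, d, e)" and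
          i = "\<lambda>(u,d,e). (- u, d, e)"]) (auto simp: Tri_def add.commute)
    have sw: "(\<Sum>(u,d,e)\<in>?S. e * u^2) = (\<Sum>(u,d,e)\<in>?S. d * u^2)"
      by (rule sum.reindex_bij_witness[where j = "\<lambda>(u,d,e). (u, e, d)" and
          i = "\<lambda>(u,d,e). (u, e, d)"]) (auto simp: Tri_def algebra_simps)
    have "2 * sum ?F ?S = (\<Sum>(u,d,e)\<in>?S. (e - 2*u) * (u + d)^2) + (\<Sum>(u,d,e)\<in>?S. (e + 2*u) * (d - u)^2)"
      using neg by simp
    also have "... = (\<Sum>(u,d,e)\<in>?S. 2 * (d * (d * e - 4 * u^2)) + 2 * (e * u^2))"
      unfolding sum.distrib[symmetric]
      by (rule sum.cong) (auto simp: algebra_simps power2_eq_square)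
    also have "... = 2 * (\<Sum>(u,d,e)\<in>?S. d * (d * e - 4 * u^2)) + 2 * (\<Sum>(u,d,e)\<in>?S. e * u^2)"
      by (simp add: case_prod_unfold sum.distrib sum_distrib_left)
    also note sw
    finally show ?thesis by (simp add: case_prod_unfold sum.distrib)
  qed
  moreover have "sum ?a ?S = 2 * (\<Sum>(u,d,e)\<in>?S. d * u^2)"
  proof -
    have sw: "(\<Sum>(u,d,e)\<in>?S. e * u^2) = (\<Sum>(u,d,e)\<in>?S. d * u^2)"
      by (rule sum.reindex_bij_witness[where j = "\<lambda>(u,d,e). (u, e, d)" and
          i = "\<lambda>(u,d,e). (u, e, d)"]) (auto simp: Tri_def algebra_simps)
    show ?thesis using sw by (simp add: case_prod_unfold sum.distrib distrib_right)
  qed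
  ultimately show ?thesis
    unfolding S0_def A0_def by (simp add: case_prod_unfold sum.distrib)
qed

lemma sum_squares_closed: "6 * (\<Sum>i\<in>{1..int m}. i^2) = int m * (int m + 1) * (2 * int m + 1)"
proof (induction m)
  case (Suc m)
  have "{1..int (Suc m)} = insert (int (Suc m)) {1..int m}" by auto
  then show ?case using Suc by (simp add: algebra_simps power2_eq_square)
qed simp

lemma sum_closed: "2 * (\<Sum>i\<in>{1..int m}. i) = int m * (int m + 1)"
proof (induction m)
  case (Suc m)
  have "{1..int (Suc m)} = insert (int (Suc m)) {1..int m}" by auto
  then show ?case using Suc by (simp add: algebra_simps)
qed simp

text \<open>Under either side condition u^2 + d e is a perfect square, namely (u + d)^2 or (u +
  e)^2. Boundary terms of Liouville's identity therefore exist only for square n, and one entry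
  parametrises them.\<close>

lemma Tri_reindex:
  fixes l :: int
  assumes l: "l > 0" and n: "n = l^2" and c: "c = 1 \<or> c = 2"
  shows "(\<Sum>(u,d,e)\<in>{(u,d,e)\<in>Tri c n. 2*u + d = e}. f u d e)
          = (\<Sum>d | d \<in> {1..2*l-1} \<and> c dvd d. f (l - d) d (2 * l - d))"
    and "(\<Sum>(u,d,e)\<in>{(u,d,e)\<in>Tri c n. e + 2*u = d}. f u d e)
          = (\<Sum>d | d \<in> {1..2*l-1} \<and> c dvd d. f (l - d) (2 * l - d) d)"
proof -
  have u: "u = l - d" "2 * l > d" if "u^2 + d * (2 * u + d) = l^2" "d > 0" "2 * u + d > 0" for u d :: int
  proof -
    have "(u + d)^2 = l^2" using that(1) by (simp add: power2_eq_square algebra_simps)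
    \<comment> \<open>The root -l is excluded because 2 (u + d) is the sum of the positive numbers d
      and 2 u + d.\<close>
    then have "u + d = l" using that l by (auto simp: power2_eq_iff)
    then show "u = l - d" "2 * l > d" using that by auto
  qed
  have dv: "c dvd 2 * l - d \<longleftrightarrow> c dvd d" for d using c by auto
  show first: "(\<Sum>(u,d,e)\<in>{(u,d,e)\<in>Tri c n. 2*u + d = e}. f u d e)
          = (\<Sum>d | d \<in> {1..2*l-1} \<and> c dvd d. f (l - d) d (2 * l - d))" for f :: "int \<Rightarrow> int \<Rightarrow> int \<Rightarrow> 'a"
  proof (rule sum.reindex_bij_witness[where j = "\<lambda>(u,d,e). d" and i = "\<lambda>d. (l - d, d, 2*l - d)"])
    fix t assume t: "t \<in> {(u,d,e)\<in>Tri c n. 2*u + d = e}"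
    then obtain u d e where tt: "t = (u,d,e)" and h: "u^2 + d * (2 * u + d) = l^2" "d > 0" "2 * u + d > 0"
      "2 * u + d = e" "c dvd d"
      by (auto simp: Tri_def n)
    have "u = l - d" "e = 2 * l - d" using u(1)[OF h(1-3)] h(4) by auto
    then show "(case t of (u, d, e) \<Rightarrow> d) \<in> {d \<in> {1..2 * l - 1}. c dvd d}"
      "(case case t of (u, d, e) \<Rightarrow> d of d \<Rightarrow> (l - d, d, 2 * l - d)) = t"
      "f (l - (case t of (u, d, e) \<Rightarrow> d)) (case t of (u, d, e) \<Rightarrow> d) (2 * l - (case t of (u, d, e) \<Rightarrow> d))
        = (case t of (u, d, e) \<Rightarrow> f u d e)"
      using u(2)[OF h(1-3)] h(2,5) by (auto simp: tt)
  next
    fix d assume "d \<in> {d \<in> {1..2 * l - 1}. c dvd d}"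
    moreover have "(l - d)^2 + d * (2 * l - d) = l^2" by (simp add: power2_eq_square algebra_simps)
    ultimately show "(l - d, d, 2 * l - d) \<in> {(u,d,e)\<in>Tri c n. 2*u + d = e}"
      by (auto simp: Tri_def n dv)
  qed auto
  have "(\<Sum>(u,d,e)\<in>{(u,d,e)\<in>Tri c n. e + 2*u = d}. f u d e) = (\<Sum>(u,d,e)\<in>{(u,d,e)\<in>Tri c n. 2*u + d = e}. f u e d)"
    by (rule sum.reindex_bij_witness[where j = "\<lambda>(u,d,e). (u,e,d)" and i = "\<lambda>(u,d,e). (u,e,d)"])
       (auto simp: Tri_def mult.commute)
  then show "(\<Sum>(u,d,e)\<in>{(u,d,e)\<in>Tri c n. e + 2*u = d}. f u d e)
          = (\<Sum>d | d \<in> {1..2*l-1} \<and> c dvd d. f (l - d) (2 * l - d) d)"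
    unfolding first .
qed

lemma Tri_square_sums:
  fixes l :: int
  assumes l: "l > 0" and n: "n = l^2" and c: "c = 1 \<or> c = 2"
  shows "(\<Sum>(u,d,e)\<in>{(u,d,e)\<in>Tri c n. 2*u + d = e}. (e - 2*u) * (u + d)^2)
          = (\<Sum>d | d \<in> {1..2*l-1} \<and> c dvd d. d * l^2)"
    and "(\<Sum>(u,d,e)\<in>{(u,d,e)\<in>Tri c n. e + 2*u = d}. (d + e) * u^2)
          = (\<Sum>d | d \<in> {1..2*l-1} \<and> c dvd d. 2 * l * (d - l)^2)"
  unfolding Tri_reindex[OF assms] by (rule sum.cong; simp add: power2_commute[of l])+

text \<open>The boundary terms are polynomials in d, so closed forms for sums of i and i^2 evaluate
  them. What matters is the first value minus twice the second: the fourth powers of l cancel and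
  exactly l^2 remains.\<close>

lemma Tri_sum_square:
  fixes l :: int
  assumes l: "l > 0"
  shows "3 * (\<Sum>(u,d,e)\<in>Tri 1 (l^2). d * (d * e - 4 * u^2)) = l^2 * (4 * l^2 - 1)"
    and "3 * (\<Sum>(u,d,e)\<in>Tri 2 (l^2). d * (d * e - 4 * u^2)) = 2 * l^2 * (l^2 - 1)"
proof -
  have expand: "(\<Sum>i\<in>A. 2 * l * (g i - l)^2) = 2 * l * (\<Sum>i\<in>A. (g i)^2) - 4 * l^2 * (\<Sum>i\<in>A. g i) + 2 * l^3 * int (card A)"
    for g :: "int \<Rightarrow> int" and A :: "int set"
  proof -
    have "(\<Sum>i\<in>A. 2 * l * (g i - l)^2) = (\<Sum>i\<in>A. 2 * l * (g i)^2 - 4 * l^2 * g i + 2 * l^3)"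
      by (rule sum.cong) (auto simp: power2_eq_square power3_eq_cube algebra_simps)
    then show ?thesis by (simp add: sum.distrib sum_subtractf sum_distrib_left)
  qed
  have cl: "6 * (\<Sum>i\<in>{1..m}. i^2) = m * (m + 1) * (2 * m + 1)" "2 * (\<Sum>i\<in>{1..m}. i) = m * (m + 1)" if "m \<ge> 0" for m :: int
    using sum_squares_closed[of "nat m"] sum_closed[of "nat m"] that by auto
  define A B where "A = (\<Sum>i\<in>{1..2*l-1}. i^2)" and "B = (\<Sum>i\<in>{1..2*l-1}. i)"
  have AB: "6 * A = (2*l-1) * (2*l) * (4*l-1)" "2 * B = (2*l-1) * (2*l)"
    using cl[of "2*l-1"] l unfolding A_def B_def by (simp_all add: algebra_simps)
  have s1: "{d. d \<in> {1..2*l-1} \<and> (1::int) dvd d} = {1..2*l-1}" by auto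
  have "2 * (\<Sum>(u,d,e)\<in>Tri 1 (l^2). d * (d * e - 4 * u^2)) = 2 * (l^2 * B) - (2 * l * A - 4 * l^2 * B + 2 * l^3 * (2*l-1))"
    using liouville_identity[of 1 "l^2"] l
    unfolding Tri_square_sums(1)[OF l refl, of 1, OF disjI1, OF refl] Tri_square_sums(2)[OF l refl, of 1, OF disjI1, OF refl] s1 expand[of "\<lambda>x. x"] A_def B_def
    by (simp add: sum_distrib_left sum_distrib_right mult.commute)
  then have "6 * (\<Sum>(u,d,e)\<in>Tri 1 (l^2). d * (d * e - 4 * u^2)) = 9 * l^2 * (2 * B) - l * (6 * A) - 6 * l^3 * (2*l-1)"
    by (simp add: algebra_simps)
  then show "3 * (\<Sum>(u,d,e)\<in>Tri 1 (l^2). d * (d * e - 4 * u^2)) = l^2 * (4 * l^2 - 1)"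
    unfolding AB by (simp add: algebra_simps power2_eq_square power3_eq_cube)
  define A' B' where "A' = (\<Sum>i\<in>{1..l-1}. i^2)" and "B' = (\<Sum>i\<in>{1..l-1}. i)"
  have AB': "6 * A' = (l-1) * l * (2*l-1)" "2 * B' = (l-1) * l"
    using cl[of "l-1"] l unfolding A'_def B'_def by (simp_all add: algebra_simps)
  have s2: "{d. d \<in> {1..2*l-1} \<and> (2::int) dvd d} = (\<lambda>i. 2 * i) ` {1..l-1}"
    by (auto simp: image_iff elim!: dvdE)
  have r: "(\<Sum>d | d \<in> {1..2*l-1} \<and> (2::int) dvd d. g d) = (\<Sum>i\<in>{1..l-1}. g (2 * i))" for g :: "int \<Rightarrow> int"
    unfolding s2 by (subst sum.reindex) (auto simp: inj_on_def)
  have "2 * (\<Sum>(u,d,e)\<in>Tri 2 (l^2). d * (d * e - 4 * u^2)) = 2 * (2 * l^2 * B') - (8 * l * A' - 8 * l^2 * B' + 2 * l^3 * (l-1))"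
    using liouville_identity[of 2 "l^2"] l
    unfolding Tri_square_sums(1)[OF l refl, of 2, OF disjI2, OF refl] Tri_square_sums(2)[OF l refl, of 2, OF disjI2, OF refl]
      r expand[of "\<lambda>x. 2 * x"] A'_def B'_def by (simp add: sum_distrib_left sum_distrib_right mult.commute mult.left_commute power_mult_distrib)
  then have "6 * (\<Sum>(u,d,e)\<in>Tri 2 (l^2). d * (d * e - 4 * u^2)) = 18 * l^2 * (2 * B') - 4 * l * (6 * A') - 6 * l^3 * (l-1)"
    by (simp add: algebra_simps)
  then show "3 * (\<Sum>(u,d,e)\<in>Tri 2 (l^2). d * (d * e - 4 * u^2)) = 2 * l^2 * (l^2 - 1)"
    unfolding AB' by (simp add: algebra_simps power2_eq_square power3_eq_cube)
qed

lemma Tri_sum_nonsquare: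
  assumes "\<And>l. n \<noteq> l^2" and c: "c = 1 \<or> c = 2"
  shows "(\<Sum>(u,d,e)\<in>Tri c n. d * (d * e - 4 * u^2)) = 0"
proof -
  have "{(u,d,e)\<in>Tri c n. 2*u + d = e} = {}"
  proof -
    have "False" if "u^2 + d * (2 * u + d) = n" for u d :: int
      using assms(1)[of "u + d"] that by (simp add: power2_eq_square algebra_simps)
    then show ?thesis by (auto simp: Tri_def)
  qed
  moreover have "{(u,d,e)\<in>Tri c n. e + 2*u = d} = {}"
  proof -
    have "False" if "u^2 + (e + 2 * u) * e = n" for u e :: int
      using assms(1)[of "u + e"] that by (simp add: power2_eq_square algebra_simps)
    then show ?thesis by (auto simp: Tri_def)
  qed
  ultimately show ?thesis using liouville_identity[OF c, of n] by (simp only: sum.empty)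
qed

section \<open>Divisor sums and Jacobi's theorem\<close>

definition four_free_sum :: "int \<Rightarrow> int" where
  "four_free_sum m = (\<Sum>d | 0 < d \<and> d dvd m \<and> \<not> 4 dvd d. d)"

text \<open>Writing n - u^2 = d e turns n - 5 u^2 into d e - 4 u^2, the weight in Liouville's
  identity. Divisors divisible by 4 are removed by moving one factor 2 from d to e: this carries
  them to the triples with d and e both even, at twice the weight, which is why \<open>c\<close>
  takes the values 1 and 2.\<close>

lemma four_free_sum_recursion:
  fixes n :: int
  assumes n: "n > 0"
  shows "(\<Sum>u | u^2 < n. (n - 5 * u^2) * four_free_sum (n - u^2)) = (if \<exists>l. n = l^2 then n else 0)"
proof -
  let ?g = "\<lambda>(u::int,d::int,e::int). d * (d * e - 4 * u^2)"
  have finU: "finite {u::int. u^2 < n}" by (rule finite_subset[OF _ finite_square_le[of n]]) auto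
  have finD: "finite {d::int. 0 < d \<and> d dvd m \<and> \<not> 4 dvd d}" if "m > 0" for m
    by (rule finite_subset[of _ "{0..m}"]) (use that zdvd_imp_le in auto)
  have "(\<Sum>u | u^2 < n. (n - 5 * u^2) * four_free_sum (n - u^2))
      = (\<Sum>u | u^2 < n. \<Sum>d | 0 < d \<and> d dvd (n - u^2) \<and> \<not> 4 dvd d. (n - 5 * u^2) * d)"
    by (simp add: four_free_sum_def sum_distrib_left)
  also have "... = (\<Sum>(u,d)\<in>Sigma {u. u^2 < n} (\<lambda>u. {d. 0 < d \<and> d dvd (n - u^2) \<and> \<not> 4 dvd d}). (n - 5 * u^2) * d)"
    by (rule sum.Sigma) (use finU finD in auto)
  also have "... = sum ?g {(u,d,e)\<in>Tri 1 n. \<not> 4 dvd d}"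
  proof (rule sum.reindex_bij_witness[where i = "\<lambda>(u,d,e). (u, d)" and j = "\<lambda>(u,d). (u, d, (n - u^2) div d)"])
    fix t assume "t \<in> Sigma {u. u^2 < n} (\<lambda>u. {d. 0 < d \<and> d dvd (n - u^2) \<and> \<not> 4 dvd d})"
    then obtain u d where t: "t = (u,d)" "u^2 < n" "0 < d" "d dvd (n - u^2)" "\<not> 4 dvd d" by auto
    then obtain e where e: "n - u^2 = d * e" by auto
    then have "e > 0" using t by (metis diff_gt_0_iff_gt zero_less_mult_pos)
    moreover have "(n - u^2) div d = e" using e t by simp
    moreover have "n = d * e + u^2" using e by simp
    ultimately show "(case t of (u, d) \<Rightarrow> (u, d, (n - u^2) div d)) \<in> {(u,d,e)\<in>Tri 1 n. \<not> 4 dvd d}"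
      "?g (case t of (u, d) \<Rightarrow> (u, d, (n - u^2) div d)) = (case t of (u,d) \<Rightarrow> (n - 5 * u^2) * d)"
      using t by (auto simp: Tri_def)
  qed (auto simp: Tri_def)
  also have "... = sum ?g (Tri 1 n) - sum ?g {(u,d,e)\<in>Tri 1 n. 4 dvd d}"
  proof -
    have "Tri 1 n - {(u,d,e)\<in>Tri 1 n. 4 dvd d} = {(u,d,e)\<in>Tri 1 n. \<not> 4 dvd d}" by auto
    then show ?thesis using sum_diff[of "Tri 1 n" "{(u,d,e)\<in>Tri 1 n. 4 dvd d}" ?g] finite_Tri by fastforce
  qed
  also have "sum ?g {(u,d,e)\<in>Tri 1 n. 4 dvd d} = sum (\<lambda>t. 2 * ?g t) (Tri 2 n)"
    by (rule sum.reindex_bij_witness[where i = "\<lambda>(u,d,e). (u, 2 * d, e div 2)" and j = "\<lambda>(u,d,e). (u, d div 2, 2 * e)"])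
       (auto simp: Tri_def elim!: dvdE)
  also have "... = 2 * sum ?g (Tri 2 n)" by (simp add: sum_distrib_left)
  also have "sum ?g (Tri 1 n) - 2 * sum ?g (Tri 2 n) = (if \<exists>l. n = l^2 then n else 0)"
  proof (cases "\<exists>l. n = l^2")
    case True
    then obtain l' where l': "n = l'^2" by auto
    define l where "l = \<bar>l'\<bar>"
    have l: "l > 0" "n = l^2" using l' n by (auto simp: l_def)
    have "3 * (sum ?g (Tri 1 n) - 2 * sum ?g (Tri 2 n)) = 3 * n"
      using Tri_sum_square[OF l(1)] unfolding l(2) by (simp add: algebra_simps)
    then show ?thesis using True by simp
  next
    case False
    then show ?thesis using Tri_sum_nonsquare[of n 1] Tri_sum_nonsquare[of n 2] by auto
  qed
  finally show ?thesis .
qed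

definition Four :: "int \<Rightarrow> (int \<times> int \<times> int \<times> int) set" where
  "Four m = {(a, b, c, d). a^2 + b^2 + c^2 + d^2 = m}"

lemma finite_Four: "finite (Four m)"
proof -
  have "Four m \<subseteq> {-m..m} \<times> {-m..m} \<times> {-m..m} \<times> {-m..m}"
  proof
    fix t assume "t \<in> Four m"
    then obtain a b c d where t: "t = (a,b,c,d)" "a^2 + b^2 + c^2 + d^2 = m" by (auto simp: Four_def)
    moreover have "0 \<le> a^2" "0 \<le> b^2" "0 \<le> c^2" "0 \<le> d^2" by auto
    ultimately have "a^2 \<le> m" "b^2 \<le> m" "c^2 \<le> m" "d^2 \<le> m" by linarith+
    then have "\<bar>a\<bar> \<le> m" "\<bar>b\<bar> \<le> m" "\<bar>c\<bar> \<le> m" "\<bar>d\<bar> \<le> m" by (auto intro: abs_le_of_square_le)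
    then show "t \<in> {-m..m} \<times> {-m..m} \<times> {-m..m} \<times> {-m..m}" by (auto simp: t)
  qed
  then show ?thesis by (rule finite_subset) auto
qed

text \<open>Summing \<open>n - 5 u\<^sup>2\<close> over all representations of \<open>n\<close> by five squares gives zero by symmetry.\<close>

lemma card_Four_recursion:
  fixes n :: int
  shows "(\<Sum>u | u^2 \<le> n. (n - 5 * u^2) * int (card (Four (n - u^2)))) = 0"
proof -
  define P where "P = {(u::int,a::int,b::int,c::int,d::int). u^2 + a^2 + b^2 + c^2 + d^2 = n}"
  have P: "P = Sigma {u. u^2 \<le> n} (\<lambda>u. Four (n - u^2))"
  proof -
    have "u^2 \<le> n" if "u^2 + a^2 + b^2 + c^2 + d^2 = n" for u a b c d :: int
    proof -
      have "0 \<le> a^2" "0 \<le> b^2" "0 \<le> c^2" "0 \<le> d^2" by auto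
      then show ?thesis using that by linarith
    qed
    then show ?thesis by (auto simp: P_def Four_def)
  qed
  have finP: "finite P" unfolding P by (intro finite_SigmaI finite_square_le finite_Four)
  define q where "q = (\<Sum>(u,a,b,c,d)\<in>P. u^2)"
  have perm: "(\<Sum>(u,a,b,c,d)\<in>P. a^2) = q" "(\<Sum>(u,a,b,c,d)\<in>P. b^2) = q"
    "(\<Sum>(u,a,b,c,d)\<in>P. c^2) = q" "(\<Sum>(u,a,b,c,d)\<in>P. d^2) = q"
    unfolding q_def
    subgoal by (rule sum.reindex_bij_witness[where i = "\<lambda>(u,a,b,c,d). (a,u,b,c,d)" and j = "\<lambda>(u,a,b,c,d). (a,u,b,c,d)"])
      (auto simp: P_def)
    subgoal by (rule sum.reindex_bij_witness[where i = "\<lambda>(u,a,b,c,d). (b,a,u,c,d)" and j = "\<lambda>(u,a,b,c,d). (b,a,u,c,d)"])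
      (auto simp: P_def)
    subgoal by (rule sum.reindex_bij_witness[where i = "\<lambda>(u,a,b,c,d). (c,a,b,u,d)" and j = "\<lambda>(u,a,b,c,d). (c,a,b,u,d)"])
      (auto simp: P_def)
    subgoal by (rule sum.reindex_bij_witness[where i = "\<lambda>(u,a,b,c,d). (d,a,b,c,u)" and j = "\<lambda>(u,a,b,c,d). (d,a,b,c,u)"])
      (auto simp: P_def)
    done
  have "5 * q = (\<Sum>(u,a,b,c,d)\<in>P. u^2 + a^2 + b^2 + c^2 + d^2)"
    using perm q_def by (simp add: case_prod_unfold sum.distrib)
  also have "... = (\<Sum>t\<in>P. n)" by (rule sum.cong) (auto simp: P_def)
  finally have five: "5 * q = (\<Sum>t\<in>P. n)" .
  have "(\<Sum>u | u^2 \<le> n. (n - 5 * u^2) * int (card (Four (n - u^2))))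
      = (\<Sum>u | u^2 \<le> n. \<Sum>t\<in>Four (n - u^2). n - 5 * u^2)" by (simp add: mult.commute)
  also have "... = (\<Sum>(u,t)\<in>P. n - 5 * u^2)"
    unfolding P by (rule sum.Sigma) (use finite_square_le finite_Four in auto)
  also have "... = (\<Sum>t\<in>P. n) - 5 * q"
    unfolding q_def by (simp add: case_prod_unfold sum_subtractf sum_distrib_left)
  finally show ?thesis using five by simp
qed

text \<open>Both sides obey a recursion in which the value at n has the coefficient n, so it is
  determined by the values at n - u^2 with u nonzero. The factor 8 comes from square n: the two
  roots u each have weight -4 n, and 0 has one representation.\<close>

theorem jacobi_four_squares:
  fixes n :: int
  assumes "n > 0"
  shows "int (card (Four n)) = 8 * four_free_sum n"
  using assms
proof (induction "nat n" arbitrary: n rule: less_induct)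
  case less
  let ?R = "\<lambda>u. (n - 5 * u^2) * int (card (Four (n - u^2)))"
  let ?Q = "\<lambda>u. (n - 5 * u^2) * (8 * four_free_sum (n - u^2))"
  have 0: "Four 0 = {(0,0,0,0)}"
  proof -
    have "a = 0 \<and> b = 0 \<and> c = 0 \<and> d = 0" if "a^2 + b^2 + c^2 + d^2 = 0" for a b c d :: int
    proof -
      have "0 \<le> a^2" "0 \<le> b^2" "0 \<le> c^2" "0 \<le> d^2" by auto
      then have "a^2 = 0" "b^2 = 0" "c^2 = 0" "d^2 = 0" using that by linarith+
      then show ?thesis by auto
    qed
    then have "Four 0 \<subseteq> {(0,0,0,0)}" unfolding Four_def by blast
    moreover have "(0,0,0,0) \<in> Four 0" by (simp add: Four_def)
    ultimately show ?thesis by blast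
  qed
  let ?U = "{u::int. u^2 < n}" and ?E = "{u::int. u^2 = n}"
  have finU: "finite ?U" "finite ?E" by (auto intro: finite_subset[OF _ finite_square_le[of n]])
  have spl: "{u::int. u^2 \<le> n} = ?U \<union> ?E" by auto
  have E: "(\<Sum>u\<in>?E. ?R u) = (if \<exists>l. n = l^2 then - 8 * n else 0)"
  proof (cases "\<exists>l. n = l^2")
    case True
    then obtain l where l: "n = l^2" by auto
    then have l0: "l \<noteq> 0" using less.prems by auto
    have "?E = {l, - l}" unfolding l by (auto simp: power2_eq_iff)
    moreover have "l \<noteq> - l" using l0 by auto
    ultimately show ?thesis using True 0 l by auto
  next
    case False
    then have "?E = {}" by auto
    then show ?thesis using False by simp
  qed
  have "0 = (\<Sum>u\<in>?U. ?R u) + (\<Sum>u\<in>?E. ?R u)"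
    using card_Four_recursion[of n] unfolding spl
    by (subst (asm) sum.union_disjoint) (use finU in auto)
  moreover have "0 = 8 * (\<Sum>u\<in>?U. (n - 5 * u^2) * four_free_sum (n - u^2)) + (if \<exists>l. n = l^2 then - 8 * n else 0)"
    using four_free_sum_recursion[OF less.prems] by simp
  ultimately have "(\<Sum>u\<in>?U. ?R u) = 8 * (\<Sum>u\<in>?U. (n - 5 * u^2) * four_free_sum (n - u^2))"
    using E by linarith
  then have eq: "(\<Sum>u\<in>?U. ?R u) = (\<Sum>u\<in>?U. ?Q u)"
    by (simp add: sum_distrib_left mult.left_commute)
  have rest: "?R u = ?Q u" if "u \<in> ?U - {0}" for u
  proof -
    have "u^2 > 0" "u^2 < n" using that by auto
    then show ?thesis using less.hyps[of "n - u^2"] less.prems by simp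
  qed
  have "0 \<in> ?U" using less.prems by simp
  then have split: "(\<Sum>u\<in>?U. f u) = f 0 + (\<Sum>u\<in>?U - {0}. f u)" for f :: "int \<Rightarrow> int"
    by (rule sum.remove[OF finU(1)])
  have "(\<Sum>u\<in>?U - {0}. ?R u) = (\<Sum>u\<in>?U - {0}. ?Q u)"
    by (rule sum.cong[OF refl rest])
  then have "n * int (card (Four n)) = n * (8 * four_free_sum n)"
    using eq unfolding split by simp
  then show ?case using less.prems by simp
qed

text \<open>The divisor m alone gives the bound. A condition at 2 is unavoidable, since every power
  2^k with k >= 1 has only 24 representations.\<close>

corollary card_Four_ge:
  fixes m :: int
  assumes m: "m > 0" "\<not> 4 dvd m"
  shows "int (card (Four m)) \<ge> 8 * m"
proof -
  have "m \<le> four_free_sum m"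
    unfolding four_free_sum_def
  proof (rule member_le_sum[where f = "\<lambda>d. d"])
    show "finite {d. 0 < d \<and> d dvd m \<and> \<not> 4 dvd d}"
      by (rule finite_subset[of _ "{0..m}"]) (use m zdvd_imp_le in auto)
  qed (use m in auto)
  then show ?thesis using jacobi_four_squares[OF m(1)] by simp
qed

section \<open>Weyl sums\<close>

definition ee :: "real \<Rightarrow> complex" where
  "ee x = cis (2 * pi * x)"

lemma ee_add: "ee (x + y) = ee x * ee y"
  by (simp add: ee_def cis_mult distrib_left)

lemma norm_ee [simp]: "norm (ee x) = 1"
  by (simp add: ee_def)

lemma ee_of_int [simp]: "ee (of_int k) = 1"
  by (simp add: ee_def cis_multiple_2pi)

lemma ee_0 [simp]: "ee 0 = 1"
  by (simp add: ee_def)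

lemma ee_minus: "ee (x - y) = ee x * cnj (ee y)"
  by (simp add: ee_def cis_cnj cis_mult right_diff_distrib)

lemma ee_power: "ee x ^ j = ee (x * real j)"
  by (induction j) (simp_all add: ee_add[symmetric] algebra_simps)

lemma norm_one_minus_ee: "norm (1 - ee x) = 2 * \<bar>sin (pi * x)\<bar>"
proof -
  have "(norm (1 - ee x))^2 = (1 - cos (2 * (pi * x)))^2 + (sin (2 * (pi * x)))^2"
    by (simp add: cmod_power2 ee_def mult.assoc)
  also have "... = 2 - 2 * cos (2 * (pi * x))"
    using sin_cos_squared_add[of "2 * (pi * x)"] by (simp add: power2_diff)
  also have "... = (2 * sin (pi * x))^2"
    by (simp add: cos_double_sin power_mult_distrib)
  finally have "\<bar>norm (1 - ee x)\<bar> = \<bar>2 * sin (pi * x)\<bar>"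
    using power2_eq_iff by (metis abs_of_nonneg power2_abs power2_eq_imp_eq abs_ge_zero)
  then show ?thesis by (simp add: abs_mult)
qed

lemma norm_one_minus_ee_le: "norm (1 - ee x) \<le> 2 * pi * \<bar>x\<bar>"
  using abs_sin_le_one abs_sin_x_le_abs_x[of "pi * x"] by (simp add: norm_one_minus_ee abs_mult)

text \<open>This is concavity of the sine, argued by hand: a negative value of \<open>f\<close>
  between its two zeros forces a negative slope before it and a positive one after it, while the
  derivative of \<open>f\<close> decreases.\<close>

lemma sin_pi_ge:
  assumes "0 \<le> y" "y \<le> 1/2"
  shows "2 * y \<le> sin (pi * y)"
proof (rule ccontr)
  assume neg: "\<not> ?thesis"
  define f where "f = (\<lambda>t. sin (pi * t) - 2 * t)"
  have der: "(f has_real_derivative (pi * cos (pi * t) - 2)) (at t)" for t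
    unfolding f_def by (auto intro!: derivative_eq_intros)
  have fy: "f y < 0" using neg by (simp add: f_def)
  have f0: "f 0 = 0" "f (1/2) = 0" by (simp_all add: f_def)
  have "y \<noteq> 0" "y \<noteq> 1/2" using fy f0 by (metis less_irrefl)+
  then have y: "0 < y" "y < 1/2" using assms by auto
  obtain s where s: "0 < s" "s < y" "f y - f 0 = (y - 0) * (pi * cos (pi * s) - 2)"
    using MVT2[OF y(1), of f "\<lambda>t. pi * cos (pi * t) - 2"] der by auto
  obtain r where r: "y < r" "r < 1/2" "f (1/2) - f y = (1/2 - y) * (pi * cos (pi * r) - 2)"
    using MVT2[OF y(2), of f "\<lambda>t. pi * cos (pi * t) - 2"] der by auto
  have "pi * cos (pi * s) - 2 < 0" using s fy f0 y by (simp add: mult_less_0_iff)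
  moreover have "pi * cos (pi * r) - 2 > 0"
  proof -
    have "0 < (1/2 - y) * (pi * cos (pi * r) - 2)" using r(3) fy f0 by linarith
    moreover have "1/2 - y > 0" using y by simp
    ultimately show ?thesis using zero_less_mult_pos by blast
  qed
  moreover have "cos (pi * r) \<le> cos (pi * s)"
    by (rule cos_monotone_0_pi_le) (use s r y in \<open>auto simp: mult_le_cancel_left1\<close>)
  ultimately show False using pi_gt_zero by (smt (verit) mult_le_cancel_left_pos)
qed

lemma norm_one_minus_ee_ge:
  assumes "\<bar>y\<bar> \<le> 1/2"
  shows "norm (1 - ee y) \<ge> 4 * \<bar>y\<bar>"
proof -
  have "2 * \<bar>y\<bar> \<le> sin (pi * \<bar>y\<bar>)" using sin_pi_ge assms by auto
  also have "... \<le> \<bar>sin (pi * y)\<bar>" by (cases "y \<ge> 0") auto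
  finally show ?thesis by (simp add: norm_one_minus_ee)
qed

lemma norm_geometric_ee_le:
  assumes "0 < \<bar>x - of_int i\<bar>" "\<bar>x - of_int i\<bar> \<le> 1/2"
  shows "norm (\<Sum>j<m. ee (x * real j)) \<le> 1 / (2 * \<bar>x - of_int i\<bar>)"
proof -
  define y where "y = x - of_int i"
  have eq: "ee x = ee y"
    using ee_add[of y "of_int i"] by (simp add: y_def)
  have g: "norm (1 - ee x) \<ge> 4 * \<bar>y\<bar>" unfolding eq using assms by (intro norm_one_minus_ee_ge) (simp add: y_def)
  have "(1 - ee x) * (\<Sum>j<m. ee (x * real j)) = 1 - ee x ^ m"
    unfolding ee_power[symmetric] by (simp add: one_diff_power_eq)
  then have "norm (1 - ee x) * norm (\<Sum>j<m. ee (x * real j)) = norm (1 - ee x ^ m)"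
    by (metis norm_mult)
  also have "... \<le> 2" using norm_triangle_ineq4[of 1 "ee x ^ m"] by (simp add: norm_power)
  finally have "4 * \<bar>y\<bar> * norm (\<Sum>j<m. ee (x * real j)) \<le> 2"
    using g by (meson mult_right_mono norm_ge_zero order_trans)
  then show ?thesis using assms by (simp add: y_def field_simps)
qed

lemma norm_sum_ee_le: "norm (\<Sum>j\<in>A. ee (f j)) \<le> real (card A)"
  using norm_sum[of "\<lambda>j. ee (f j)" A] by simp

section \<open>Weyl differencing and shifts not divisible by the denominator\<close>

text \<open>The square is expanded and its off-diagonal pairs are grouped by their difference u; the
  induction step adds the pairs that involve the last index.\<close>

lemma van_der_Corput:
  fixes z :: "nat \<Rightarrow> complex"
  shows "(norm (\<Sum>j<L. z j))^2 = (\<Sum>j<L. (norm (z j))^2)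
      + 2 * Re (\<Sum>u\<in>{1..<L}. \<Sum>j<L-u. z (j + u) * cnj (z j))"
proof (induction L)
  case (Suc L)
  have A: "(norm (\<Sum>j<Suc L. z j))^2 = (norm (\<Sum>j<L. z j))^2 + (norm (z L))^2 + 2 * Re (z L * cnj (\<Sum>j<L. z j))"
  proof -
    have nrm: "(norm (a + b))^2 = (norm a)^2 + (norm b)^2 + 2 * Re (b * cnj a)" for a b :: complex
      unfolding cmod_power2 by (simp add: power2_eq_square algebra_simps)
    show ?thesis unfolding sum.lessThan_Suc by (rule nrm)
  qed
  have B: "(\<Sum>u\<in>{1..<Suc L}. \<Sum>j<Suc L-u. z (j + u) * cnj (z j))
     = (\<Sum>u\<in>{1..<L}. \<Sum>j<L-u. z (j + u) * cnj (z j)) + z L * cnj (\<Sum>j<L. z j)"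
  proof -
    have "(\<Sum>u\<in>{1..<Suc L}. \<Sum>j<Suc L-u. z (j + u) * cnj (z j))
      = (\<Sum>u\<in>{1..<Suc L}. (\<Sum>j<L-u. z (j + u) * cnj (z j)) + z L * cnj (z (L - u)))"
      by (rule sum.cong) (auto simp: Suc_diff_le)
    also have "... = (\<Sum>u\<in>{1..<Suc L}. \<Sum>j<L-u. z (j + u) * cnj (z j)) + (\<Sum>u\<in>{1..<Suc L}. z L * cnj (z (L - u)))"
      by (rule sum.distrib)
    also have "(\<Sum>u\<in>{1..<Suc L}. z L * cnj (z (L - u))) = (\<Sum>j<L. z L * cnj (z j))"
      by (rule sum.reindex_bij_witness[where i = "\<lambda>j. L - j" and j = "\<lambda>u. L - u"]) auto
    also have "... = z L * cnj (\<Sum>j<L. z j)" by (simp add: sum_distrib_left)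
    also have "(\<Sum>u\<in>{1..<Suc L}. \<Sum>j<L-u. z (j + u) * cnj (z j)) = (\<Sum>u\<in>{1..<L}. \<Sum>j<L-u. z (j + u) * cnj (z j))"
      by (rule sum.mono_neutral_right) auto
    finally show ?thesis .
  qed
  have C: "(\<Sum>j<Suc L. (norm (z j))^2) = (\<Sum>j<L. (norm (z j))^2) + (norm (z L))^2" by simp
  show ?case unfolding A B C Suc.IH plus_complex.sel distrib_left by linarith
qed simp

text \<open>A term times the conjugate of a shifted one has a phase linear in j, up to a unimodular
  constant. The coefficient b enters only this constant, so the bound is uniform in b, hence later
  in the starting point of a progression.\<close>

lemma weyl_differencing:
  "(norm (\<Sum>j<L. ee (a * (real j)^2 + b * real j)))^2
     \<le> real L + 2 * (\<Sum>u\<in>{1..<L}. norm (\<Sum>j<L-u. ee (2 * a * real u * real j)))"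
proof -
  let ?z = "\<lambda>j. ee (a * (real j)^2 + b * real j)"
  have step: "norm (\<Sum>j<L-u. ?z (j + u) * cnj (?z j)) = norm (\<Sum>j<L-u. ee (2 * a * real u * real j))" for u
  proof -
    have "(\<Sum>j<L-u. ?z (j + u) * cnj (?z j)) = (\<Sum>j<L-u. ee (a * (real u)^2 + b * real u) * ee (2 * a * real u * real j))"
      unfolding ee_minus[symmetric] ee_add[symmetric]
      by (rule sum.cong) (auto intro!: arg_cong[where f = ee] simp: algebra_simps power2_eq_square)
    then show ?thesis by (simp add: sum_distrib_left[symmetric] norm_mult)
  qed
  have "Re (\<Sum>u\<in>{1..<L}. \<Sum>j<L-u. ?z (j + u) * cnj (?z j)) \<le> (\<Sum>u\<in>{1..<L}. norm (\<Sum>j<L-u. ?z (j + u) * cnj (?z j)))"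
    by (rule order_trans[OF complex_Re_le_cmod norm_sum])
  then show ?thesis unfolding van_der_Corput step by simp
qed

text \<open>Among q consecutive u, multiplication by k permutes the residues modulo q, so each
  nonzero residue r occurs once. A block therefore costs twice the sum of q / r over 1 <= r < q,
  bounded through a harmonic number; m counts the blocks.\<close>

lemma sum_inverse_residues_le:
  fixes q :: nat and k :: int
  assumes q: "q > 0" and cop: "coprime k (int q)"
  defines "B \<equiv> \<lambda>u::nat. real q / real_of_int (k * int u mod int q) + real q / real_of_int (int q - k * int u mod int q)"
  shows "(\<Sum>u | u < q * m \<and> \<not> q dvd u. B u) \<le> real m * (2 * real q * (1 + ln (real q)))"
proof (induction m)
  case (Suc m)
  let ?N = "{u. q * m \<le> u \<and> u < q * Suc m \<and> \<not> q dvd u}"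
  let ?r = "\<lambda>u::nat. nat (k * int u mod int q)"
  have B: "B u = real q / real (?r u) + real q / (real q - real (?r u))" for u
    using q by (simp add: B_def)
  have ran: "?r ` ?N \<subseteq> {1..<q}"
  proof
    fix j assume "j \<in> ?r ` ?N"
    then obtain u where u: "u \<in> ?N" "j = ?r u" by auto
    have "\<not> int q dvd k * int u"
      using u cop by (simp add: coprime_commute coprime_dvd_mult_right_iff)
    then have "k * int u mod int q \<noteq> 0" by (simp add: dvd_eq_mod_eq_0)
    moreover have "0 \<le> k * int u mod int q" "k * int u mod int q < int q" using q by auto
    ultimately show "j \<in> {1..<q}" using u(2) by auto
  qed
  have inj: "inj_on ?r ?N"
  proof
    fix u v assume uv: "u \<in> ?N" "v \<in> ?N" "?r u = ?r v"
    have "0 \<le> k * int u mod int q" "0 \<le> k * int v mod int q" using q by auto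
    then have "k * int u mod int q = k * int v mod int q" using uv(3) by (simp add: eq_nat_nat_iff)
    then have "int q dvd k * (int u - int v)" by (simp add: mod_eq_dvd_iff right_diff_distrib)
    then have dv: "int q dvd int u - int v"
      using cop by (simp add: coprime_commute coprime_dvd_mult_right_iff)
    have "\<bar>int u - int v\<bar> < int q" using uv by (auto simp: abs_if)
    then have "int u - int v = 0" using dv zdvd_not_zless[of "\<bar>int u - int v\<bar>" "int q"] by fastforce
    then show "u = v" by simp
  qed
  have "(\<Sum>u\<in>?N. B u) = (\<Sum>j\<in>?r ` ?N. real q / real j + real q / (real q - real j))"
    using sum.reindex[OF inj, of "\<lambda>j. real q / real j + real q / (real q - real j)"] by (simp add: B)
  also have "... \<le> (\<Sum>j\<in>{1..<q}. real q / real j + real q / (real q - real j))"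
    by (rule sum_mono2) (use ran in auto)
  also have "... = (\<Sum>j\<in>{1..<q}. real q / real j) + (\<Sum>j\<in>{1..<q}. real q / (real q - real j))"
    by (rule sum.distrib)
  also have "(\<Sum>j\<in>{1..<q}. real q / (real q - real j)) = (\<Sum>j\<in>{1..<q}. real q / real j)"
    by (rule sum.reindex_bij_witness[where i = "\<lambda>j. q - j" and j = "\<lambda>j. q - j"]) (auto simp: of_nat_diff)
  also have "(\<Sum>j\<in>{1..<q}. real q / real j) \<le> real q * (1 + ln (real q))"
  proof -
    have "(\<Sum>j\<in>{1..<q}. real q / real j) \<le> (\<Sum>j\<in>{1..q}. real q / real j)"
      by (rule sum_mono2) auto
    also have "... = real q * harm q" by (simp add: harm_def sum_distrib_left divide_inverse)
    also have "harm q \<le> 1 + ln (real q)" using euler_mascheroni_sequence_decreasing[of 1 q] q by (simp add: harm_def)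
    finally show ?thesis by (simp add: mult_left_mono)
  qed
  finally have N: "(\<Sum>u\<in>?N. B u) \<le> 2 * real q * (1 + ln (real q))" by simp
  have un: "{u. u < q * Suc m \<and> \<not> q dvd u} = {u. u < q * m \<and> \<not> q dvd u} \<union> ?N" by auto
  have "(\<Sum>u | u < q * Suc m \<and> \<not> q dvd u. B u) = (\<Sum>u | u < q * m \<and> \<not> q dvd u. B u) + (\<Sum>u\<in>?N. B u)"
    unfolding un by (rule sum.union_disjoint) auto
  also have "... \<le> real m * (2 * real q * (1 + ln (real q))) + 2 * real q * (1 + ln (real q))"
    by (rule add_mono[OF Suc.IH N])
  also have "... = real (Suc m) * (2 * real q * (1 + ln (real q)))"
    by (simp only: of_nat_Suc distrib_right mult_1_left add.commute)
  finally show ?case .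
qed simp

text \<open>Replacing a by k / q moves a u by at most 1 / (2 q), no more than half the distance of k
  u / q from the integers. With r the residue of k u, the distance of a u from the nearest integer
  is thus at least r / (2 q) or (q - r) / (2 q).\<close>

lemma norm_sum_ee_nonmultiple_le:
  fixes q L u m :: nat and k :: int and a :: real
  assumes q: "q > 0" and u: "\<not> q dvd u" "u < L" and cop: "coprime k (int q)"
    and appr: "\<bar>real q * a - of_int k\<bar> < 1 / (2 * real L)"
  shows "norm (\<Sum>j<m. ee (a * real u * real j))
    \<le> real q / real_of_int (k * int u mod int q) + real q / real_of_int (int q - k * int u mod int q)"
proof -
  define r i where "r = k * int u mod int q" and "i = k * int u div int q"
  have kr: "k * int u = i * int q + r" by (simp add: r_def i_def)
  have "\<not> int q dvd k * int u"
    using u cop by (simp add: coprime_commute coprime_dvd_mult_right_iff)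
  then have "r \<noteq> 0" by (simp add: r_def dvd_eq_mod_eq_0)
  moreover have "0 \<le> r" "r < int q" using q by (auto simp: r_def)
  ultimately have r: "1 \<le> r" "r \<le> int q - 1" by auto
  define y where "y = a * real u - of_int i"
  have L: "L > 0" using u by simp
  have "real q * (y - of_int r / real q) = real u * (real q * a - of_int k)"
  proof -
    have "real_of_int k * real u = of_int i * real q + of_int r" using arg_cong[OF kr, of real_of_int] by simp
    then show ?thesis using q by (simp add: y_def field_simps)
  qed
  from arg_cong[OF this, of abs]
  have "real q * \<bar>y - of_int r / real q\<bar> = real u * \<bar>real q * a - of_int k\<bar>"
    by (simp only: abs_mult abs_of_nat)
  also have "... \<le> real L * (1 / (2 * real L))"
    using u appr by (intro mult_mono) auto
  also have "... = 1/2" using L by simp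
  finally have d: "\<bar>y - of_int r / real q\<bar> \<le> 1 / (2 * real q)" using q by (simp add: field_simps)
  have y1: "y \<ge> of_int r / (2 * real q)"
  proof -
    have "of_int r / real q - 1 / (2 * real q) \<ge> of_int r / (2 * real q)" using r q by (simp add: field_simps)
    then show ?thesis using d by linarith
  qed
  have y2: "1 - y \<ge> (real q - of_int r) / (2 * real q)"
  proof -
    have "real_of_int r \<le> real q - 1" using r by linarith
    then have "(real q - of_int r) / (2 * real q) \<le> (2 * real q - 2 * of_int r - 1) / (2 * real q)"
      by (intro divide_right_mono) auto
    also have "... = 1 - of_int r / real q - 1 / (2 * real q)" using q by (simp add: field_simps)
    finally have "1 - of_int r / real q - 1 / (2 * real q) \<ge> (real q - of_int r) / (2 * real q)" .
    then show ?thesis using d by linarith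
  qed
  have pos: "of_int r / (2 * real q) > 0" "(real q - of_int r) / (2 * real q) > 0"
    using r q by (auto intro!: divide_pos_pos)
  have inv: "1 / (2 * b) \<le> 1 / (2 * a)" if "0 < a" "a \<le> b" for a b :: real
    using that by (intro frac_le) auto
  have nn: "real q / of_int r \<ge> 0" "real q / (real q - of_int r) \<ge> 0" using r by auto
  show ?thesis
  proof (cases "y \<le> 1/2")
    case True
    have "norm (\<Sum>j<m. ee (a * real u * real j)) \<le> 1 / (2 * \<bar>a * real u - of_int i\<bar>)"
      by (rule norm_geometric_ee_le) (use True y1 pos in \<open>auto simp: y_def[symmetric]\<close>)
    also have "... = 1 / (2 * y)" using y1 pos by (simp add: y_def[symmetric])
    also have "... \<le> 1 / (2 * (of_int r / (2 * real q)))"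
      by (rule inv[OF pos(1) y1])
    also have "... = real q / of_int r" by simp
    finally show ?thesis using nn by (simp add: r_def)
  next
    case False
    have e: "\<bar>a * real u - of_int (i + 1)\<bar> = 1 - y" using y2 pos by (simp add: y_def)
    have "norm (\<Sum>j<m. ee (a * real u * real j)) \<le> 1 / (2 * \<bar>a * real u - of_int (i + 1)\<bar>)"
      by (rule norm_geometric_ee_le; unfold e; use False y2 pos in linarith)
    also have "... = 1 / (2 * (1 - y))" unfolding e ..
    also have "... \<le> 1 / (2 * ((real q - of_int r) / (2 * real q)))"
      by (rule inv[OF pos(2) y2])
    also have "... = real q / (real q - of_int r)" by (simp del: right_diff_distrib_numeral)
    finally show ?thesis using nn by (simp add: r_def)
  qed
qed

text \<open>These shifts are the source of the logarithm, and it comes with the factor L only,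
  whereas the multiples of q may contribute as much as L^2 / q.\<close>

lemma sum_nonmultiples_le:
  fixes q L :: nat and k :: int and a :: real
  assumes q: "q > 0" "q \<le> 2 * L" and L: "L > 0" and cop: "coprime k (int q)"
    and appr: "\<bar>real q * a - of_int k\<bar> < 1 / (2 * real L)"
  shows "(\<Sum>u | u \<in> {1..<L} \<and> \<not> q dvd u. norm (\<Sum>j<L-u. ee (a * real u * real j)))
    \<le> 6 * real L * (1 + ln (2 * real L))"
proof -
  define B where "B = (\<lambda>u::nat. real q / real_of_int (k * int u mod int q) + real q / real_of_int (int q - k * int u mod int q))"
  \<comment> \<open>One extra block covers the remainder; with q <= 2 L this gives m q <= L + q <= 3
    L.\<close>
  define m where "m = L div q + 1"
  have Lm: "L \<le> q * m"
  proof -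
    have "q * (L div q) + L mod q = L" "L mod q < q" using q(1) by auto
    then show ?thesis unfolding m_def distrib_left by linarith
  qed
  have B0: "B u \<ge> 0" for u
  proof -
    have q': "int q > 0" using q by simp
    have "0 \<le> k * int u mod int q" by (rule pos_mod_sign[OF q'])
    moreover have "0 \<le> int q - k * int u mod int q"
      unfolding diff_ge_0_iff_ge by (rule less_imp_le[OF pos_mod_bound[OF q']])
    ultimately have "0 \<le> k * int u mod int q" "0 \<le> int q - k * int u mod int q" by blast+
    then show ?thesis unfolding B_def
      by (intro add_nonneg_nonneg divide_nonneg_nonneg) (simp_all only: of_int_0_le_iff of_nat_0_le_iff)
  qed
  have "(\<Sum>u | u \<in> {1..<L} \<and> \<not> q dvd u. norm (\<Sum>j<L-u. ee (a * real u * real j))) \<le> (\<Sum>u | u \<in> {1..<L} \<and> \<not> q dvd u. B u)"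
    unfolding B_def by (rule sum_mono, rule norm_sum_ee_nonmultiple_le) (use assms in auto)
  also have "... \<le> (\<Sum>u | u < q * m \<and> \<not> q dvd u. B u)"
    by (rule sum_mono2) (use Lm B0 in auto)
  also have "... \<le> real m * (2 * real q * (1 + ln (real q)))"
    unfolding B_def by (rule sum_inverse_residues_le[OF q(1) cop])
  also have "... = (real m * real q) * (2 * (1 + ln (real q)))" by simp
  also have "... \<le> (3 * real L) * (2 * (1 + ln (2 * real L)))"
  proof (rule mult_mono)
    have "q * (L div q) \<le> L" by (rule times_div_less_eq_dividend)
    moreover have "m * q = q * (L div q) + q" by (simp add: m_def algebra_simps)
    ultimately have "m * q \<le> 3 * L" using q(2) by linarith
    then have "real (m * q) \<le> real (3 * L)" by (rule of_nat_mono)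
    then show "real m * real q \<le> 3 * real L" by simp
    have "ln (real q) \<le> ln (2 * real L)" by (rule ln_mono) (use q in linarith)+
    then show "2 * (1 + ln (real q)) \<le> 2 * (1 + ln (2 * real L))"
      by (intro mult_left_mono add_left_mono) simp_all
    have "0 \<le> ln (real q)" using q(1) by (intro ln_ge_zero) linarith
    then show "0 \<le> 2 * (1 + ln (real q))" by simp
  qed simp
  finally show ?thesis by (simp add: algebra_simps)
qed

section \<open>Shifts divisible by the denominator\<close>

lemma sum_powr_neg_four_fifths_le:
  "(\<Sum>t\<in>{1..T}. real t powr (-4/5)) \<le> 5 * real T powr (1/5)"
proof (induction T)
  case (Suc T)
  have "real (Suc T) powr (-4/5) \<le> 5 * (real (Suc T) powr (1/5) - real T powr (1/5))"
  proof (cases "T = 0")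
    case False
    have "\<exists>z::real. z > real T \<and> z < real (Suc T) \<and>
        real (Suc T) powr (1/5) - real T powr (1/5) = (real (Suc T) - real T) * (1/5 * z powr (1/5 - 1))"
      by (rule MVT2) (use False in \<open>auto intro!: derivative_eq_intros\<close>)
    then obtain z where z: "z > real T" "z < real (Suc T)"
      "5 * (real (Suc T) powr (1/5) - real T powr (1/5)) = z powr (-4/5)" by auto
    have "real (Suc T) powr (-4/5) \<le> z powr (-4/5)" by (rule powr_mono2') (use z False in auto)
    then show ?thesis using z by simp
  qed simp
  then show ?case using Suc.IH by simp
qed simp

lemma min_le_powr_interpolate:
  fixes a b s :: real
  assumes "a > 0" "b > 0" "0 \<le> s" "s \<le> 1"
  shows "min a b \<le> a powr s * b powr (1 - s)"
proof -
  have "min a b = min a b powr s * min a b powr (1 - s)"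
    using assms by (simp add: powr_add[symmetric])
  also have "... \<le> a powr s * b powr (1 - s)"
    by (intro mult_mono powr_mono2) (use assms in auto)
  finally show ?thesis .
qed

abbreviation multiples_sum :: "nat \<Rightarrow> nat \<Rightarrow> real \<Rightarrow> real" where
  "multiples_sum q L a \<equiv> \<Sum>u | u \<in> {1..<L} \<and> q dvd u. norm (\<Sum>j<L-u. ee (a * real u * real j))"

text \<open>For u = q t the distance of a u from the integers is t |q a - k|, so the geometric sum
  is at most the minimum of L and 1 / (t |q a - k|). Summing the reciprocals 1 / t would cost a
  logarithm; interpolation lowers the exponent to 4/5 and the sum over t to order T^(1/5). The value
  4/5 is chosen because the power 5/2, applied later, turns x^(-4/5) into the integrable
  x^(-2).\<close>

lemma sum_multiples_le:
  fixes q L :: nat and k :: int and a :: real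
  assumes q: "q > 0" and L: "L > 0"
    and appr: "\<bar>real q * a - of_int k\<bar> < 1 / (2 * real L)"
  defines "x \<equiv> (real L)^2 * \<bar>a - of_int k / real q\<bar>"
  shows "multiples_sum q L a
      \<le> (real L)^2 / real q"
    and "x > 0 \<Longrightarrow> multiples_sum q L a
      \<le> 5 * ((real L)^2 / real q) * x powr (-4/5)"
proof -
  define T where "T = L div q"
  have TL: "real T \<le> real L / real q" unfolding T_def by (rule of_nat_div_le_of_nat)
  define e where "e = \<bar>real q * a - of_int k\<bar>"
  have xe: "x = (real L)^2 * e / real q"
  proof -
    have "a - of_int k / real q = (real q * a - of_int k) / real q" using q by (simp add: field_simps)
    then show ?thesis by (simp add: x_def e_def)
  qed
  have mono: "multiples_sum q L a \<le> (\<Sum>t\<in>{1..T}. g t)"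
    if g: "\<And>t. t \<ge> 1 \<Longrightarrow> q * t < L \<Longrightarrow> norm (\<Sum>j<L-q*t. ee (a * real (q * t) * real j)) \<le> g t" "\<And>t. 0 \<le> g t" for g
  proof -
    have sub: "{u. u \<in> {1..<L} \<and> q dvd u} = (\<lambda>t. q * t) ` {t. 1 \<le> t \<and> q * t < L}"
      using q by (auto elim!: dvdE)
    have fin: "{t. 1 \<le> t \<and> q * t < L} \<subseteq> {1..T}"
      using q by (auto simp: T_def less_eq_div_iff_mult_less_eq mult.commute)
    have "multiples_sum q L a
        = (\<Sum>t | 1 \<le> t \<and> q * t < L. norm (\<Sum>j<L-q*t. ee (a * real (q * t) * real j)))"
      unfolding sub by (subst sum.reindex) (use q in \<open>auto simp: inj_on_def\<close>)
    also have "... \<le> (\<Sum>t | 1 \<le> t \<and> q * t < L. g t)" by (rule sum_mono) (use g in auto)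
    also have "... \<le> (\<Sum>t\<in>{1..T}. g t)" by (rule sum_mono2) (use fin g in auto)
    finally show ?thesis .
  qed
  have triv: "norm (\<Sum>j<L-u. ee (f j)) \<le> real L" for f and u :: nat
    using norm_sum_ee_le[of f "{..<L-u}"] by simp
  have "multiples_sum q L a \<le> (\<Sum>t\<in>{1..T}. real L)"
    by (rule mono) (use triv in auto)
  also have "... = real T * real L" by simp
  also have "... \<le> (real L / real q) * real L" by (intro mult_right_mono TL) auto
  finally show "multiples_sum q L a
      \<le> (real L)^2 / real q" by (simp add: power2_eq_square)
  assume x0: "x > 0"
  then have e0: "e > 0" using q L unfolding xe by (simp add: zero_less_mult_iff zero_less_divide_iff)
  have "multiples_sum q L a
     \<le> (\<Sum>t\<in>{1..T}. real L powr (1/5) * e powr (-4/5) * real t powr (-4/5))"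
  proof (rule mono)
    fix t :: nat assume t: "t \<ge> 1" "q * t < L"
    have e: "\<bar>a * real (q * t) - of_int (k * int t)\<bar> = real t * e"
    proof -
      have "a * real (q * t) - of_int (k * int t) = real t * (real q * a - of_int k)" by (simp add: algebra_simps)
      then show ?thesis by (simp only: e_def abs_mult abs_of_nat)
    qed
    have "t \<le> q * t" using q by simp
    then have tL: "t < L" using t by linarith
    have "real t * e \<le> real L * (1 / (2 * real L))"
      using tL appr by (intro mult_mono) (auto simp: e_def)
    then have half: "real t * e \<le> 1/2" using L by simp
    have "norm (\<Sum>j<L-q*t. ee (a * real (q * t) * real j)) \<le> 1 / (2 * \<bar>a * real (q * t) - of_int (k * int t)\<bar>)"
      by (rule norm_geometric_ee_le; unfold e; use half t e0 in simp)
    also have "... \<le> 1 / (real t * e)" unfolding e using t e0 by (simp add: field_simps)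
    finally have "norm (\<Sum>j<L-q*t. ee (a * real (q * t) * real j)) \<le> min (real L) (1 / (real t * e))"
      using triv by simp
    also have "... \<le> real L powr (1/5) * (1 / (real t * e)) powr (1 - 1/5)"
      by (rule min_le_powr_interpolate) (use L t e0 in auto)
    also have "(1 / (real t * e)) powr (1 - 1/5) = e powr (-4/5) * real t powr (-4/5)"
      using t e0 by (simp add: powr_divide powr_mult powr_minus_divide)
    finally show "norm (\<Sum>j<L-q*t. ee (a * real (q * t) * real j)) \<le> real L powr (1/5) * e powr (-4/5) * real t powr (-4/5)"
      by simp
  qed simp
  also have "... = real L powr (1/5) * e powr (-4/5) * (\<Sum>t\<in>{1..T}. real t powr (-4/5))"
    by (simp add: sum_distrib_left)
  also have "... \<le> real L powr (1/5) * e powr (-4/5) * (5 * (real L / real q) powr (1/5))"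
  proof (rule mult_left_mono)
    have "(\<Sum>t\<in>{1..T}. real t powr (-4/5)) \<le> 5 * real T powr (1/5)" by (rule sum_powr_neg_four_fifths_le)
    also have "... \<le> 5 * (real L / real q) powr (1/5)" using TL by (intro mult_left_mono powr_mono2) auto
    finally show "(\<Sum>t\<in>{1..T}. real t powr (-4/5)) \<le> 5 * (real L / real q) powr (1/5)" .
  qed simp
  also have "... = 5 * (((real L)^2 / real q) powr (1/5) * e powr (-4/5))"
    using L q by (simp add: powr_divide powr_mult power2_eq_square)
  also have "... = 5 * ((real L)^2 / real q) * x powr (-4/5)"
  proof -
    define A where "A = (real L)^2 / real q"
    have A: "A > 0" using L q by (simp add: A_def)
    have "x = A * e" unfolding xe A_def by simp
    then have "A * x powr (-4/5) = (A powr 1 * A powr (-4/5)) * e powr (-4/5)"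
      using A e0 by (simp add: powr_mult)
    also have "A powr 1 * A powr (-4/5) = A powr (1/5)" by (simp only: powr_add[symmetric]) simp
    finally show ?thesis by (simp add: A_def)
  qed
  finally show "multiples_sum q L a
      \<le> 5 * ((real L)^2 / real q) * x powr (-4/5)" .
qed

section \<open>The fifth power of a quadratic Weyl sum\<close>

lemma square_powr_five_halves:
  fixes x :: real
  assumes "x \<ge> 0"
  shows "(x^2) powr (5/2) = x ^ 5"
proof (cases "x = 0")
  case False
  then have "x > 0" using assms by simp
  then have "(x^2) powr (5/2) = (x powr 2) powr (5/2)" by simp
  also have "... = x powr 5" by (simp only: powr_powr) simp
  finally show ?thesis using \<open>x > 0\<close> by simp
qed simp

lemma powr_half_five_add_le:
  fixes a b :: real
  assumes "a \<ge> 0" "b \<ge> 0"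
  shows "(a + b) powr (5/2) \<le> 6 * (a powr (5/2) + b powr (5/2))"
proof -
  have "(a + b) powr (5/2) \<le> (2 * max a b) powr (5/2)" using assms by (intro powr_mono2) auto
  also have "... = 2 powr (5/2) * max a b powr (5/2)" using assms by (simp add: powr_mult)
  also have "... \<le> 6 * (a powr (5/2) + b powr (5/2))"
  proof (rule mult_mono)
    have "(2::real) powr (5/2) = 2 powr (2 + 1/2)" by simp
    also have "... = 2 powr 2 * 2 powr (1/2)" by (rule powr_add)
    also have "... = 4 * sqrt 2" by (simp add: powr_half_sqrt)
    also have "... \<le> 4 * (3/2)" by (intro mult_left_mono real_le_lsqrt) (auto simp: power2_eq_square)
    finally show "(2::real) powr (5/2) \<le> 6" by simp
    show "max a b powr (5/2) \<le> a powr (5/2) + b powr (5/2)" by (auto simp: max_def)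
  qed auto
  finally show ?thesis .
qed

text \<open>In the bound for the squared sum, 10 = 2 * 5 and 13 = 1 + 2 * 6 are the two
  coefficients. The 6 separates the terms under the power 5/2, the 12 includes a 2 from passing to
  the kernel 1 / (1 + x^2), and 1 + 10 * 2^(1/10) comes from bounding 1 + ln (2 L) by a multiple of
  L^(1/10).\<close>

definition weyl_const :: real where
  "weyl_const = 12 * 10 powr (5/2) + 6 * (13 * (1 + 10 * 2 powr (1/10))) powr (5/2)"

lemma weyl_const_pos: "weyl_const > 0"
  unfolding weyl_const_def by (intro add_pos_nonneg mult_pos_pos) simp_all

text \<open>Differencing doubles the quadratic coefficient, which is why 2 a is approximated. The
  logarithm is absorbed by writing L^(11/10) for the error in the squared sum; the power 5/2 makes
  this L^(11/4), still below the L^3 of the moment bound, while the main term carries no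
  logarithm.\<close>

proposition weyl_fifth_power:
  fixes L q :: nat and k :: int and a b :: real
  assumes L: "L > 0" and q: "q > 0" "q \<le> 2 * L" and cop: "coprime k (int q)"
    and appr: "\<bar>real q * (2 * a) - of_int k\<bar> < 1 / (2 * real L)"
  shows "norm (\<Sum>j<L. ee (a * (real j)^2 + b * real j)) ^ 5 \<le>
    weyl_const * (real L ^ 5 * real q powr (-5/2) / (1 + ((real L)^2 * \<bar>2 * a - of_int k / real q\<bar>)^2)
      + real L powr (11/4))"
proof -
  define C0 :: real where "C0 = 13 * (1 + 10 * 2 powr (1/10))"
  have C0: "C0 > 0" by (simp add: C0_def add_pos_pos)
  have C: "weyl_const = 6 * (2 * 10 powr (5/2)) + 6 * C0 powr (5/2)" by (simp add: weyl_const_def C0_def)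
  define S where "S = norm (\<Sum>j<L. ee (a * (real j)^2 + b * real j))"
  define x where "x = (real L)^2 * \<bar>2 * a - of_int k / real q\<bar>"
  define A where "A = (real L)^2 / real q"
  \<comment> \<open>Up to x = 1 the trivial estimate is used, which avoids the singularity of
    x^(-4/5) at 0.\<close>
  define M where "M = (if x \<le> 1 then 1 else x powr (-4/5))"
  let ?D = "\<lambda>u. norm (\<Sum>j<L-u. ee (2 * a * real u * real j))"
  have A0: "A > 0" using L q by (simp add: A_def)
  have M0: "M > 0" by (simp add: M_def)
  have x0: "x \<ge> 0" by (simp add: x_def)
  have mult: "(\<Sum>u | u \<in> {1..<L} \<and> q dvd u. ?D u) \<le> 5 * A * M"
  proof (cases "x \<le> 1")
    case True
    then have "(\<Sum>u | u \<in> {1..<L} \<and> q dvd u. ?D u) \<le> A"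
      using sum_multiples_le(1)[OF q(1) L appr] by (simp add: A_def)
    then show ?thesis using True A0 by (simp add: M_def)
  next
    case False
    then show ?thesis using sum_multiples_le(2)[OF q(1) L appr, folded x_def] by (simp add: A_def M_def)
  qed
  have nonmult: "(\<Sum>u | u \<in> {1..<L} \<and> \<not> q dvd u. ?D u) \<le> 6 * real L * (1 + ln (2 * real L))"
    by (rule sum_nonmultiples_le[OF q L cop appr])
  have "(\<Sum>u\<in>{1..<L}. ?D u) = (\<Sum>u | u \<in> {1..<L} \<and> q dvd u. ?D u) + (\<Sum>u | u \<in> {1..<L} \<and> \<not> q dvd u. ?D u)"
    by (subst sum.union_disjoint[symmetric]) (auto intro!: sum.cong)
  then have tot: "(\<Sum>u\<in>{1..<L}. ?D u) \<le> 5 * A * M + 6 * real L * (1 + ln (2 * real L))"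
    using mult nonmult by linarith
  have "S^2 \<le> real L + 2 * (\<Sum>u\<in>{1..<L}. ?D u)"
    unfolding S_def by (rule weyl_differencing)
  also have "... \<le> real L + 2 * (5 * A * M + 6 * real L * (1 + ln (2 * real L)))"
    by (intro add_left_mono mult_left_mono tot) simp
  also have "... \<le> 10 * (A * M) + 13 * real L * (1 + ln (2 * real L))"
  proof -
    have "0 \<le> real L * ln (2 * real L)" using L by auto
    then show ?thesis by (simp add: algebra_simps)
  qed
  also have "... \<le> 10 * (A * M) + C0 * real L powr (11/10)"
  proof -
    have "ln (2 * real L) \<le> (2 * real L) powr (1/10) / (1/10)" by (rule ln_powr_bound) (use L in auto)
    also have "... = 10 * 2 powr (1/10) * real L powr (1/10)" by (simp add: powr_mult)
    finally have "1 + ln (2 * real L) \<le> real L powr (1/10) + 10 * 2 powr (1/10) * real L powr (1/10)"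
      using ge_one_powr_ge_zero[of "real L" "1/10"] L by simp
    then have "13 * real L * (1 + ln (2 * real L)) \<le> 13 * real L * ((1 + 10 * 2 powr (1/10)) * real L powr (1/10))"
      by (intro mult_left_mono) (auto simp: algebra_simps)
    also have "... = C0 * (real L powr 1 * real L powr (1/10))" using L by (simp add: C0_def)
    also have "... = C0 * real L powr (11/10)" by (simp only: powr_add[symmetric]) simp
    finally show ?thesis by simp
  qed
  finally have S2: "S^2 \<le> 10 * (A * M) + C0 * real L powr (11/10)" .
  have S0: "S \<ge> 0" by (simp add: S_def)
  have "S ^ 5 = (S^2) powr (5/2)" by (rule square_powr_five_halves[symmetric, OF S0])
  also have "... \<le> (10 * (A * M) + C0 * real L powr (11/10)) powr (5/2)"
    using S2 by (intro powr_mono2) auto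
  also have "... \<le> 6 * ((10 * (A * M)) powr (5/2) + (C0 * real L powr (11/10)) powr (5/2))"
    by (rule powr_half_five_add_le) (use A0 M0 C0 in auto)
  also have "(10 * (A * M)) powr (5/2) = 10 powr (5/2) * (A powr (5/2) * M powr (5/2))"
    using A0 M0 by (simp add: powr_mult)
  also have "A powr (5/2) = real L ^ 5 * real q powr (-5/2)"
    using L q by (simp add: A_def powr_divide powr_minus_divide square_powr_five_halves)
  also have "M powr (5/2) \<le> 2 / (1 + x^2)"
  proof (cases "x \<le> 1")
    case True
    then have "x^2 \<le> 1" using x0 by (simp add: power_le_one)
    moreover have "1 + x^2 > 0" by (simp add: add_pos_nonneg)
    ultimately show ?thesis using True by (simp add: M_def)
  next
    case False
    then have "M powr (5/2) = (x powr (-4/5)) powr (5/2)" by (simp only: M_def if_False)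
    also have "... = x powr (-2)" by (simp only: powr_powr) simp
    also have "... = 1 / x^2" using False by (simp add: powr_minus_divide)
    also have "... = 2 / (x^2 + x^2)" using False by simp
    also have "... \<le> 2 / (1 + x^2)"
    proof (rule frac_le)
      have "1 \<le> x^2" using False by (intro one_le_power) simp
      then show "0 < 1 + x^2" "1 + x^2 \<le> x^2 + x^2" by linarith+
    qed auto
    finally show ?thesis .
  qed
  also have "(C0 * real L powr (11/10)) powr (5/2) = C0 powr (5/2) * real L powr (11/4)"
    using C0 by (simp add: powr_mult powr_powr)
  finally have "S ^ 5 \<le> 6 * (10 powr (5/2) * (real L ^ 5 * real q powr (-5/2) * (2 / (1 + x^2))) + C0 powr (5/2) * real L powr (11/4))"
    by (simp add: mult_left_mono)
  also have "... \<le> weyl_const * (real L ^ 5 * real q powr (-5/2) / (1 + x^2) + real L powr (11/4))"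
  proof -
    define P R where "P = real L ^ 5 * real q powr (-5/2) / (1 + x^2)" and "R = real L powr (11/4)"
    have "P \<ge> 0" "R \<ge> 0" by (simp_all add: P_def R_def)
    then have "6 * (10 powr (5/2) * (2 * P) + C0 powr (5/2) * R) \<le> weyl_const * (P + R)"
      by (simp add: C algebra_simps add_increasing2)
    then show ?thesis by (simp add: P_def R_def)
  qed
  finally show ?thesis by (simp add: S_def x_def)
qed

section \<open>Fifth moments of quadratic exponential sums\<close>

text \<open>The antiderivative is an arctangent, whose total variation is pi; hence the bound is
  uniform in the centre z.\<close>

lemma integral_cauchy_kernel:
  fixes c Y z :: real
  assumes c: "c > 0" and Y: "Y > 0"
  shows "(\<lambda>t. 1 / (Y^2 + (c * (t - z))^2)) integrable_on {0..1}"
    and "integral {0..1} (\<lambda>t. 1 / (Y^2 + (c * (t - z))^2)) \<le> pi / (c * Y)"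
proof -
  define F where "F = (\<lambda>t. arctan (c * (t - z) / Y) / (c * Y))"
  have "((\<lambda>t. 1 / (Y^2 + (c * (t - z))^2)) has_integral (F 1 - F 0)) {0..1}"
  proof (rule fundamental_theorem_of_calculus)
    fix t :: real
    have pos: "Y^2 + (c * (t - z))^2 > 0" using Y by (simp add: add_pos_nonneg)
    have "(F has_real_derivative (inverse (1 + (c * (t - z) / Y)^2) * (c / Y) / (c * Y))) (at t)"
      unfolding F_def using c Y by (auto intro!: derivative_eq_intros)
    moreover have "inverse (1 + (c * (t - z) / Y)^2) * (c / Y) / (c * Y) = 1 / (Y^2 + (c * (t - z))^2)"
    proof -
      have "1 + (c * (t - z) / Y)^2 = (Y^2 + (c * (t - z))^2) / Y^2"
        using Y by (simp add: power_divide add_divide_distrib)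
      then show ?thesis using c Y pos by (simp add: power2_eq_square)
    qed
    ultimately have "(F has_real_derivative 1 / (Y^2 + (c * (t - z))^2)) (at t)" by simp
    then show "(F has_vector_derivative 1 / (Y^2 + (c * (t - z))^2)) (at t within {0..1})"
      by (simp add: has_real_derivative_iff_has_vector_derivative has_vector_derivative_at_within)
  qed simp
  moreover have "F 1 - F 0 \<le> pi / (c * Y)"
  proof -
    have "arctan (c * (1 - z) / Y) - arctan (c * (0 - z) / Y) \<le> pi"
      using arctan_ubound[of "c * (1 - z) / Y"] arctan_lbound[of "c * (0 - z) / Y"] by linarith
    then show ?thesis unfolding F_def diff_divide_distrib[symmetric]
      by (intro divide_right_mono) (use c Y in auto)
  qed
  ultimately show "(\<lambda>t. 1 / (Y^2 + (c * (t - z))^2)) integrable_on {0..1}"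
    "integral {0..1} (\<lambda>t. 1 / (Y^2 + (c * (t - z))^2)) \<le> pi / (c * Y)"
    by (auto simp: integrable_on_def integral_unique)
qed

text \<open>Each t is charged to a single kernel, and then all kernels, being nonnegative, are added
  and integrated over the whole interval. This replaces a dissection into disjoint arcs.\<close>

lemma integral_le_sum_cauchy_kernels:
  fixes f :: "real \<Rightarrow> real" and A Y z :: "'i \<Rightarrow> real"
  assumes I: "finite I" and f: "f integrable_on {0..1}" and c: "c > 0"
    and Y: "\<And>i. i \<in> I \<Longrightarrow> Y i > 0" and A: "\<And>i. i \<in> I \<Longrightarrow> A i \<ge> 0"
    and bound: "\<And>t. t \<in> {0..1} \<Longrightarrow> (\<exists>i\<in>I. f t \<le> A i * (1 / ((Y i)^2 + (c * (t - z i))^2)) + E)"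
  shows "integral {0..1} f \<le> (\<Sum>i\<in>I. A i * (pi / (c * Y i))) + E"
proof -
  let ?k = "\<lambda>i t. 1 / ((Y i)^2 + (c * (t - z i))^2)"
  have int: "(\<lambda>t. A i * ?k i t) integrable_on {0..1}" if "i \<in> I" for i
    by (intro integrable_on_mult_right integral_cauchy_kernel(1)[OF c Y[OF that]])
  have ints: "(\<lambda>t. (\<Sum>i\<in>I. A i * ?k i t)) integrable_on {0..1}"
    by (rule integrable_sum[OF I int])
  have "integral {0..1} f \<le> integral {0..1} (\<lambda>t. (\<Sum>i\<in>I. A i * ?k i t) + E)"
  proof (rule integral_le[OF f])
    show "(\<lambda>t. (\<Sum>i\<in>I. A i * ?k i t) + E) integrable_on {0..1}"
      by (intro integrable_add ints integrable_const_ivl)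
    fix t :: real assume "t \<in> {0..1}"
    then obtain i where i: "i \<in> I" "f t \<le> A i * ?k i t + E" using bound by blast
    have "A i * ?k i t \<le> (\<Sum>i\<in>I. A i * ?k i t)"
      by (rule member_le_sum[OF i(1) _ I], rule mult_nonneg_nonneg) (simp_all add: A)
    then show "f t \<le> (\<Sum>i\<in>I. A i * ?k i t) + E" using i(2) by linarith
  qed
  also have "... = integral {0..1} (\<lambda>t. \<Sum>i\<in>I. A i * ?k i t) + integral {0..1} (\<lambda>t::real. E)"
    by (rule integral_add[OF ints integrable_const_ivl])
  also have "integral {0..1} (\<lambda>t. \<Sum>i\<in>I. A i * ?k i t) = (\<Sum>i\<in>I. integral {0..1} (\<lambda>t. A i * ?k i t))"
    by (rule integral_sum[OF I int])
  also have "... \<le> (\<Sum>i\<in>I. A i * (pi / (c * Y i)))"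
  proof (rule sum_mono)
    fix i assume i: "i \<in> I"
    have "integral {0..1} (\<lambda>t. A i * ?k i t) = A i * integral {0..1} (?k i)"
      by (rule integral_mult_right)
    also have "... \<le> A i * (pi / (c * Y i))"
      by (intro mult_left_mono integral_cauchy_kernel(2)[OF c Y[OF i]] A[OF i])
    finally show "integral {0..1} (\<lambda>t. A i * ?k i t) \<le> A i * (pi / (c * Y i))" .
  qed
  finally show ?thesis by simp
qed

text \<open>Comparison with the integral of x^(-3/2), by telescoping. The decay Q^(-1/2) is used at
  Q = p^2, where it supplies a factor 1 / p.\<close>

lemma sum_powr_tail_le:
  assumes "Q \<ge> 1"
  shows "(\<Sum>q\<in>{Q<..R}. real q powr (-3/2)) \<le> 2 * real Q powr (-1/2)"
proof -
  have step: "real (Suc q) powr (-3/2) \<le> 2 * real q powr (-1/2) - 2 * real (Suc q) powr (-1/2)" if q: "q \<ge> 1" for q :: nat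
  proof -
    have "\<exists>z::real. z > real q \<and> z < real (Suc q) \<and>
        real (Suc q) powr (-1/2) - real q powr (-1/2) = (real (Suc q) - real q) * (-1/2 * z powr (-1/2 - 1))"
      by (rule MVT2) (use q in \<open>auto intro!: derivative_eq_intros\<close>)
    then obtain z where z: "z > real q" "z < real (Suc q)"
      "2 * real q powr (-1/2) - 2 * real (Suc q) powr (-1/2) = z powr (-3/2)" by auto
    have "real (Suc q) powr (-3/2) \<le> z powr (-3/2)" by (rule powr_mono2') (use z q in auto)
    then show ?thesis using z by simp
  qed
  have "(\<Sum>q\<in>{Q<..R}. real q powr (-3/2)) \<le> 2 * real Q powr (-1/2) - 2 * real R powr (-1/2)" if "R \<ge> Q" for R
    using that
  proof (induction R rule: dec_induct)
    case (step R)
    have "{Q<..Suc R} = insert (Suc R) {Q<..R}" using step by auto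
    then show ?case using step.IH \<open>\<And>q. 1 \<le> q \<Longrightarrow> _\<close>[of R] step.hyps assms by simp
  qed simp
  note * = this
  show ?thesis
  proof (cases "R \<ge> Q")
    case True
    have "0 \<le> 2 * real R powr (-1/2)" by simp
    then show ?thesis using *[OF True] by linarith
  qed simp
qed

lemma sum_powr_three_halves_le: "(\<Sum>q\<in>{1..R}. real q powr (-3/2)) \<le> 3"
proof (cases "R = 0")
  case False
  then have "{1..R} = insert 1 {1<..R}" by auto
  then show ?thesis using sum_powr_tail_le[of 1 R] by simp
qed simp

section \<open>Quadratic sums over arithmetic progressions\<close>

definition gauss_sum :: "int \<Rightarrow> nat \<Rightarrow> nat \<Rightarrow> real \<Rightarrow> complex" where
  "gauss_sum n0 p L t = (\<Sum>j<L. ee (t * (of_int (n0 + int p * int j))^2))"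

lemma continuous_on_ee: "continuous_on A f \<Longrightarrow> continuous_on A (\<lambda>x. ee (f x))"
  unfolding ee_def cis_conv_exp by (intro continuous_intros)

lemma continuous_on_gauss_sum: "continuous_on A (gauss_sum n0 p L)"
  unfolding gauss_sum_def by (intro continuous_intros continuous_on_ee)

lemma norm_gauss_sum_le: "norm (gauss_sum n0 p L t) \<le> real L"
  unfolding gauss_sum_def using norm_sum_ee_le[of _ "{..<L}"] by simp

lemma norm_gauss_sum:
  "norm (gauss_sum n0 p L t) = norm (\<Sum>j<L. ee ((real p)^2 * t * (real j)^2 + 2 * of_int n0 * real p * t * real j))"
proof -
  have "gauss_sum n0 p L t = (\<Sum>j<L. ee (t * (of_int n0)^2) * ee ((real p)^2 * t * (real j)^2 + 2 * of_int n0 * real p * t * real j))"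
    unfolding gauss_sum_def ee_add[symmetric]
    by (rule sum.cong) (auto intro!: arg_cong[where f = ee] simp: algebra_simps power2_eq_square)
  then show ?thesis by (simp add: sum_distrib_left[symmetric] norm_mult)
qed

text \<open>Dirichlet's theorem is applied to 2 p^2 t, twice the quadratic coefficient of the sum in
  j. The limit 2 L for the denominators yields the error 1 / (2 L) that the Weyl bound asks for, and
  t in [0, 1] confines h to finitely many values.\<close>

lemma gauss_sum_rational_approx:
  fixes p L :: nat and t :: real
  assumes p: "p \<ge> 1" and L: "L \<ge> 1" and t: "t \<in> {0..1}"
  obtains q :: nat and h :: int where "1 \<le> q" "q \<le> 2 * L" "0 \<le> h" "h \<le> 2 * int p ^ 2 * int q"
    "coprime h (int q)" "\<bar>real q * (2 * ((real p)^2 * t)) - of_int h\<bar> < 1 / (2 * real L)"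
proof -
  obtain h k where hk: "coprime h k" "0 < k" "k \<le> int (2 * L)"
    "\<bar>of_int k * (2 * ((real p)^2 * t)) - of_int h\<bar> < 1 / real (2 * L)"
    by (rule Dirichlet_approx_coprime[of "2 * L" "2 * ((real p)^2 * t)"]) (use L in auto)
  have "1 / real (2 * L) < 1" using L by simp
  then have lt: "\<bar>of_int k * (2 * ((real p)^2 * t)) - of_int h\<bar> < 1" using hk(4) by linarith
  have nn: "0 \<le> of_int k * (2 * ((real p)^2 * t))" using hk t by auto
  have "real_of_int h > -1" using lt nn by linarith
  then have h0: "h \<ge> 0" by linarith
  have "of_int k * (2 * ((real p)^2 * t)) \<le> of_int k * (2 * ((real p)^2 * 1))"
    using hk t by (intro mult_left_mono) auto
  then have "real_of_int h < of_int (2 * int p ^ 2 * k) + 1" using lt by (simp add: mult.commute mult.left_commute)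
  then have h1: "h \<le> 2 * int p ^ 2 * k" by linarith
  show ?thesis
    by (rule that[of "nat k" h]) (use hk h0 h1 in auto)
qed

lemma dirichlet_distance_eq:
  fixes p L q :: nat and h :: int and t :: real
  assumes p: "p \<ge> 1" and q: "q \<ge> 1"
  shows "(real L)^2 * \<bar>2 * ((real p)^2 * t) - of_int h / real q\<bar>
    = \<bar>2 * (real p)^2 * (real L)^2 * (t - of_int h / (2 * (real p)^2 * real q))\<bar>"
proof -
  have eq: "2 * (real p)^2 * (real L)^2 * (t - of_int h / (2 * (real p)^2 * real q)) = (real L)^2 * (2 * ((real p)^2 * t) - of_int h / real q)"
    using p q by (simp add: right_diff_distrib)
  show ?thesis unfolding eq abs_mult by simp
qed

text \<open>The weight of all fractions with denominator q: q^(-5/2) comes from the Weyl bound, and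
  1 / f h from integrating a kernel of width f h.\<close>

abbreviation row :: "nat \<Rightarrow> nat \<Rightarrow> (int \<Rightarrow> real) \<Rightarrow> real" where
  "row p q f \<equiv> real q powr (-5/2) * (\<Sum>h\<in>{0..2 * int p ^ 2 * int q}. 1 / f h)"

abbreviation fifth_moment :: "int \<Rightarrow> nat \<Rightarrow> nat \<Rightarrow> real" where
  "fifth_moment n0 p L \<equiv> integral {0..1} (\<lambda>t. norm (gauss_sum n0 p L t) ^ 5)"

text \<open>\<open>Y q h\<close> is the radius, in the rescaled variable x, of a neighbourhood of
  the fraction on which the sum is already known to be small; the value 1 means that nothing is
  claimed. Outside it 1 / (1 + x^2) is at most 2 / (Y^2 + x^2), whose integral is of order 1 / Y.
  Cancellation close to a fraction is thus converted into a smaller weight for that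
  fraction.\<close>

lemma fifth_moment_weighted:
  fixes p L :: nat and Y :: "nat \<Rightarrow> int \<Rightarrow> real"
  assumes p: "p \<ge> 1" and L: "L \<ge> 1" and Y: "\<And>q h. Y q h \<ge> 1" and E: "E \<ge> 0"
    and small: "\<And>t q h. \<lbrakk>1 \<le> q; q \<le> 2 * L; coprime h (int q); Y q h \<noteq> 1;
      \<bar>2 * (real p)^2 * (real L)^2 * (t - of_int h / (2 * (real p)^2 * real q))\<bar> \<le> Y q h\<rbrakk>
      \<Longrightarrow> norm (gauss_sum n0 p L t) ^ 5 \<le> E"
  shows "fifth_moment n0 p L
    \<le> weyl_const * (1 + pi) * (real L ^ 3 / (real p)^2 * (\<Sum>q\<in>{1..2*L}. row p q (Y q)) + real L powr (11/4)) + E"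
proof -
  define c where "c = 2 * (real p)^2 * (real L)^2"
  define z where "z = (\<lambda>(q::nat,h::int). of_int h / (2 * (real p)^2 * real q))"
  define I where "I = Sigma {1..2*L} (\<lambda>q. {0..2 * int p ^ 2 * int q})"
  define A where "A = (\<lambda>(q::nat,h::int). 2 * weyl_const * (real L ^ 5 * real q powr (-5/2)))"
  define E' where "E' = weyl_const * real L powr (11/4) + E"
  have c: "c > 0" using p L by (simp add: c_def)
  have Y0: "Y q h > 0" for q h using Y[of q h] by linarith
  have "fifth_moment n0 p L \<le> (\<Sum>i\<in>I. A i * (pi / (c * (case i of (q,h) \<Rightarrow> Y q h)))) + E'"
  proof (rule integral_le_sum_cauchy_kernels[where z = z])
    show "finite I" by (simp add: I_def)
    show "(\<lambda>t. norm (gauss_sum n0 p L t) ^ 5) integrable_on {0..1}"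
      by (intro integrable_continuous_interval continuous_intros continuous_on_gauss_sum)
    show "c > 0" by (rule c)
    show "(case i of (q,h) \<Rightarrow> Y q h) > 0" for i
      by (cases i) (simp add: Y0)
    show "A i \<ge> 0" for i using weyl_const_pos by (auto simp: A_def split: prod.splits)
    fix t :: real assume t: "t \<in> {0..1}"
    obtain q :: nat and h :: int where qh: "1 \<le> q" "q \<le> 2 * L" "0 \<le> h" "h \<le> 2 * int p ^ 2 * int q"
      "coprime h (int q)" "\<bar>real q * (2 * ((real p)^2 * t)) - of_int h\<bar> < 1 / (2 * real L)"
      by (rule gauss_sum_rational_approx[OF p L t])
    define x where "x = c * (t - z (q,h))"
    have I: "(q,h) \<in> I" using qh by (simp add: I_def)
    have "norm (gauss_sum n0 p L t) ^ 5 \<le> A (q,h) * (1 / ((Y q h)^2 + x^2)) + E'"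
    proof (cases "Y q h \<noteq> 1 \<and> \<bar>x\<bar> \<le> Y q h")
      case True
      then have "norm (gauss_sum n0 p L t) ^ 5 \<le> E"
        using small[OF qh(1,2,5)] by (simp add: x_def c_def z_def)
      moreover have "0 \<le> weyl_const * real L powr (11/4)" "0 \<le> A (q,h) * (1 / ((Y q h)^2 + x^2))"
        using weyl_const_pos by (auto simp: A_def)
      ultimately show ?thesis unfolding E'_def by linarith
    next
      case neg: False
      have "(Y q h)^2 + x^2 \<le> 2 * (1 + x^2)"
      proof (cases "Y q h = 1")
        case False
        then have "Y q h \<le> \<bar>x\<bar>" using neg by auto
        then have "(Y q h)^2 \<le> \<bar>x\<bar>^2" using Y[of q h] by (intro power_mono) auto
        then show ?thesis by simp
      qed auto
      moreover have "(Y q h)^2 > 0" using Y[of q h] by (intro zero_less_power) linarith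
      ultimately have frac: "1 / (1 + x^2) \<le> 2 * (1 / ((Y q h)^2 + x^2))"
        by (simp add: divide_simps add_pos_nonneg)
      have xx: "((real L)^2 * \<bar>2 * ((real p)^2 * t) - of_int h / real q\<bar>)^2 = x^2"
        unfolding dirichlet_distance_eq[OF p qh(1)] by (simp add: x_def c_def z_def)
      have "norm (gauss_sum n0 p L t) ^ 5 \<le> weyl_const * (real L ^ 5 * real q powr (-5/2) / (1 + x^2) + real L powr (11/4))"
        unfolding norm_gauss_sum xx[symmetric] by (rule weyl_fifth_power) (use qh L in auto)
      also have "... = weyl_const * (real L ^ 5 * real q powr (-5/2)) * (1 / (1 + x^2)) + weyl_const * real L powr (11/4)"
        by (simp add: distrib_left)
      also have "... \<le> weyl_const * (real L ^ 5 * real q powr (-5/2)) * (2 * (1 / ((Y q h)^2 + x^2))) + weyl_const * real L powr (11/4)"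
        by (intro add_right_mono mult_left_mono frac) (use weyl_const_pos in auto)
      also have "weyl_const * (real L ^ 5 * real q powr (-5/2)) * (2 * (1 / ((Y q h)^2 + x^2))) = A (q,h) * (1 / ((Y q h)^2 + x^2))"
        by (simp add: A_def)
      finally show ?thesis unfolding E'_def using E by linarith
    qed
    then show "\<exists>i\<in>I. norm (gauss_sum n0 p L t) ^ 5 \<le> A i * (1 / ((case i of (q,h) \<Rightarrow> Y q h)^2 + (c * (t - z i))^2)) + E'"
      using I unfolding x_def by (intro bexI[of _ "(q,h)"]) auto
  qed
  also have "(\<Sum>i\<in>I. A i * (pi / (c * (case i of (q,h) \<Rightarrow> Y q h))))
      = (\<Sum>q\<in>{1..2*L}. \<Sum>h\<in>{0..2 * int p ^ 2 * int q}. A (q,h) * (pi / (c * Y q h)))"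
    unfolding I_def by (subst sum.Sigma) (auto simp: case_prod_unfold)
  also have "... = (\<Sum>q\<in>{1..2*L}. (weyl_const * pi * (real L ^ 3 / (real p)^2)) * (row p q (Y q)))"
  proof (rule sum.cong[OF refl])
    fix q assume "q \<in> {1..2*L}"
    have "A (q,h) * (pi / (c * Y q h)) = (weyl_const * pi * (real L ^ 3 / (real p)^2)) * (real q powr (-5/2) * (1 / Y q h))" for h
      using L p by (simp add: A_def c_def power2_eq_square power3_eq_cube numeral_eq_Suc mult_ac)
    then show "(\<Sum>h\<in>{0..2 * int p ^ 2 * int q}. A (q,h) * (pi / (c * Y q h)))
       = (weyl_const * pi * (real L ^ 3 / (real p)^2)) * (row p q (Y q))"
      by (simp only: sum_distrib_left)
  qed
  also have "... = weyl_const * pi * (real L ^ 3 / (real p)^2 * (\<Sum>q\<in>{1..2*L}. row p q (Y q)))"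
    by (simp only: sum_distrib_left mult.assoc)
  finally have fin: "fifth_moment n0 p L
     \<le> weyl_const * pi * (real L ^ 3 / (real p)^2 * (\<Sum>q\<in>{1..2*L}. row p q (Y q))) + E'" .
  define U V where "U = real L ^ 3 / (real p)^2 * (\<Sum>q\<in>{1..2*L}. row p q (Y q))"
    and "V = real L powr (11/4)"
  have "0 \<le> 1 / Y q h" for q h using Y[of q h] by simp
  then have "U \<ge> 0" unfolding U_def by (intro mult_nonneg_nonneg sum_nonneg) auto
  then have "0 \<le> weyl_const * U" "0 \<le> weyl_const * pi * V" using weyl_const_pos by (auto simp: V_def)
  then have "weyl_const * pi * U + E' \<le> weyl_const * (1 + pi) * (U + V) + E" by (simp add: E'_def V_def[symmetric] algebra_simps)
  then show ?thesis using fin unfolding U_def[symmetric] V_def[symmetric] by linarith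
qed

text \<open>Here 25 = 24 + 1 and 20 ^ 5 are dictated by the bound with the gain 1 / p; the bound
  without it asks only for 9 + 1 in place of 25.\<close>

definition moment_const :: real where
  "moment_const = 25 * (weyl_const * (1 + pi)) + 20 ^ 5"

lemma weyl_pi_const_pos: "weyl_const * (1 + pi) > 0"
  by (intro mult_pos_pos add_pos_pos weyl_const_pos pi_gt_zero) simp

lemma moment_const_pos: "moment_const > 0"
  using weyl_pi_const_pos by (simp add: moment_const_def)

lemma powr_times_self: "q \<ge> 1 \<Longrightarrow> real q powr (-5/2) * (c * real q) = c * real q powr (-3/2)"
  using powr_add[of "real q" "-5/2" 1] by simp

lemma row_one_le:
  assumes "p \<ge> 1" "q \<ge> 1"
  shows "row p q (\<lambda>_. 1) \<le> 3 * (real p)^2 * real q powr (-3/2)"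
proof -
  have pq: "1 \<le> (real p)^2 * real q" using assms by (intro mult_ge1_I one_le_power) auto
  have "(\<Sum>h\<in>{0..2 * int p ^ 2 * int q}. 1 / (1::real)) = 2 * ((real p)^2 * real q) + 1"
    by (simp add: mult.assoc)
  also have "... \<le> 3 * (real p)^2 * real q" using pq by linarith
  finally have "row p q (\<lambda>_. 1) \<le> real q powr (-5/2) * (3 * (real p)^2 * real q)" by (intro mult_left_mono) auto
  then show ?thesis unfolding powr_times_self[OF assms(2)] .
qed

text \<open>All radii are 1. Each q has about 2 p^2 q numerators, and this p^2 cancels against the
  dilation 2 p^2 L^2 of the variable t, so the bound is uniform in p.\<close>

proposition fifth_moment_le:
  fixes p L :: nat
  assumes p: "p \<ge> 1" and L: "L \<ge> 1"
  shows "fifth_moment n0 p L \<le> moment_const * real L ^ 3"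
proof -
  define C where "C = weyl_const * (1 + pi)"
  note C = weyl_pi_const_pos[folded C_def]
  have "(\<Sum>q\<in>{1..2*L}. row p q (\<lambda>_. 1))
      \<le> (\<Sum>q\<in>{1..2*L}. 3 * (real p)^2 * real q powr (-3/2))"
  proof (rule sum_mono)
    fix q assume q: "q \<in> {1..2*L}"
    show "row p q (\<lambda>_. 1) \<le> 3 * (real p)^2 * real q powr (-3/2)"
      using p q by (intro row_one_le) auto
  qed
  also have "... = 3 * (real p)^2 * (\<Sum>q\<in>{1..2*L}. real q powr (-3/2))" by (simp add: sum_distrib_left)
  also have "... \<le> 3 * (real p)^2 * 3" by (intro mult_left_mono sum_powr_three_halves_le) auto
  finally have S: "(\<Sum>q\<in>{1..2*L}. row p q (\<lambda>_. 1)) \<le> 9 * (real p)^2"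
    by simp
  have "fifth_moment n0 p L
     \<le> C * ((real L) ^ 3 / (real p)^2 * (\<Sum>q\<in>{1..2*L}. row p q (\<lambda>_. 1))
          + real L powr (11/4)) + 0"
    unfolding C_def by (rule fifth_moment_weighted[where Y = "\<lambda>_ _. 1"]) (use p L in auto)
  also have "... \<le> C * ((real L) ^ 3 / (real p)^2 * (9 * (real p)^2) + real L ^ 3)"
  proof -
    have "real L powr (11/4) \<le> real L powr 3" using L by (intro powr_mono) auto
    then have L3: "real L powr (11/4) \<le> real L ^ 3" using L by simp
    have S3: "(real L) ^ 3 / (real p)^2 * (\<Sum>q\<in>{1..2*L}. row p q (\<lambda>_. 1))
      \<le> (real L) ^ 3 / (real p)^2 * (9 * (real p)^2)" by (intro mult_left_mono S) auto
    show ?thesis unfolding add_0_right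
      by (rule mult_left_mono[OF add_mono[OF S3 L3] less_imp_le[OF C]])
  qed
  also have "... = (10 * C) * real L ^ 3" using p by simp
  also have "... \<le> moment_const * real L ^ 3"
    using C by (intro mult_right_mono) (simp_all add: moment_const_def C_def)
  finally show ?thesis .
qed

section \<open>Cancellation near fractions and the gain of a factor p\<close>

lemma norm_one_minus_ee_fraction_ge:
  fixes p :: nat and m :: int
  assumes p: "p \<ge> 1" and m: "\<not> int p dvd m"
  shows "norm (1 - ee (of_int m / real p)) \<ge> 4 / real p"
proof -
  define r i where "r = m mod int p" and "i = m div int p"
  have mr: "m = i * int p + r" by (simp add: r_def i_def)
  have "r \<noteq> 0" using m by (simp add: r_def dvd_eq_mod_eq_0)
  moreover have "0 \<le> r" "r < int p" using p by (auto simp: r_def)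
  ultimately have r: "1 \<le> r" "r + 1 \<le> int p" by auto
  have r': "1 \<le> real_of_int r" "real_of_int r + 1 \<le> real p" using r by linarith+
  have mp: "of_int m / real p = of_int i + of_int r / real p" using p by (simp add: mr field_simps)
  show ?thesis
  proof (cases "2 * real_of_int r \<le> real p")
    case True
    have "ee (of_int m / real p) = ee (of_int r / real p)" unfolding mp ee_add by simp
    moreover have "norm (1 - ee (of_int r / real p)) \<ge> 4 * \<bar>of_int r / real p\<bar>"
      by (rule norm_one_minus_ee_ge) (use True r' p in \<open>simp add: field_simps\<close>)
    moreover have "4 / real p \<le> 4 * \<bar>of_int r / real p\<bar>" using r' p by (simp add: divide_right_mono)
    ultimately show ?thesis by simp
  next
    case False
    have "of_int m / real p = of_int (i + 1) + (of_int r - real p) / real p" using p by (simp add: mp field_simps)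
    then have "ee (of_int m / real p) = ee ((of_int r - real p) / real p)" by (simp only: ee_add ee_of_int mult_1)
    moreover have "norm (1 - ee ((of_int r - real p) / real p)) \<ge> 4 * \<bar>(of_int r - real p) / real p\<bar>"
      by (rule norm_one_minus_ee_ge) (use False r' p in \<open>simp add: field_simps abs_if\<close>)
    moreover have "4 / real p \<le> 4 * \<bar>(of_int r - real p) / real p\<bar>" using r' p by (simp add: abs_if divide_right_mono field_simps)
    ultimately show ?thesis by simp
  qed
qed

lemma norm_sum_shift_le:
  fixes f :: "nat \<Rightarrow> complex"
  assumes f: "\<And>j. norm (f j) \<le> 1"
  shows "norm ((\<Sum>j<L. f (j + m)) - (\<Sum>j<L. f j)) \<le> 2 * real m"
proof -
  have aux: "x - c = d - b" if "x + b = s" "c + d = s" for x b c d s :: complex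
    using that by (auto simp: algebra_simps)
  have "(\<Sum>j<L. f (j + m)) + (\<Sum>j<m. f j) = (\<Sum>j<L + m. f j)"
    by (induction L) (simp_all add: algebra_simps)
  moreover have "(\<Sum>j<L. f j) + (\<Sum>j<m. f (j + L)) = (\<Sum>j<L + m. f j)"
    by (induction m) (simp_all add: algebra_simps)
  ultimately have "(\<Sum>j<L. f (j + m)) - (\<Sum>j<L. f j) = (\<Sum>j<m. f (j + L)) - (\<Sum>j<m. f j)"
    by (rule aux)
  moreover have "norm (\<Sum>j<m. f (j + L)) \<le> real m" "norm (\<Sum>j<m. f j) \<le> real m"
    using sum_norm_bound[of "{..<m}" "\<lambda>j. f (j + L)" 1] sum_norm_bound[of "{..<m}" f 1] f by auto
  ultimately show ?thesis using norm_triangle_ineq4[of "\<Sum>j<m. f (j + L)" "\<Sum>j<m. f j"] by simp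
qed

text \<open>Close to \<open>h / (2 p\<^sup>2 q)\<close> with \<open>p\<close> not dividing \<open>2 n\<^sub>0 h\<close>, translating the summation variable by
  \<open>2 p q\<close> multiplies the sum by a root of unity different from \<open>1\<close>, which forces cancellation.\<close>

lemma norm_gauss_sum_cancellation:
  fixes p L q :: nat and n0 h :: int
  assumes p: "p \<ge> 1" and q: "q \<ge> 1" "q \<le> p^2" and L: "p ^ 7 \<le> L"
    and n0: "\<bar>n0\<bar> \<le> int p * int L" and nd: "\<not> int p dvd 2 * n0 * h"
    and close: "\<bar>2 * (real p)^2 * (real L)^2 * (t - of_int h / (2 * (real p)^2 * real q))\<bar> \<le> real p"
  shows "norm (gauss_sum n0 p L t) \<le> 20 * real p ^ 4"
proof -
  let ?G = "2 * real p * real q"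
  define y where "y = t - of_int h / (2 * (real p)^2 * real q)"
  define f where "f = (\<lambda>j::nat. ee (t * (of_int (n0 + int p * int j))^2))"
  define w where "w = ee (of_int (2 * n0 * h) / real p)"
  define g where "g = (\<lambda>j::nat. (2 * of_int (n0 + int p * int j) * ?G + ?G^2) * y)"
  define T where "T = gauss_sum n0 p L t"
  have T: "T = (\<Sum>j<L. f j)" by (simp add: T_def gauss_sum_def f_def)
  have p7: "1 \<le> p ^ 7" using p by simp
  then have L1: "L \<ge> 1" using L by linarith
  have pL2: "(real p)^2 \<le> real L"
  proof -
    have "p^2 \<le> p ^ 7" using p by (intro power_increasing) auto
    then have "p^2 \<le> L" using L by linarith
    then show ?thesis using of_nat_mono[of "p^2" L] by simp
  qed
  \<comment> \<open>Raising j by 2 q moves the squared integer by 2 p q. At h / (2 p^2 q) the phase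
    then changes by 2 n0 h / p up to an integer, the same for every j; what remains of t is
    collected in \<open>g j\<close>.\<close>
  have shift: "f (j + 2 * q) = w * f j * ee (g j)" for j
  proof -
    define n where "n = real_of_int (n0 + int p * int j)"
    have th: "t = of_int h / (2 * (real p)^2 * real q) + y" by (simp add: y_def)
    have m: "real_of_int (n0 + int p * int (j + 2 * q)) = n + ?G" by (simp add: n_def algebra_simps)
    have "of_int h / (2 * (real p)^2 * real q) * (2 * n * ?G + ?G^2)
        = 2 * n * of_int h / real p + 2 * of_int h * real q"
      using p q by (simp add: field_simps power2_eq_square)
    also have "2 * n * of_int h / real p = of_int (2 * n0 * h) / real p + 2 * real j * of_int h"
      using p by (simp add: n_def field_simps)
    finally have h1: "of_int h / (2 * (real p)^2 * real q) * (2 * n * ?G + ?G^2)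
       = of_int (2 * n0 * h) / real p + of_int (2 * int j * h + 2 * h * int q)" by simp
    have "t * (n + ?G)^2 = t * n^2 + t * (2 * n * ?G + ?G^2)"
      by (simp add: power2_eq_square algebra_simps)
    also have "t * (2 * n * ?G + ?G^2)
       = of_int h / (2 * (real p)^2 * real q) * (2 * n * ?G + ?G^2) + g j"
      unfolding g_def n_def[symmetric] by (subst th) (simp only: distrib_right mult.commute)
    finally have e: "t * (n + ?G)^2
       = t * n^2 + (of_int (2 * n0 * h) / real p + of_int (2 * int j * h + 2 * h * int q) + g j)"
      unfolding h1 .
    show ?thesis unfolding f_def m e n_def[symmetric] ee_add w_def ee_of_int by simp
  qed
  have bnd: "\<bar>2 * N * G + G^2\<bar> \<le> 2 * M * G + G^2" if "\<bar>N\<bar> \<le> M" "0 \<le> G" for N M G :: real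
  proof -
    have "\<bar>2 * N * G + G^2\<bar> \<le> \<bar>2 * N * G\<bar> + \<bar>G^2\<bar>" by (rule abs_triangle_ineq)
    also have "... = 2 * \<bar>N\<bar> * G + G^2" using that by (simp add: abs_mult)
    also have "... \<le> 2 * M * G + G^2" using that by (intro add_right_mono mult_right_mono) auto
    finally show ?thesis .
  qed
  have gj: "\<bar>g j\<bar> \<le> 6 * real p ^ 3 / real L" if j: "j < L" for j
  proof -
    have "\<bar>of_int (n0 + int p * int j)\<bar> \<le> 2 * real p * real L"
    proof -
      have "\<bar>n0 + int p * int j\<bar> \<le> \<bar>n0\<bar> + int p * int j" by (simp add: abs_if)
      also have "... \<le> int p * int L + int p * int L" using n0 j by (intro add_mono mult_left_mono) auto
      finally have "\<bar>n0 + int p * int j\<bar> \<le> 2 * int p * int L" by (simp add: algebra_simps)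
      then have "real_of_int \<bar>n0 + int p * int j\<bar> \<le> real_of_int (2 * int p * int L)" by (rule of_int_le_iff[THEN iffD2])
      then show ?thesis by simp
    qed
    then have "\<bar>2 * of_int (n0 + int p * int j) * ?G + ?G^2\<bar>
       \<le> 2 * (2 * real p * real L) * ?G + ?G^2"
      using bnd[of "real_of_int (n0 + int p * int j)" "2 * real p * real L" "?G"] by simp
    also have "... = 8 * (real p)^2 * real q * real L + 4 * (real p)^2 * (real q * real q)" by (simp add: power2_eq_square)
    also have "... \<le> 8 * (real p)^2 * (real p)^2 * real L + 4 * (real p)^2 * ((real p)^2 * real L)"
    proof -
      have "q \<le> L" using q(2) pL2 by (metis of_nat_le_iff of_nat_power order_trans)
      moreover have "real q \<le> (real p)^2" using q(2) by (metis of_nat_le_iff of_nat_power)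
      ultimately show ?thesis by (intro add_mono mult_mono) auto
    qed
    also have "... = 12 * real p ^ 4 * real L" by (simp add: power2_eq_square numeral_eq_Suc)
    finally have a: "\<bar>2 * of_int (n0 + int p * int j) * ?G + ?G^2\<bar> \<le> 12 * real p ^ 4 * real L" .
    have "2 * (real p)^2 * (real L)^2 * \<bar>y\<bar> \<le> real p" using close by (simp add: y_def abs_mult)
    then have b: "\<bar>y\<bar> \<le> 1 / (2 * real p * (real L)^2)" using p L1 by (simp add: field_simps power2_eq_square)
    have "\<bar>g j\<bar> \<le> (12 * real p ^ 4 * real L) * (1 / (2 * real p * (real L)^2))"
      unfolding g_def abs_mult by (rule mult_mono[OF a[unfolded abs_mult] b]) auto
    also have "... = 6 * real p ^ 3 / real L" using p L1 by (simp add: power2_eq_square numeral_eq_Suc)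
    finally show ?thesis .
  qed
  \<comment> \<open>The phases \<open>g j\<close> are of order p^3 / L, so the L terms together cost
    only of order p^3.\<close>
  have "norm ((\<Sum>j<L. f (j + 2 * q)) - w * T) \<le> 40 * real p ^ 3"
  proof -
    have "(\<Sum>j<L. f (j + 2 * q)) - w * T = (\<Sum>j<L. w * f j * (ee (g j) - 1))"
      unfolding shift T by (simp add: sum_distrib_left sum_subtractf right_diff_distrib)
    moreover have "norm (w * f j * (ee (g j) - 1)) \<le> 40 * real p ^ 3 / real L" if "j \<in> {..<L}" for j
    proof -
      have "norm (w * f j * (ee (g j) - 1)) = norm (1 - ee (g j))"
        by (simp add: norm_mult f_def w_def norm_minus_commute)
      also have "... \<le> 2 * pi * \<bar>g j\<bar>" by (rule norm_one_minus_ee_le)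
      also have "... \<le> (2 * 3.2) * (6 * real p ^ 3 / real L)"
        using that gj pi_less_4 pi_approx by (intro mult_mono) auto
      also have "... \<le> 40 * real p ^ 3 / real L" using p L1 by (simp add: field_simps)
      finally show ?thesis .
    qed
    then have "norm (\<Sum>j<L. w * f j * (ee (g j) - 1)) \<le> real (card {..<L}) * (40 * real p ^ 3 / real L)"
      by (rule sum_norm_bound)
    ultimately show ?thesis using L1 by simp
  qed
  moreover have "norm ((\<Sum>j<L. f (j + 2 * q)) - T) \<le> 4 * real p ^ 3"
  proof -
    have "norm ((\<Sum>j<L. f (j + 2 * q)) - T) \<le> 2 * real (2 * q)"
      unfolding T by (rule norm_sum_shift_le) (simp add: f_def)
    also have "... \<le> 4 * real p ^ 3"
    proof -
      have "p^2 \<le> p ^ 3" using p by (intro power_increasing) auto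
      then have "q \<le> p ^ 3" using q by linarith
      then have "real q \<le> real (p ^ 3)" by (rule of_nat_mono)
      then show ?thesis by simp
    qed
    finally show ?thesis .
  qed
  \<comment> \<open>The shifted sum is close both to w T and to T. Dividing by |1 - w| >= 4 / p
    costs one more power of p.\<close>
  ultimately have "norm (T - w * T) \<le> 44 * real p ^ 3"
    using norm_triangle_ineq4[of "(\<Sum>j<L. f (j + 2 * q)) - w * T" "(\<Sum>j<L. f (j + 2 * q)) - T"] by simp
  moreover have "norm (T - w * T) = norm T * norm (1 - w)"
    by (metis norm_mult mult.commute right_diff_distrib mult.right_neutral)
  moreover have "norm T * (4 / real p) \<le> norm T * norm (1 - w)"
    unfolding w_def by (intro mult_left_mono norm_one_minus_ee_fraction_ge[OF p nd]) auto
  ultimately have "norm T * (4 / real p) \<le> 44 * real p ^ 3" by linarith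
  then have "norm T \<le> 11 * real p ^ 4" using p by (simp add: field_simps numeral_eq_Suc)
  also have "... \<le> 20 * real p ^ 4" by (intro mult_right_mono) auto
  finally show ?thesis by (simp add: T_def)
qed

text \<open>For q <= p^2 the cancellation allows the radius p unless p divides h. Of about 2 p^2 q
  numerators only about 2 p q keep full weight, so the row is smaller by a factor of order p. For q
  > p^2 the tail of the sum of q^(-3/2) gives the same saving. The condition p^7 <= L makes the
  exceptional value (20 p^4)^5 at most 20^5 L^3 / p.\<close>

proposition fifth_moment_gain:
  fixes p L :: nat
  assumes pr: "prime p" and p2: "p > 2" and pL: "p ^ 7 \<le> L" and n0: "\<not> int p dvd n0" "\<bar>n0\<bar> \<le> int p * int L"
  shows "fifth_moment n0 p L \<le> moment_const * (real L ^ 3 / real p)"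
proof -
  define C where "C = weyl_const * (1 + pi)"
  note C = weyl_pi_const_pos[folded C_def]
  define Y where "Y = (\<lambda>(q::nat) h. if int p dvd h \<or> p^2 < q then 1 else real p)"
  define E where "E = (20 * real p ^ 4) ^ 5"
  have p1: "p \<ge> 1" using p2 by simp
  have "p ^ 7 \<ge> 1" using p1 by simp
  then have L1: "L \<ge> 1" using pL by linarith
  have row: "row p q (Y q)
      \<le> 6 * real p * real q powr (-3/2) + (if p^2 < q then 3 * (real p)^2 * real q powr (-3/2) else 0)"
    if q: "q \<ge> 1" for q
  proof -
    have pq: "1 \<le> real p * real q" using p1 q by (intro mult_ge1_I) auto
    have ppq: "1 \<le> (real p)^2 * real q" using p1 q by (intro mult_ge1_I one_le_power) auto
    show ?thesis
    proof (cases "p^2 < q")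
      case True
      then have "Y q = (\<lambda>_. 1)" by (auto simp: Y_def)
      then show ?thesis using row_one_le[OF p1 q] True by (simp add: add_increasing)
    next
      case False
      let ?H = "{0..2 * int p ^ 2 * int q}"
      have "(\<Sum>h\<in>?H. 1 / Y q h) \<le> (\<Sum>h\<in>?H. (if int p dvd h then 1 else 0) + 1 / real p)"
        using False by (intro sum_mono) (auto simp: Y_def)
      also have "... = real (card {h\<in>?H. int p dvd h}) + real (card ?H) * (1 / real p)"
        by (simp add: sum.distrib sum.inter_filter[symmetric])
      also have "{h\<in>?H. int p dvd h} = (\<lambda>i. int p * i) ` {0..2 * int p * int q}"
      proof (intro equalityI subsetI)
        fix h assume "h \<in> {h\<in>?H. int p dvd h}"
        then obtain i where hi: "h = int p * i" and h: "0 \<le> h" "h \<le> 2 * int p ^ 2 * int q"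
          by (auto elim: dvdE)
        have "2 * int p ^ 2 * int q = int p * (2 * int p * int q)" by (simp add: power2_eq_square)
        then have i: "h = int p * i" "0 \<le> int p * i" "int p * i \<le> int p * (2 * int p * int q)"
          using hi h by metis+
        then have "0 \<le> i" "i \<le> 2 * int p * int q" using p1 by (auto simp: zero_le_mult_iff)
        then show "h \<in> (\<lambda>i. int p * i) ` {0..2 * int p * int q}" using i by auto
      next
        fix h assume "h \<in> (\<lambda>i. int p * i) ` {0..2 * int p * int q}"
        then obtain i where i: "h = int p * i" "i \<in> {0..2 * int p * int q}" by (rule imageE)
        then have "int p * i \<le> int p * (2 * int p * int q)" by (intro mult_left_mono) auto
        also have "... = 2 * int p ^ 2 * int q" by (simp add: power2_eq_square)
        finally show "h \<in> {h\<in>?H. int p dvd h}" using i by simp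
      qed
      also have "card ((\<lambda>i. int p * i) ` {0..2 * int p * int q}) = card {0..2 * int p * int q}"
        by (rule card_image) (use p1 in \<open>auto simp: inj_on_def\<close>)
      also have "real (card {0..2 * int p * int q}) = 2 * (real p * real q) + 1" by (simp add: mult.assoc)
      also have "real (card ?H) = 2 * ((real p)^2 * real q) + 1" by (simp add: mult.assoc)
      also have "(2 * ((real p)^2 * real q) + 1) * (1 / real p) \<le> (3 * ((real p)^2 * real q)) * (1 / real p)"
      proof (rule mult_right_mono)
        show "2 * ((real p)^2 * real q) + 1 \<le> 3 * ((real p)^2 * real q)" using ppq by linarith
      qed simp
      also have "... = 3 * (real p * real q)" using p1 by (simp add: power2_eq_square)
      also have "2 * (real p * real q) + 1 + 3 * (real p * real q) \<le> 6 * real p * real q" using pq by linarith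
      finally have "real q powr (-5/2) * (\<Sum>h\<in>?H. 1 / Y q h) \<le> real q powr (-5/2) * (6 * real p * real q)"
        by (intro mult_left_mono) auto
      also have "... = 6 * real p * real q powr (-3/2)" by (rule powr_times_self[OF q])
      finally show ?thesis using False by simp
    qed
  qed
  have "(\<Sum>q\<in>{1..2*L}. row p q (Y q))
    \<le> (\<Sum>q\<in>{1..2*L}. 6 * real p * real q powr (-3/2) + (if p^2 < q then 3 * (real p)^2 * real q powr (-3/2) else 0))"
    by (rule sum_mono, rule row) simp
  also have "... = 6 * real p * (\<Sum>q\<in>{1..2*L}. real q powr (-3/2)) + (\<Sum>q\<in>{1..2*L}. if p^2 < q then 3 * (real p)^2 * real q powr (-3/2) else 0)"
    by (simp add: sum.distrib sum_distrib_left)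
  also have "(\<Sum>q\<in>{1..2*L}. if p^2 < q then 3 * (real p)^2 * real q powr (-3/2) else 0)
     = (\<Sum>q\<in>{p^2<..2*L}. 3 * (real p)^2 * real q powr (-3/2))"
  proof -
    have "{q\<in>{1..2*L}. p^2 < q} = {p^2<..2*L}" by auto
    then show ?thesis by (simp add: sum.inter_filter[symmetric])
  qed
  also have "... = 3 * (real p)^2 * (\<Sum>q\<in>{p^2<..2*L}. real q powr (-3/2))" by (simp add: sum_distrib_left)
  also have "... \<le> 3 * (real p)^2 * (2 * real (p^2) powr (-1/2))"
    by (intro mult_left_mono sum_powr_tail_le) (use p1 in auto)
  also have "real (p^2) powr (-1/2) = 1 / real p"
  proof -
    have "real (p^2) powr (-1/2) = 1 / (real (p^2)) powr (1/2)" by (simp add: powr_minus_divide)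
    also have "(real (p^2)) powr (1/2) = real p" by (simp add: powr_half_sqrt)
    finally show ?thesis .
  qed
  also have "3 * (real p)^2 * (2 * (1 / real p)) = 6 * real p" using p1 by (simp add: power2_eq_square)
  also have "6 * real p * (\<Sum>q\<in>{1..2*L}. real q powr (-3/2)) \<le> 6 * real p * 3"
    by (intro mult_left_mono sum_powr_three_halves_le) auto
  finally have S: "(\<Sum>q\<in>{1..2*L}. row p q (Y q)) \<le> 24 * real p"
    by simp
  have "real (p ^ 7) \<le> real L" by (rule of_nat_mono[OF pL])
  then have pL': "real p ^ 7 \<le> real L" by simp
  have L3: "real L powr (11/4) \<le> real L ^ 3 / real p"
  proof -
    have "real p ^ 4 \<le> real p ^ 7" using p1 by (intro power_increasing) auto
    then have "real p ^ 4 \<le> real L" using pL' by linarith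
    then have "(real p ^ 4) powr (1/4) \<le> real L powr (1/4)" by (intro powr_mono2) auto
    moreover have "(real p ^ 4) powr (1/4) = real p"
    proof -
      have "(real p ^ 4) powr (1/4) = (real p powr 4) powr (1/4)" using p1 by simp
      also have "... = real p" using p1 by (simp only: powr_powr) simp
      finally show ?thesis .
    qed
    ultimately have "real L powr (11/4) * real p \<le> real L powr (11/4) * real L powr (1/4)"
      by (intro mult_left_mono) auto
    also have "... = real L powr 3" by (simp only: powr_add[symmetric]) simp
    also have "... = real L ^ 3" using L1 by simp
    finally show ?thesis using p1 by (simp add: field_simps)
  qed
  have E: "E \<le> 20 ^ 5 * (real L ^ 3 / real p)"
  proof -
    have "(real p ^ 7) ^ 3 \<le> real L ^ 3" using pL' by (intro power_mono) auto
    then have "real p ^ 20 * real p \<le> real L ^ 3" by (simp add: power_mult[symmetric] power_Suc2[symmetric])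
    then have "real p ^ 20 \<le> real L ^ 3 / real p" using p1 by (simp add: field_simps)
    then show ?thesis by (simp add: E_def power_mult_distrib power_mult[symmetric])
  qed
  have "fifth_moment n0 p L
     \<le> C * ((real L) ^ 3 / (real p)^2 * (\<Sum>q\<in>{1..2*L}. row p q (Y q))
          + real L powr (11/4)) + E"
  unfolding C_def
  proof (rule fifth_moment_weighted[OF p1 L1])
    show "Y q h \<ge> 1" for q h using p1 by (simp add: Y_def)
    show "E \<ge> 0" by (simp add: E_def)
    fix t :: real and q :: nat and h :: int
    assume q: "1 \<le> q" and Y1: "Y q h \<noteq> 1"
      and close: "\<bar>2 * (real p)^2 * (real L)^2 * (t - of_int h / (2 * (real p)^2 * real q))\<bar> \<le> Y q h"
    have h: "\<not> int p dvd h" "q \<le> p^2" using Y1 by (auto simp: Y_def split: if_splits)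
    have prp: "prime (int p)" using pr by simp
    have "\<not> int p dvd 2" using p2 zdvd_imp_le[of "int p" 2] by auto
    then have "\<not> int p dvd 2 * n0 * h" using n0(1) h(1) by (simp add: prime_dvd_mult_iff[OF prp])
    moreover have "Y q h = real p" using h by (simp add: Y_def)
    ultimately have "norm (gauss_sum n0 p L t) \<le> 20 * real p ^ 4"
      using norm_gauss_sum_cancellation[OF p1 q h(2) pL n0(2)] close by simp
    then show "norm (gauss_sum n0 p L t) ^ 5 \<le> E" unfolding E_def by (intro power_mono) auto
  qed
  also have "... \<le> C * ((real L) ^ 3 / (real p)^2 * (24 * real p) + real L ^ 3 / real p) + 20 ^ 5 * (real L ^ 3 / real p)"
    by (intro add_mono mult_left_mono L3 E S) (use C in auto)
  also have "(real L) ^ 3 / (real p)^2 * (24 * real p) = 24 * (real L ^ 3 / real p)"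
    using p1 by (simp add: power2_eq_square)
  finally show ?thesis unfolding moment_const_def C_def[symmetric] by (simp add: algebra_simps)
qed

section \<open>Lattice points on spheres in arithmetic progressions\<close>

lemma integral_ee_int:
  "((\<lambda>t. ee (t * of_int m)) has_integral (if m = 0 then 1 else 0)) {0..1}"
proof (cases "m = 0")
  case True
  then show ?thesis using has_integral_const_real[of "1::complex" 0 1] by simp
next
  case False
  define c where "c = 2 * of_real pi * \<i> * of_int m"
  have c: "c \<noteq> 0" using False by (simp add: c_def)
  have ee: "ee (t * of_int m) = exp (c * of_real t)" for t
    by (simp add: ee_def cis_conv_exp c_def mult_ac)
  have "((\<lambda>t. exp (c * of_real t)) has_integral exp (c * of_real 1) / c - exp (c * of_real 0) / c) {0..1}"
  proof (rule fundamental_theorem_of_calculus)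
    fix x :: real
    have "((\<lambda>z. exp (c * z) / c) has_field_derivative exp (c * of_real x)) (at (of_real x))"
      using c by (auto intro!: derivative_eq_intros)
    then show "((\<lambda>t. exp (c * of_real t) / c) has_vector_derivative exp (c * of_real x)) (at x within {0..1})"
      by (rule has_vector_derivative_real_field)
  qed simp
  moreover have "exp (c * of_real 1) = 1" using ee[of 1] by simp
  ultimately show ?thesis using False by (simp add: ee)
qed

text \<open>By orthogonality the count is the integral of the product of one-coordinate sums against
  the character of frequency -l. Taking absolute values removes this character, so the bound is
  uniform in l.\<close>

lemma circle_method_bound:
  fixes n0 :: "'d::finite \<Rightarrow> int" and p L :: "'d \<Rightarrow> nat" and l :: int
  shows "real (card {J \<in> UNIV \<rightarrow>\<^sub>E (UNIV :: nat set). (\<forall>i. J i < L i) \<and> (\<Sum>i\<in>UNIV. (n0 i + int (p i) * int (J i))^2) = l})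
    \<le> integral {0..1} (\<lambda>t. \<Prod>i\<in>UNIV. norm (gauss_sum (n0 i) (p i) (L i) t))"
proof -
  define P where "P = PiE (UNIV :: 'd set) (\<lambda>i. {..<L i})"
  define Q where "Q = (\<lambda>J::'d \<Rightarrow> nat. \<Sum>i\<in>UNIV. (n0 i + int (p i) * int (J i))^2)"
  let ?T = "\<lambda>i. gauss_sum (n0 i) (p i) (L i)"
  have finP: "finite P" unfolding P_def by (intro finite_PiE) auto
  have set: "{J \<in> UNIV \<rightarrow>\<^sub>E (UNIV :: nat set). (\<forall>i. J i < L i) \<and> (\<Sum>i\<in>UNIV. (n0 i + int (p i) * int (J i))^2) = l}
      = {J\<in>P. Q J = l}"
    by (auto simp: P_def PiE_def Q_def)
  have prod: "ee (t * of_int (- l)) * (\<Prod>i\<in>UNIV. ?T i t) = (\<Sum>J\<in>P. ee (t * of_int (Q J - l)))" for t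
  proof -
    have "(\<Prod>i\<in>UNIV. ?T i t) = (\<Sum>J\<in>P. \<Prod>i\<in>UNIV. ee (t * (of_int (n0 i + int (p i) * int (J i)))^2))"
      unfolding gauss_sum_def P_def by (rule prod_sum_PiE) auto
    also have "... = (\<Sum>J\<in>P. ee (t * of_int (Q J)))"
    proof (rule sum.cong[OF refl])
      fix J
      have "(\<Prod>i\<in>A. ee (f i)) = ee (sum f A)" if "finite A" for A and f :: "'d \<Rightarrow> real"
        using that by induction (simp_all add: ee_add)
      then show "(\<Prod>i\<in>UNIV. ee (t * (of_int (n0 i + int (p i) * int (J i)))^2)) = ee (t * of_int (Q J))"
        by (simp add: Q_def sum_distrib_left)
    qed
    finally show ?thesis
      by (simp add: sum_distrib_left ee_add[symmetric] algebra_simps)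
  qed
  have "((\<lambda>t. \<Sum>J\<in>P. ee (t * of_int (Q J - l))) has_integral (\<Sum>J\<in>P. if Q J - l = 0 then 1 else 0)) {0..1}"
    by (intro has_integral_sum finP integral_ee_int)
  moreover have "(\<Sum>J\<in>P. if Q J - l = 0 then 1 else (0::complex)) = of_nat (card {J\<in>P. Q J = l})"
    using finP by (simp add: sum.inter_filter[symmetric])
  ultimately have "((\<lambda>t. ee (t * of_int (- l)) * (\<Prod>i\<in>UNIV. ?T i t)) has_integral of_nat (card {J\<in>P. Q J = l})) {0..1}"
    unfolding prod by simp
  then have eq: "of_nat (card {J\<in>P. Q J = l}) = integral {0..1} (\<lambda>t. ee (t * of_int (- l)) * (\<Prod>i\<in>UNIV. ?T i t))"
    and int: "(\<lambda>t. ee (t * of_int (- l)) * (\<Prod>i\<in>UNIV. ?T i t)) integrable_on {0..1}"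
    by (auto simp: integral_unique)
  have "real (card {J\<in>P. Q J = l}) = norm (integral {0..1} (\<lambda>t. ee (t * of_int (- l)) * (\<Prod>i\<in>UNIV. ?T i t)))"
    unfolding eq[symmetric] by simp
  also have "... \<le> integral {0..1} (\<lambda>t. \<Prod>i\<in>UNIV. norm (?T i t))"
  proof (rule integral_norm_bound_integral[OF int])
    show "(\<lambda>t. \<Prod>i\<in>UNIV. norm (?T i t)) integrable_on {0..1}"
      by (intro integrable_continuous_interval continuous_intros continuous_on_gauss_sum)
    show "norm (ee (t * of_int (- l)) * (\<Prod>i\<in>UNIV. ?T i t)) \<le> (\<Prod>i\<in>UNIV. norm (?T i t))" for t
      unfolding norm_mult norm_ee prod_norm[symmetric] by simp
  qed
  finally show ?thesis unfolding set .
qed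

text \<open>A substitute for Hoelder's inequality: every factor w i * x i is at most the largest
  one, and the power of the largest is one of the summands.\<close>

lemma prod_le_sum_weighted_powers:
  fixes x w :: "'d::finite \<Rightarrow> real"
  assumes x: "\<And>i. x i \<ge> 0" and w: "\<And>i. w i \<ge> 0" "(\<Prod>i\<in>UNIV. w i) = 1"
  shows "(\<Prod>i\<in>UNIV. x i) \<le> (\<Sum>i\<in>UNIV. (w i * x i) ^ CARD('d))"
proof -
  define M where "M = Max (range (\<lambda>i. w i * x i))"
  have le: "w i * x i \<le> M" for i unfolding M_def by (rule Max_ge) auto
  have "M \<in> range (\<lambda>i. w i * x i)" unfolding M_def by (rule Max_in) auto
  then obtain i0 where i0: "M = w i0 * x i0" by auto
  have "(\<Prod>i\<in>UNIV. x i) = (\<Prod>i\<in>UNIV. w i * x i)" by (simp add: prod.distrib w)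
  also have "... \<le> (\<Prod>i\<in>(UNIV::'d set). M)" by (rule prod_mono) (use x w le in auto)
  also have "... = (w i0 * x i0) ^ CARD('d)" by (simp add: i0)
  also have "... \<le> (\<Sum>i\<in>UNIV. (w i * x i) ^ CARD('d))"
    by (rule member_le_sum[where f = "\<lambda>i. (w i * x i) ^ CARD('d)"]) (use x w in auto)
  finally show ?thesis .
qed

lemma mem_lattice_sphere_iff: "n \<in> lattice_sphere l \<longleftrightarrow> (\<Sum>i\<in>UNIV. (n $ i)^2) = int l"
  unfolding lattice_sphere_def lattice_norm_sq mem_Collect_eq
  using of_int_eq_iff[of "\<Sum>i\<in>UNIV. (n $ i)^2" "int l", where 'a = real] by simp

lemma lattice_sphere_component_le:
  assumes n: "n \<in> lattice_sphere l" and X: "l < (X + 1)^2"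
  shows "\<bar>n $ i\<bar> \<le> int X"
proof (rule ccontr)
  assume "\<not> ?thesis"
  then have "(int X + 1)^2 \<le> \<bar>n $ i\<bar>^2" by (intro power_mono) auto
  also have "... = (n $ i)^2" by simp
  also have "... \<le> (\<Sum>i\<in>UNIV. (n $ i)^2)" by (rule member_le_sum) auto
  also have "... = int l" using n by (simp add: mem_lattice_sphere_iff)
  finally have "int ((X + 1)^2) \<le> int l" by (simp add: add.commute)
  then show False using X by linarith
qed

text \<open>The weights \<open>w\<close> balance coordinates that are restricted to progressions of different density.\<close>

proposition card_sphere_progression_le:
  fixes m :: "'d::finite \<Rightarrow> nat" and a :: "'d \<Rightarrow> int" and l X :: nat
  assumes d: "CARD('d) \<ge> 5" and m: "\<And>i. m i \<ge> 1"
    and w: "\<And>i. w i \<ge> 0" "(\<Prod>i\<in>UNIV. w i) = 1"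
    and X: "l < (X + 1)^2"
  defines "L \<equiv> \<lambda>i. 2 * X div m i + 1" and "n0 \<equiv> \<lambda>i. (a i + int X) mod int (m i) - int X"
  assumes M: "\<And>i. fifth_moment (n0 i) (m i) (L i) \<le> M i"
  shows "real (card {n \<in> (lattice_sphere l :: (int ^ 'd) set). \<forall>i. int (m i) dvd n $ i - a i})
     \<le> (\<Sum>i\<in>UNIV. w i ^ CARD('d) * (real (L i) ^ (CARD('d) - 5) * M i))"
proof -
  let ?T = "\<lambda>i. gauss_sum (n0 i) (m i) (L i)"
  let ?R = "{n \<in> (lattice_sphere l :: (int ^ 'd) set). \<forall>i. int (m i) dvd n $ i - a i}"
  let ?K = "{J \<in> UNIV \<rightarrow>\<^sub>E (UNIV :: nat set). (\<forall>i. J i < L i) \<and> (\<Sum>i\<in>UNIV. (n0 i + int (m i) * int (J i))^2) = int l}"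
  have fin: "finite ?K"
  proof (rule finite_subset)
    show "?K \<subseteq> PiE UNIV (\<lambda>i. {..<L i})" by auto
    show "finite (PiE (UNIV :: 'd set) (\<lambda>i. {..<L i}))" by (intro finite_PiE) auto
  qed
  \<comment> \<open>\<open>n0 i\<close> is the least integer not below -X that is congruent to
    \<open>a i\<close>, so a component of n has a nonnegative index in the progression. At most 2 X
    div m i + 1 members fit into [-X, X], which bounds the index by \<open>L i\<close>.\<close>
  define \<phi> where "\<phi> = (\<lambda>(n::int ^ 'd) i. nat ((n $ i - n0 i) div int (m i)))"
  have key: "n $ i = n0 i + int (m i) * int (\<phi> n i)" "\<phi> n i < L i" if n: "n \<in> ?R" for n i
  proof -
    have mi: "int (m i) > 0" using m[of i] by simp
    have "int (m i) dvd n0 i - a i"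
    proof -
      have "n0 i - a i = - ((a i + int X) - (a i + int X) mod int (m i))" by (simp add: n0_def)
      then show ?thesis by (simp only: dvd_minus_iff dvd_minus_mod)
    qed
    moreover have "int (m i) dvd n $ i - a i" using n by auto
    ultimately have "int (m i) dvd (n $ i - a i) - (n0 i - a i)" using dvd_diff by blast
    then have dv: "int (m i) dvd n $ i - n0 i" by simp
    have absn: "\<bar>n $ i\<bar> \<le> int X" using n lattice_sphere_component_le[OF _ X] by blast
    have n0b: "- int X \<le> n0 i" "n0 i < int (m i) - int X" using mi by (auto simp: n0_def)
    have "n $ i - n0 i > - int (m i)" using absn n0b by linarith
    then have gt: "n0 i - n $ i < int (m i)" by simp
    have nn: "n $ i - n0 i \<ge> 0"
    proof (rule ccontr)
      assume "\<not> ?thesis"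
      then have "0 < n0 i - n $ i" by simp
      moreover have "int (m i) dvd n0 i - n $ i" using dv by (simp add: dvd_diff_commute)
      ultimately show False using gt zdvd_not_zless by blast
    qed
    then have "int (m i) * ((n $ i - n0 i) div int (m i)) = n $ i - n0 i" using dv by simp
    moreover have q0: "(n $ i - n0 i) div int (m i) \<ge> 0" using nn mi by (simp add: pos_imp_zdiv_nonneg_iff)
    ultimately show "n $ i = n0 i + int (m i) * int (\<phi> n i)" by (simp add: \<phi>_def)
    have "(n $ i - n0 i) div int (m i) \<le> (2 * int X) div int (m i)"
      using absn n0b mi by (intro zdiv_mono1) auto
    also have "... < int (L i)" by (simp add: L_def zdiv_int)
    finally show "\<phi> n i < L i" using q0 by (simp add: \<phi>_def)
  qed
  have inj: "inj_on \<phi> ?R"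
  proof
    fix n n' assume n: "n \<in> ?R" and n': "n' \<in> ?R" and eq: "\<phi> n = \<phi> n'"
    have "n $ i = n' $ i" for i
    proof -
      have "n $ i = n0 i + int (m i) * int (\<phi> n i)" by (rule key(1)[OF n])
      also have "... = n' $ i" unfolding eq by (rule key(1)[OF n', symmetric])
      finally show ?thesis .
    qed
    then show "n = n'" by (simp add: vec_eq_iff)
  qed
  have "card ?R \<le> card ?K"
  proof (rule card_inj_on_le[OF inj _ fin])
    show "\<phi> ` ?R \<subseteq> ?K"
    proof (intro image_subsetI CollectI conjI allI)
      fix n assume n: "n \<in> ?R"
      show "\<phi> n \<in> UNIV \<rightarrow>\<^sub>E (UNIV :: nat set)" by auto
      show "\<phi> n i < L i" for i by (rule key(2)[OF n])
      show "(\<Sum>i\<in>UNIV. (n0 i + int (m i) * int (\<phi> n i))^2) = int l"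
        unfolding key(1)[OF n, symmetric] using n by (simp add: mem_lattice_sphere_iff)
    qed
  qed
  then have "real (card ?R) \<le> real (card ?K)" by simp
  also have "... \<le> integral {0..1} (\<lambda>t. \<Prod>i\<in>UNIV. norm (?T i t))" by (rule circle_method_bound)
  also have "... \<le> integral {0..1} (\<lambda>t. \<Sum>i\<in>UNIV. w i ^ CARD('d) * (real (L i) ^ (CARD('d) - 5) * norm (?T i t) ^ 5))"
  proof (rule integral_le)
    show "(\<lambda>t. \<Prod>i\<in>UNIV. norm (?T i t)) integrable_on {0..1}"
      by (intro integrable_continuous_interval continuous_intros continuous_on_gauss_sum)
    show "(\<lambda>t. \<Sum>i\<in>UNIV. w i ^ CARD('d) * (real (L i) ^ (CARD('d) - 5) * norm (?T i t) ^ 5)) integrable_on {0..1}"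
      by (intro integrable_continuous_interval continuous_intros continuous_on_gauss_sum)
    fix t :: real
    have "(\<Prod>i\<in>UNIV. norm (?T i t)) \<le> (\<Sum>i\<in>UNIV. (w i * norm (?T i t)) ^ CARD('d))"
      by (rule prod_le_sum_weighted_powers) (use w in auto)
    also have "... \<le> (\<Sum>i\<in>UNIV. w i ^ CARD('d) * (real (L i) ^ (CARD('d) - 5) * norm (?T i t) ^ 5))"
    proof (rule sum_mono)
      fix i
      \<comment> \<open>Five factors are kept for the moment and the other d - 5 are bounded by the
        length; with a fifth moment of order L^3 this amounts to L^(d - 2).\<close>
      have "norm (?T i t) ^ CARD('d) = norm (?T i t) ^ (CARD('d) - 5) * norm (?T i t) ^ 5"
        using d by (simp add: power_add[symmetric])
      also have "... \<le> real (L i) ^ (CARD('d) - 5) * norm (?T i t) ^ 5"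
        by (intro mult_right_mono power_mono norm_gauss_sum_le) auto
      finally show "(w i * norm (?T i t)) ^ CARD('d) \<le> w i ^ CARD('d) * (real (L i) ^ (CARD('d) - 5) * norm (?T i t) ^ 5)"
        using w(1)[of i] by (simp add: power_mult_distrib mult_left_mono)
    qed
    finally show "(\<Prod>i\<in>UNIV. norm (?T i t)) \<le> (\<Sum>i\<in>UNIV. w i ^ CARD('d) * (real (L i) ^ (CARD('d) - 5) * norm (?T i t) ^ 5))" .
  qed
  also have "... = (\<Sum>i\<in>UNIV. integral {0..1} (\<lambda>t. w i ^ CARD('d) * (real (L i) ^ (CARD('d) - 5) * norm (?T i t) ^ 5)))"
    by (intro integral_sum integrable_continuous_interval continuous_intros continuous_on_gauss_sum) auto
  also have "... = (\<Sum>i\<in>UNIV. w i ^ CARD('d) * (real (L i) ^ (CARD('d) - 5) * integral {0..1} (\<lambda>t. norm (?T i t) ^ 5)))"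
    by (simp only: integral_mult_right)
  also have "... \<le> (\<Sum>i\<in>UNIV. w i ^ CARD('d) * (real (L i) ^ (CARD('d) - 5) * M i))"
    by (intro sum_mono mult_left_mono M) (use w in auto)
  finally show ?thesis .
qed

section \<open>Primes not dividing given integers\<close>

text \<open>Nair's argument with Leibniz's harmonic triangle: the reciprocal of (k + 1) binom(n, k +
  1) is the difference of the reciprocals of k binom(n - 1, k) and k binom(n, k), and the triangle
  starts with 1 / n. Multiplied by the fixed number Lcm {1..N}, integrality passes from k to k + 1
  for all n up to N.\<close>

lemma binomial_times_dvd_Lcm:
  fixes k n :: nat
  assumes "1 \<le> k" "k \<le> n"
  shows "k * (n choose k) dvd Lcm {1..n}"
proof -
  have main: "\<exists>z::int. real (Lcm {1..N}) / (real k * real (n choose k)) = of_int z"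
    if "1 \<le> k" "k \<le> n" "n \<le> N" for N k n :: nat
    using that
  proof (induction k arbitrary: n rule: dec_induct)
    case base
    then have "n dvd Lcm {1..N}" by (intro dvd_Lcm) auto
    then obtain c where "Lcm {1..N} = n * c" by auto
    then have "real (Lcm {1..N}) / (real 1 * real (n choose 1)) = of_int (int c)" using base by simp
    then show ?case by blast
  next
    case (step k)
    define m where "m = n - 1"
    have n: "n = Suc m" "k \<le> m" using step by (auto simp: m_def)
    define D where "D = real (Lcm {1..N})"
    obtain y z :: int where y: "D / (real k * real (m choose k)) = of_int y" and z: "D / (real k * real (n choose k)) = of_int z"
      using step.IH[of m] step.IH[of n] step.prems step.hyps n unfolding D_def by auto
    obtain j where j: "k = Suc j" using step.hyps by (cases k) auto
    have b: "real (Suc m choose Suc j) * real (Suc j) = real (Suc m) * real (m choose j)"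
      using arg_cong[OF Suc_times_binomial_eq[of m j], of real] by (simp only: of_nat_mult)
    have b2: "real (Suc m choose Suc k) * real (Suc k) = real (Suc m) * real (m choose k)"
      using arg_cong[OF Suc_times_binomial_eq[of m k], of real] by (simp only: of_nat_mult)
    have pas: "real (Suc m choose k) = real (m choose j) + real (m choose k)" by (simp add: j)
    have pos: "real (m choose k) > 0" "real (Suc m choose k) > 0" "real k > 0" "real (m choose j) > 0"
    proof -
      have "m choose k > 0" "Suc m choose k > 0" "m choose j > 0" "k > 0"
        using n j by (auto intro!: zero_less_binomial simp del: binomial_Suc_Suc)
      then show "real (m choose k) > 0" "real (Suc m choose k) > 0" "real k > 0" "real (m choose j) > 0"
        by (simp_all only: of_nat_0_less_iff)
    qed
    have "D / (real (Suc k) * real (n choose Suc k)) = D / (real (Suc m) * real (m choose k))"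
      using b2 by (simp only: n mult.commute)
    also have "... = D / (real k * real (m choose k)) - D / (real k * real (n choose k))"
    proof -
      have gen: "D / (K * A) - D / (K * B) = D * (B - A) / (K * A * B)" if "K > 0" "A > 0" "B > 0" for K A B :: real
        using that by (simp add: field_simps)
      have gen': "D * c / (a * (b * c)) = D / (b * a)" if "c > 0" for a b c :: real
        using that by simp
      have "D / (real k * real (m choose k)) - D / (real k * real (n choose k))
          = D * (real (Suc m choose k) - real (m choose k)) / (real k * real (m choose k) * real (Suc m choose k))"
        unfolding n(1) by (rule gen) (use pos in simp_all)
      also have "real (Suc m choose k) - real (m choose k) = real (m choose j)" using pas by simp
      also have "D * real (m choose j) / (real k * real (m choose k) * real (Suc m choose k))
          = D * real (m choose j) / (real (m choose k) * (real (Suc m) * real (m choose j)))"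
        unfolding b[symmetric] unfolding j by (simp only: mult_ac)
      also have "... = D / (real (Suc m) * real (m choose k))"
        by (rule gen') (use pos in simp_all)
      finally show ?thesis by simp
    qed
    finally have "real (Lcm {1..N}) / (real (Suc k) * real (n choose Suc k)) = of_int (y - z)"
      unfolding y z D_def[symmetric] by simp
    then show ?case by blast
  qed
  obtain z :: int where z: "real (Lcm {1..n}) / (real k * real (n choose k)) = of_int z"
    using main[OF assms order_refl] by blast
  have pos: "real k * real (n choose k) > 0" using assms by simp
  have "real (Lcm {1..n}) = real (Lcm {1..n}) / (real k * real (n choose k)) * (real k * real (n choose k))"
    using pos by (intro nonzero_divide_eq_eq[THEN iffD1, OF _ refl]) linarith
  then have "real (Lcm {1..n}) = of_int z * real (k * (n choose k))" unfolding z by simp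
  then have "int (Lcm {1..n}) = z * int (k * (n choose k))" by (metis of_int_eq_iff of_int_mult of_int_of_nat_eq)
  then have "int (k * (n choose k)) dvd int (Lcm {1..n})" by simp
  then show ?thesis by (simp only: of_nat_dvd_iff)
qed

lemma Lcm_pos: "Lcm {1..n} > (0::nat)"
proof (induction n)
  case (Suc n)
  have "{1..Suc n} = insert (Suc n) {1..n}" by auto
  then show ?case using Suc by (simp add: lcm_pos_nat)
qed simp

text \<open>The divisor m binom(2 m, m) of the least common multiple is at least 4^m / 2, by the
  bound for the central binomial coefficient.\<close>

lemma two_power_le_Lcm:
  assumes "m \<ge> 1"
  shows "2 ^ m \<le> Lcm {1..2 * m}"
proof -
  have "m * (2 * m choose m) dvd Lcm {1..2 * m}" by (rule binomial_times_dvd_Lcm) (use assms in auto)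
  then have 1: "m * (2 * m choose m) \<le> Lcm {1..2 * m}" using Lcm_pos by (rule dvd_imp_le)
  have "4 ^ m / (2 * real m) \<le> real (2 * m choose m)" using central_binomial_lower_bound[of m] assms by simp
  then have "4 ^ m \<le> 2 * real (m * (2 * m choose m))" using assms by (simp add: field_simps)
  also have "... \<le> 2 * real (Lcm {1..2 * m})" using 1 by (intro mult_left_mono of_nat_mono) auto
  finally have "2 * 2 ^ m * 2 ^ m \<le> 2 * (2 * real (Lcm {1..2 * m}))"
    by (simp add: power_mult_distrib[symmetric])
  moreover have "2 * (2::real) ^ m \<le> 2 ^ m * 2 ^ m" using assms by (intro mult_right_mono) (auto intro: self_le_power)
  moreover have "(2::real) ^ m * 2 ^ m \<le> 2 * real (Lcm {1..2 * m})"
    using calculation(1) by simp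
  ultimately have "(2::real) ^ m \<le> real (Lcm {1..2 * m})" by linarith
  then show ?thesis by (metis of_nat_le_iff of_nat_numeral of_nat_power)
qed

text \<open>Each prime power that exactly divides Lcm {1..n} is itself at most n. Read backwards, a
  large least common multiple forces many primes up to n.\<close>

lemma Lcm_le_power_card_primes:
  fixes n :: nat
  assumes "n \<ge> 1"
  shows "Lcm {1..n} \<le> n ^ card {p. prime p \<and> p \<le> n}"
proof -
  let ?D = "Lcm {1..n}"
  have mult: "p ^ multiplicity p (Lcm {1..n}) \<le> n" if p: "prime p" and n: "n \<ge> 1" for p n :: nat
    using n
  proof (induction n rule: dec_induct)
    case base
    then show ?case by simp
  next
    case (step n)
    have "{1..Suc n} = insert (Suc n) {1..n}" by auto
    then have "Lcm {1..Suc n} = lcm (Suc n) (Lcm {1..n})" by simp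
    moreover have "Lcm {1..n} \<noteq> 0" using Lcm_pos[of n] by simp
    ultimately have "multiplicity p (Lcm {1..Suc n}) = max (multiplicity p (Suc n)) (multiplicity p (Lcm {1..n}))"
      using p by (simp add: multiplicity_lcm)
    moreover have "p ^ multiplicity p (Suc n) \<le> Suc n" using multiplicity_dvd by (intro dvd_imp_le) auto
    ultimately show ?case using step.IH by (simp add: max_def)
  qed
  have fin: "finite {p. prime p \<and> p \<le> n}" by (rule finite_subset[of _ "{..n}"]) auto
  have sub: "prime_factors ?D \<subseteq> {p. prime p \<and> p \<le> n}"
  proof
    fix p assume "p \<in> prime_factors ?D"
    then have p: "prime p" "multiplicity p ?D > 0" by (auto simp: prime_factors_multiplicity)
    then have "p \<le> p ^ multiplicity p ?D" by (intro self_le_power prime_ge_1_nat)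
    also have "... \<le> n" by (rule mult[OF p(1) assms])
    finally show "p \<in> {p. prime p \<and> p \<le> n}" using p by simp
  qed
  have "?D = (\<Prod>p\<in>prime_factors ?D. p ^ multiplicity p ?D)"
    using Lcm_pos[of n] by (intro prime_factorization_nat) auto
  also have "... \<le> (\<Prod>p\<in>prime_factors ?D. n)"
    by (intro prod_mono conjI mult assms) (auto intro: in_prime_factors_imp_prime)
  also have "... = n ^ card (prime_factors ?D)" by simp
  also have "... \<le> n ^ card {p. prime p \<and> p \<le> n}"
    by (intro power_increasing card_mono fin sub assms)
  finally show ?thesis .
qed

section \<open>A prime that divides none of the given integers\<close>

text \<open>The product of distinct primes dividing s divides s, so N of them, all larger than N,
  would push s beyond N^N.\<close>

lemma card_large_prime_divisors_less:
  fixes s N :: nat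
  assumes N: "N \<ge> 2" and s: "0 < s" "s < N ^ N"
  shows "card {p. prime p \<and> N < p \<and> p dvd s} < N"
proof -
  let ?Q = "{p. prime p \<and> N < p \<and> p dvd s}"
  have fin: "finite ?Q" by (rule finite_subset[of _ "{..s}"]) (use s dvd_imp_le in auto)
  have pd: "\<Prod>Q dvd s" if "finite Q" "\<And>p. p \<in> Q \<Longrightarrow> prime p \<and> p dvd s" for Q
    using that
  proof (induction Q)
    case (insert p Q)
    have "coprime p (\<Prod>Q)"
      by (rule prod_coprime_right) (use insert in \<open>auto intro: primes_coprime\<close>)
    then have "p * \<Prod>Q dvd s" using insert by (intro divides_mult) auto
    then show ?case using insert by simp
  qed simp
  have "\<Prod>?Q dvd s" by (rule pd[OF fin]) simp
  then have "\<Prod>?Q \<le> s" using s by (intro dvd_imp_le)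
  moreover have "N ^ card ?Q \<le> \<Prod>?Q"
  proof -
    have "(\<Prod>p\<in>?Q. N) \<le> (\<Prod>p\<in>?Q. p)" by (rule prod_mono) auto
    then show ?thesis by simp
  qed
  ultimately have "N ^ card ?Q < N ^ N" using s by linarith
  then show ?thesis using N by (simp add: power_strict_increasing_iff)
qed

text \<open>The primes up to N and those excluded by S number at most N + N^2 N <= 2 N^3. With n = 2
  N^6 the least common multiple bound reads 2^(N^6) <= n^pi(n), which forces more primes than that
  even with the crude estimate n <= 2^(6 N + 1) obtained from N <= 2^N. The last comparison is N^3
  >= 16 N > 12 N + 2.\<close>

lemma exists_prime_not_dividing:
  fixes N :: nat and S :: "nat set"
  assumes N: "N \<ge> 4" and S: "finite S" "card S \<le> N^2" "\<And>s. s \<in> S \<Longrightarrow> 0 < s \<and> s < N ^ N"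
  shows "\<exists>p. prime p \<and> N < p \<and> p \<le> N ^ 7 \<and> (\<forall>s\<in>S. \<not> p dvd s)"
proof (rule ccontr)
  assume neg: "\<not> ?thesis"
  define n where "n = 2 * N ^ 6"
  have n1: "n \<ge> 1" using N by (simp add: n_def)
  have nN: "n \<le> N ^ 7"
  proof -
    have "2 * N ^ 6 \<le> N * N ^ 6" using N by (intro mult_le_mono1) auto
    then show ?thesis by (simp add: n_def power_Suc[symmetric] del: power_Suc)
  qed
  let ?B = "\<lambda>s. {p. prime p \<and> N < p \<and> p dvd s}"
  have finB: "finite (?B s)" if "s \<in> S" for s
    by (rule finite_subset[of _ "{..s}"]) (use S(3)[OF that] dvd_imp_le in auto)
  have "{p. prime p \<and> p \<le> n} \<subseteq> {1..N} \<union> (\<Union>s\<in>S. ?B s)"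
  proof
    fix p assume p: "p \<in> {p. prime p \<and> p \<le> n}"
    show "p \<in> {1..N} \<union> (\<Union>s\<in>S. ?B s)"
    proof (cases "p \<le> N")
      case True
      then show ?thesis using p prime_ge_1_nat by auto
    next
      case False
      then have "prime p" "N < p" "p \<le> N ^ 7" using p nN by auto
      then have "\<exists>s\<in>S. p dvd s" using neg by blast
      then show ?thesis using p False by auto
    qed
  qed
  then have "card {p. prime p \<and> p \<le> n} \<le> card ({1..N} \<union> (\<Union>s\<in>S. ?B s))"
    by (rule card_mono[rotated]) (use S finB in auto)
  also have "... \<le> card {1..N} + card (\<Union>s\<in>S. ?B s)" by (rule card_Un_le)
  also have "card (\<Union>s\<in>S. ?B s) \<le> (\<Sum>s\<in>S. card (?B s))" by (rule card_UN_le[OF S(1)])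
  also have "... \<le> (\<Sum>s\<in>S. N)"
    by (rule sum_mono, rule less_imp_le, rule card_large_prime_divisors_less) (use N S in auto)
  also have "... \<le> N^2 * N" using S(2) by simp
  also have "card {1..N} + N^2 * N \<le> 2 * N ^ 3" using self_le_power[of N 3] N by (simp add: power2_eq_square power3_eq_cube)
  finally have pi: "card {p. prime p \<and> p \<le> n} \<le> 2 * N ^ 3" by simp
  have "2 ^ (N ^ 6) \<le> Lcm {1..n}" unfolding n_def by (rule two_power_le_Lcm) (use N in simp)
  also have "... \<le> n ^ card {p. prime p \<and> p \<le> n}" by (rule Lcm_le_power_card_primes[OF n1])
  also have "... \<le> n ^ (2 * N ^ 3)" by (rule power_increasing[OF pi n1])
  also have "... \<le> (2 ^ (6 * N + 1)) ^ (2 * N ^ 3)"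
  proof (rule power_mono)
    have "N \<le> 2 ^ N" using less_exp[of N] by simp
    then have "N ^ 6 \<le> (2 ^ N) ^ 6" by (rule power_mono) simp
    then show "n \<le> 2 ^ (6 * N + 1)" by (simp add: n_def power_mult[symmetric] mult.commute)
  qed simp
  also have "... = 2 ^ ((6 * N + 1) * (2 * N ^ 3))" by (simp only: power_mult)
  finally have "N ^ 6 \<le> (6 * N + 1) * (2 * N ^ 3)" by (rule power_le_imp_le_exp[rotated]) simp
  then have "N ^ 3 * N ^ 3 \<le> (2 * (6 * N + 1)) * N ^ 3" by (simp add: power_add[symmetric] mult_ac)
  then have "N ^ 3 \<le> 2 * (6 * N + 1)" by (rule mult_right_le_imp_le) (use N in simp)
  moreover have "16 * N \<le> N ^ 3"
  proof -
    have "4 * 4 * N \<le> N * N * N" using N by (intro mult_le_mono) auto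
    then show ?thesis by (simp add: power3_eq_cube)
  qed
  moreover have "2 * (6 * N + 1) = 12 * N + 2" by simp
  ultimately show False using N by linarith
qed

section \<open>Residues of lattice points on spheres\<close>

text \<open>All but four coordinates take values of prescribed parity, exactly one of them odd, in a
  range so short that their squares sum to s <= l / 2. Since l is even, l - s is odd and at least l
  / 2, so the four squares theorem supplies at least 4 l choices for the remaining
  coordinates.\<close>

lemma card_lattice_sphere_ge:
  fixes l X :: nat
  assumes d: "CARD('d::finite) \<ge> 5" and l: "even l" and X: "X^2 \<le> l" "8 * CARD('d) \<le> X"
  shows "real (card (lattice_sphere l :: (int ^ 'd) set)) \<ge> 4 / (8 * real CARD('d)) ^ (CARD('d) - 4) * real X ^ (CARD('d) - 2)"
proof -
  define D where "D = CARD('d)"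
  obtain A :: "'d set" where A: "card A = 4"
    using obtain_subset_with_card_n[of 4 "UNIV :: 'd set"] d by auto
  obtain i1 i2 i3 i4 where A4: "A = {i1, i2, i3, i4}" and dist: "distinct [i1, i2, i3, i4]"
  proof -
    obtain xs where xs: "set xs = A" "distinct xs" using finite_distinct_list[of A] by auto
    then have "length xs = 4" using A distinct_card by metis
    then obtain a b c d where "xs = [a, b, c, d]"
      by (auto simp: numeral_eq_Suc length_Suc_conv)
    then show ?thesis using that xs by auto
  qed
  define B where "B = - A"
  have UB: "(UNIV :: 'd set) = A \<union> B" "A \<inter> B = {}" by (auto simp: B_def)
  have cB: "card B = D - 4" unfolding B_def D_def Compl_eq_Diff_UNIV by (subst card_Diff_subset) (auto simp: A)
  have "B \<noteq> {}" using cB d D_def by auto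
  then obtain b0 where b0: "b0 \<in> B" by auto
  \<comment> \<open>Small enough that d - 4 squares of numbers below 2 Y use at most half of l; X >=
    8 d keeps the rounded quotient at least half of X / (4 d).\<close>
  define Y where "Y = X div (4 * D)"
  have D5: "D \<ge> 5" using d by (simp add: D_def)
  have X8: "8 * D \<le> X" using X by (simp add: D_def)
  have Yr: "real Y \<ge> real X / (8 * real D)"
  proof -
    have "X < 4 * D + 4 * D * Y"
      unfolding Y_def by (rule dividend_less_times_div) (use D5 in simp)
    then have "X \<le> 8 * D * Y" using X8 by linarith
    then have "real X \<le> real (8 * D * Y)" by (rule of_nat_mono)
    then show ?thesis using D5 by (simp add: field_simps)
  qed
  define v where "v = (\<lambda>(g :: 'd \<Rightarrow> nat) i. 2 * int (g i) + (if i = b0 then 1 else 0))"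
  define s where "s = (\<lambda>g. \<Sum>i\<in>B. (v g i)^2)"
  define W where "W = PiE B (\<lambda>_. {..<Y})"
  have finW: "finite W" unfolding W_def by (intro finite_PiE) (auto simp: B_def)
  have s_le: "2 * s g \<le> int l" if g: "g \<in> W" for g
  proof -
    have "s g \<le> (\<Sum>i\<in>B. 4 * (int Y)^2)"
      unfolding s_def
    proof (rule sum_mono)
      fix i assume "i \<in> B"
      then have "g i < Y" using g by (auto simp: W_def)
      then have "0 \<le> v g i" "v g i \<le> 2 * int Y" by (auto simp: v_def)
      then have "(v g i)^2 \<le> (2 * int Y)^2" by (intro power_mono)
      then show "(v g i)^2 \<le> 4 * (int Y)^2" by (simp add: power_mult_distrib)
    qed
    also have "... = int (D - 4) * (4 * (int Y)^2)" by (simp add: cB)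
    finally have "2 * s g \<le> int (8 * (D - 4) * Y^2)" by (simp add: mult_ac)
    also have "8 * (D - 4) * Y^2 \<le> l"
    proof -
      have "8 * (D - 4) * Y^2 \<le> (4 * D)^2 * Y^2"
      proof (rule mult_right_mono)
        have "D - 4 \<le> D" "D \<le> D * D" by simp_all
        moreover have "(4 * D)^2 = 16 * (D * D)" by (simp add: power2_eq_square)
        ultimately show "8 * (D - 4) \<le> (4 * D)^2" by linarith
      qed simp
      also have "... = (4 * D * Y)^2" by (simp add: power_mult_distrib)
      also have "... \<le> X^2" unfolding Y_def by (intro power_mono) (auto simp: times_div_less_eq_dividend)
      finally show ?thesis using X by linarith
    qed
    finally show ?thesis by simp
  qed
  have s_odd: "odd (s g)" for g
  proof -
    have "s g = (v g b0)^2 + (\<Sum>i\<in>B - {b0}. (v g i)^2)"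
      unfolding s_def by (rule sum.remove) (use b0 in \<open>auto simp: B_def\<close>)
    moreover have "even (\<Sum>i\<in>B - {b0}. (v g i)^2)" by (rule dvd_sum) (auto simp: v_def)
    moreover have "odd ((v g b0)^2)" by (simp add: v_def)
    ultimately show ?thesis by simp
  qed
  have X1: "X^2 \<ge> 1" using X8 D5 by (intro one_le_power) linarith
  have four: "4 * int l \<le> int (card (Four (int l - s g)))" if g: "g \<in> W" for g
  proof -
    have "odd (int l - s g)" using s_odd[of g] l by simp
    moreover have "(2::int) dvd 4" by simp
    ultimately have "\<not> 4 dvd (int l - s g)" using dvd_trans by blast
    moreover have "int l - s g > 0" using s_le[OF g] X1 X by linarith
    ultimately have "8 * (int l - s g) \<le> int (card (Four (int l - s g)))" by (intro card_Four_ge)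
    moreover have "8 * (int l - s g) = 8 * int l - 8 * s g" by simp
    ultimately show ?thesis using s_le[OF g] by linarith
  qed
  define F where "F = (\<lambda>(g, (a, b, c, e)). (\<chi> i. if i = i1 then a else if i = i2 then b else if i = i3 then c else if i = i4 then e else v g i) :: int ^ 'd)"
  have F: "F (g, a, b, c, e) $ i1 = a" "F (g, a, b, c, e) $ i2 = b" "F (g, a, b, c, e) $ i3 = c" "F (g, a, b, c, e) $ i4 = e"
    "i \<in> B \<Longrightarrow> F (g, a, b, c, e) $ i = v g i" for g a b c e i
  proof -
    have ne: "i1 \<noteq> i2" "i1 \<noteq> i3" "i1 \<noteq> i4" "i2 \<noteq> i3" "i2 \<noteq> i4" "i3 \<noteq> i4" using dist by auto
    note ne = ne ne[symmetric]
    show "F (g, a, b, c, e) $ i1 = a" "F (g, a, b, c, e) $ i2 = b" "F (g, a, b, c, e) $ i3 = c" "F (g, a, b, c, e) $ i4 = e"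
      by (simp_all add: F_def ne)
    assume "i \<in> B"
    then have "i \<noteq> i1" "i \<noteq> i2" "i \<noteq> i3" "i \<noteq> i4" by (auto simp: B_def A4)
    then show "F (g, a, b, c, e) $ i = v g i" by (simp add: F_def)
  qed
  let ?Z = "Sigma W (\<lambda>g. Four (int l - s g))"
  have "card ?Z \<le> card (lattice_sphere l :: (int ^ 'd) set)"
  proof (rule card_inj_on_le)
    show "finite (lattice_sphere l :: (int ^ 'd) set)" by (rule finite_lattice_sphere)
    show "F ` ?Z \<subseteq> lattice_sphere l"
    proof (rule image_subsetI)
      fix z assume "z \<in> ?Z"
      then obtain g a b c e where z: "z = (g, a, b, c, e)" and g: "g \<in> W" and "(a, b, c, e) \<in> Four (int l - s g)"
        by auto
      then have eq: "a^2 + b^2 + c^2 + e^2 = int l - s g" by (simp add: Four_def)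
      have "(\<Sum>i\<in>UNIV. (F z $ i)^2) = (\<Sum>i\<in>A. (F z $ i)^2) + (\<Sum>i\<in>B. (F z $ i)^2)"
        unfolding UB(1) by (rule sum.union_disjoint) (use UB in \<open>auto simp: B_def A4\<close>)
      also have "(\<Sum>i\<in>A. (F z $ i)^2) = a^2 + b^2 + c^2 + e^2"
        unfolding A4 z using dist by (simp add: F)
      also have "(\<Sum>i\<in>B. (F z $ i)^2) = s g" unfolding s_def z by (intro sum.cong) (simp_all add: F)
      finally show "F z \<in> lattice_sphere l" using eq by (simp add: mem_lattice_sphere_iff)
    qed
    show "inj_on F ?Z"
    proof (rule inj_onI)
      fix z z' assume zz: "z \<in> ?Z" "z' \<in> ?Z" "F z = F z'"
      obtain g a b c e where z: "z = (g, a, b, c, e)" by (metis prod.exhaust)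
      obtain g' a' b' c' e' where z': "z' = (g', a', b', c', e')" by (metis prod.exhaust)
      have comp: "F z $ i = F z' $ i" for i using zz(3) by simp
      have "a = a'" "b = b'" "c = c'" "e = e'"
        using comp[of i1] comp[of i2] comp[of i3] comp[of i4] unfolding z z' by (simp_all add: F)
      moreover have "g = g'"
      proof (rule PiE_ext)
        show "g \<in> PiE B (\<lambda>_. {..<Y})" "g' \<in> PiE B (\<lambda>_. {..<Y})" using zz z z' by (auto simp: W_def)
        fix i assume i: "i \<in> B"
        have "v g i = v g' i" using comp[of i] unfolding z z' by (simp add: F(5)[OF i])
        then show "g i = g' i" by (simp add: v_def)
      qed
      ultimately show "z = z'" by (simp add: z z')
    qed
  qed
  then have "int (card (lattice_sphere l :: (int ^ 'd) set)) \<ge> int (card ?Z)" by simp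
  moreover have "int (card ?Z) = (\<Sum>g\<in>W. int (card (Four (int l - s g))))"
    by (subst card_SigmaI) (auto simp: finW finite_Four)
  moreover have "... \<ge> (\<Sum>g\<in>W. 4 * int l)" by (rule sum_mono) (rule four)
  moreover have "(\<Sum>g\<in>W. 4 * int l) = int (Y ^ (D - 4) * (4 * l))"
    by (simp add: W_def card_PiE cB)
  ultimately have "int (Y ^ (D - 4) * (4 * l)) \<le> int (card (lattice_sphere l :: (int ^ 'd) set))" by linarith
  then have "real (Y ^ (D - 4) * (4 * l)) \<le> real (card (lattice_sphere l :: (int ^ 'd) set))"
    by (simp only: of_nat_le_iff)
  moreover have "(real X / (8 * real D)) ^ (D - 4) * (4 * real X ^ 2) \<le> real (Y ^ (D - 4) * (4 * l))"
  proof -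
    have "real X ^ 2 \<le> real l" using of_nat_mono[OF X(1), where 'a = real] by simp
    then show ?thesis unfolding of_nat_mult of_nat_power of_nat_numeral
      by (intro mult_mono power_mono Yr) auto
  qed
  moreover have "(real X / (8 * real D)) ^ (D - 4) * (4 * real X ^ 2) = 4 / (8 * real D) ^ (D - 4) * real X ^ (D - 2)"
  proof -
    have "D - 2 = (D - 4) + 2" using D5 by simp
    then have "real X ^ (D - 2) = real X ^ (D - 4) * real X ^ 2" by (simp only: power_add)
    then show ?thesis by (simp add: power_divide)
  qed
  ultimately show ?thesis unfolding D_def by linarith
qed

section \<open>Upper bounds for points with prescribed residues\<close>

lemma progression_length_bounds:
  fixes X p :: nat
  assumes p: "p \<ge> 1" "p \<le> X"
  shows "real (2 * X div p + 1) \<le> 3 * (real X / real p)" "2 * X < p * (2 * X div p + 1)"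
proof -
  have "real (2 * X div p) \<le> 2 * (real X / real p)" using of_nat_div_le_of_nat[of "2 * X" p, where 'a = real] by simp
  moreover have "1 \<le> real X / real p" using p by simp
  ultimately show "real (2 * X div p + 1) \<le> 3 * (real X / real p)" by simp
  have "p * (2 * X div p) + 2 * X mod p = 2 * X" "2 * X mod p < p" using p by auto
  then show "2 * X < p * (2 * X div p + 1)" unfolding distrib_left by linarith
qed

text \<open>The factor d counts the summands of the progression bound, and 3 comes from the length
  of a progression, at most 3 X / p.\<close>

definition sphere_const :: "nat \<Rightarrow> real" where
  "sphere_const d = real d * moment_const * 3 ^ (d - 2)"

lemma sphere_const_pos: "d \<ge> 1 \<Longrightarrow> sphere_const d > 0"
  using moment_const_pos by (simp add: sphere_const_def)

abbreviation sphere_residue :: "nat \<Rightarrow> nat \<Rightarrow> int ^ 'd \<Rightarrow> (int ^ 'd) set" where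
  "sphere_residue p l a \<equiv> {n \<in> lattice_sphere l. \<forall>i. int p dvd n $ i - a $ i}"

text \<open>All coordinates run over progressions of the same length of order X / p, so unit weights
  suffice. Of the d - 1 powers of p, this length accounts for d - 2 and the gain in the fifth moment
  for the last; p^8 <= X ensures p^7 <= L there.\<close>

proposition card_residue_class_le:
  fixes a :: "int ^ 'd::finite"
  assumes d: "CARD('d) \<ge> 5" and p: "prime p" "p > 2" and X: "p ^ 8 \<le> X" "l < (X + 1)^2"
    and a: "\<And>i. \<not> int p dvd a $ i"
  shows "real (card (sphere_residue p l a))
    \<le> sphere_const CARD('d) * real X ^ (CARD('d) - 2) / real p ^ (CARD('d) - 1)"
proof -
  define D where "D = CARD('d)"
  have D5: "D \<ge> 5" using d by (simp add: D_def)
  define C where "C = moment_const"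
  note C = moment_const_pos[folded C_def]
  define L where "L = 2 * X div p + 1"
  have p1: "p \<ge> 1" using p by simp
  have "p ^ 1 \<le> p ^ 8" using p1 by (intro power_increasing) auto
  then have pX: "p \<le> X" using X by simp
  note Lb = progression_length_bounds[OF p1 pX, folded L_def]
  have pL: "p ^ 7 \<le> L"
  proof -
    have "p * p ^ 7 \<le> 2 * X" using X by (simp add: power_Suc[symmetric] del: power_Suc)
    then have "p ^ 7 \<le> 2 * X div p" using p1 by (simp add: less_eq_div_iff_mult_less_eq mult.commute)
    then show ?thesis by (simp add: L_def)
  qed
  have M: "fifth_moment ((a $ i + int X) mod int p - int X) p (2 * X div p + 1)
     \<le> C * (real L ^ 3 / real p)" for i
    unfolding L_def[symmetric] C_def
  proof (rule fifth_moment_gain[OF p pL])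
    let ?b = "a $ i + int X"
    show "\<not> int p dvd ?b mod int p - int X"
    proof
      assume "int p dvd ?b mod int p - int X"
      then have "int p dvd (?b mod int p - int X) + (?b - ?b mod int p)" by (intro dvd_add dvd_minus_mod)
      moreover have "(c - int X) + (?b - c) = a $ i" for c by simp
      ultimately show False using a by metis
    qed
    have "0 \<le> ?b mod int p" "?b mod int p < int p" using p1 by auto
    then have "\<bar>?b mod int p - int X\<bar> \<le> int (2 * X)" using pX by linarith
    also have "... \<le> int (p * L)" using Lb(2) by linarith
    finally show "\<bar>?b mod int p - int X\<bar> \<le> int p * int L" by simp
  qed
  have "real (card (sphere_residue p l a))
     \<le> (\<Sum>i\<in>(UNIV::'d set). 1 ^ CARD('d) * (real (2 * X div p + 1) ^ (CARD('d) - 5) * (C * (real L ^ 3 / real p))))"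
    by (rule card_sphere_progression_le[where m = "\<lambda>_. p" and a = "\<lambda>i. a $ i" and w = "\<lambda>_. 1", OF d p1 _ _ X(2) M]) auto
  also have "... = real D * C * (real L ^ (D - 2) / real p)"
  proof -
    have "D - 2 = (D - 5) + 3" using D5 by simp
    then have "real L ^ (D - 2) = real L ^ (D - 5) * real L ^ 3" by (simp only: power_add)
    then show ?thesis unfolding L_def[symmetric] D_def[symmetric] by (simp add: D_def[symmetric])
  qed
  also have "... \<le> real D * C * ((3 * (real X / real p)) ^ (D - 2) / real p)"
    using C by (intro mult_left_mono divide_right_mono power_mono Lb(1)) auto
  also have "... = sphere_const D * real X ^ (D - 2) / real p ^ (D - 1)"
  proof -
    have "D - 1 = Suc (D - 2)" using D5 by simp
    then have "real p ^ (D - 1) = real p * real p ^ (D - 2)" by (simp only: power_Suc)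
    then show ?thesis by (simp add: sphere_const_def C_def[symmetric] power_mult_distrib power_divide mult_ac)
  qed
  finally show ?thesis by (simp add: D_def)
qed

text \<open>The restricted coordinate has residue 0, so the moment bound with the gain does not
  apply to it. Its weight has d-th power p, which the short progression more than compensates, and
  the other weights shrink accordingly, to d-th power p^(-1 / (d - 1)). This is weaker than the
  expected 1 / p, but any fixed negative power of p makes these points a minority once p is
  large.\<close>

proposition card_divisible_component_le:
  fixes j :: "'d::finite"
  assumes d: "CARD('d) \<ge> 5" and p1: "p \<ge> 1" and pX: "p \<le> X" and X: "l < (X + 1)^2"
  shows "real (card {n \<in> (lattice_sphere l :: (int ^ 'd) set). int p dvd n $ j})
    \<le> sphere_const CARD('d) * real X ^ (CARD('d) - 2) * real p powr (- 1 / (real CARD('d) - 1))"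
proof -
  define D where "D = CARD('d)"
  have D5: "D \<ge> 5" using d by (simp add: D_def)
  define C where "C = moment_const"
  note C = moment_const_pos[folded C_def]
  define m where "m = (\<lambda>i. if i = j then p else 1)"
  define w where "w = (\<lambda>i. if i = j then real p powr (1 / real D) else real p powr (- 1 / (real D * (real D - 1))))"
  define L where "L = (\<lambda>i. 2 * X div m i + 1)"
  define \<delta> where "\<delta> = real p powr (- 1 / (real D - 1))"
  have m1: "m i \<ge> 1" for i using p1 by (simp add: m_def)
  have D1: "real D - 1 > 0" using D5 by simp
  have set: "{n \<in> (lattice_sphere l :: (int ^ 'd) set). int p dvd n $ j}
     = {n \<in> lattice_sphere l. \<forall>i. int (m i) dvd n $ i - 0}"
    by (auto simp: m_def)
  have wprod: "(\<Prod>i\<in>UNIV. w i) = 1"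
  proof -
    have "(\<Prod>i\<in>UNIV. w i) = w j * (\<Prod>i\<in>UNIV - {j}. w i)" by (rule prod.remove) auto
    also have "(\<Prod>i\<in>UNIV - {j}. w i) = (\<Prod>i\<in>UNIV - {j}. real p powr (- 1 / (real D * (real D - 1))))"
      by (rule prod.cong) (auto simp: w_def)
    also have "... = (real p powr (- 1 / (real D * (real D - 1)))) ^ (D - 1)"
      by (simp add: D_def card_Diff_subset)
    also have "... = (real p powr (- 1 / (real D * (real D - 1)))) powr real (D - 1)"
      using p1 by (intro powr_realpow[symmetric]) simp
    also have "real (D - 1) = real D - 1" using D5 by simp
    also have "(real p powr (- 1 / (real D * (real D - 1)))) powr (real D - 1) = real p powr (- 1 / real D)"
      using D1 by (simp add: powr_powr)
    also have "w j * real p powr (- 1 / real D) = 1"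
      using p1 by (simp add: w_def powr_add[symmetric])
    finally show ?thesis .
  qed
  have wpow: "w i ^ D = (if i = j then real p else \<delta>)" for i
  proof -
    have "w i ^ D = w i powr real D" using p1 by (intro powr_realpow[symmetric]) (simp add: w_def)
    then show ?thesis using D5 D1 p1 by (simp add: w_def \<delta>_def powr_powr)
  qed
  have Li: "real (L i) \<le> 3 * (real X / real (m i))" for i
    unfolding L_def by (rule progression_length_bounds(1)) (use m1 pX p1 in \<open>auto simp: m_def\<close>)
  have D2: "D - 2 = (D - 5) + 3" using D5 by simp
  have summand: "w i ^ CARD('d) * (real (L i) ^ (CARD('d) - 5) * (C * real (L i) ^ 3)) \<le> C * 3 ^ (D - 2) * real X ^ (D - 2) * \<delta>" for i
  proof -
    have "w i ^ CARD('d) * (real (L i) ^ (CARD('d) - 5) * (C * real (L i) ^ 3)) = C * (w i ^ D * real (L i) ^ (D - 2))"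
      unfolding D2 power_add D_def[symmetric] by (simp only: mult_ac)
    also have "... \<le> C * (w i ^ D * (3 * (real X / real (m i))) ^ (D - 2))"
      using C by (intro mult_left_mono power_mono Li) (auto simp: w_def)
    also have "... = C * 3 ^ (D - 2) * real X ^ (D - 2) * (w i ^ D / real (m i) ^ (D - 2))"
      by (simp add: power_mult_distrib power_divide)
    also have "w i ^ D / real (m i) ^ (D - 2) \<le> \<delta>"
    proof (cases "i = j")
      case True
      have "real p / real p ^ (D - 2) = real p powr 1 / real p powr real (D - 2)"
        using p1 by (simp add: powr_realpow)
      also have "... = real p powr (1 - real (D - 2))" by (rule powr_diff[symmetric])
      also have "... \<le> \<delta>"
        unfolding \<delta>_def
      proof (rule powr_mono)
        have "1 / (real D - 1) \<le> 1" using D5 by simp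
        moreover have "real (D - 2) = real D - 2" "real D \<ge> 5" using D5 by auto
        moreover have "- 1 / (real D - 1) = - (1 / (real D - 1))" by simp
        ultimately show "1 - real (D - 2) \<le> - 1 / (real D - 1)" by linarith
      qed (use p1 in simp)
      finally show ?thesis using True by (simp add: wpow m_def)
    next
      case False
      then show ?thesis by (simp add: wpow m_def)
    qed
    finally show ?thesis using C by (simp add: mult_left_mono)
  qed
  have "real (card {n \<in> (lattice_sphere l :: (int ^ 'd) set). int p dvd n $ j})
     \<le> (\<Sum>i\<in>UNIV. w i ^ CARD('d) * (real (2 * X div m i + 1) ^ (CARD('d) - 5) * (C * real (L i) ^ 3)))"
    unfolding set
  proof (rule card_sphere_progression_le[where a = "\<lambda>_. 0" and w = w, OF d m1 _ wprod X])
    show "w i \<ge> 0" for i by (simp add: w_def)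
    show "fifth_moment ((0 + int X) mod int (m i) - int X) (m i) (2 * X div m i + 1)
        \<le> C * real (L i) ^ 3" for i
      unfolding L_def C_def by (rule fifth_moment_le[OF m1]) simp
  qed
  also have "... \<le> (\<Sum>i\<in>(UNIV::'d set). C * 3 ^ (D - 2) * real X ^ (D - 2) * \<delta>)"
    by (rule sum_mono) (use summand in \<open>simp add: L_def\<close>)
  also have "... = sphere_const D * real X ^ (D - 2) * \<delta>" by (simp add: sphere_const_def C_def D_def)
  finally show ?thesis by (simp add: \<delta>_def D_def)
qed

section \<open>Popular residues\<close>

definition residue_box :: "nat \<Rightarrow> (int ^ 'd) set" where
  "residue_box p = {a. \<forall>i. a $ i \<in> {0..<int p}}"

lemma bij_betw_residue_box:
  "bij_betw (\<lambda>g. \<chi> i. g i) (UNIV \<rightarrow>\<^sub>E {0..<int p}) (residue_box p :: (int ^ 'd::finite) set)"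
  by (rule bij_betw_byWitness[where f' = vec_nth]) (auto simp: residue_box_def)

lemma finite_residue_box: "finite (residue_box p :: (int ^ 'd::finite) set)"
  using bij_betw_finite[OF bij_betw_residue_box[where 'd = 'd]] by (simp add: finite_PiE)

lemma card_square_roots_mod_prime_le:
  fixes t :: int
  assumes p: "prime p"
  shows "card {x \<in> {0..<int p}. int p dvd x^2 - t} \<le> 2"
proof (cases "{x \<in> {0..<int p}. int p dvd x^2 - t} = {}")
  case False
  then obtain y where y: "0 \<le> y" "y < int p" "int p dvd y^2 - t" by auto
  have "{x \<in> {0..<int p}. int p dvd x^2 - t} \<subseteq> {y, int p - y}"
  proof
    fix x assume "x \<in> {x \<in> {0..<int p}. int p dvd x^2 - t}"
    then have x: "0 \<le> x" "x < int p" "int p dvd x^2 - t" by auto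
    have "int p dvd (x^2 - t) - (y^2 - t)" using x(3) y(3) by (rule dvd_diff)
    then have "int p dvd (x - y) * (x + y)" by (simp add: power2_eq_square algebra_simps)
    then consider "int p dvd x - y" | "int p dvd x + y"
      using p prime_dvd_mult_iff[of "int p"] by auto
    then show "x \<in> {y, int p - y}"
    proof cases
      case 1
      then have "x - y = 0" using x y zdvd_not_zless[of "\<bar>x - y\<bar>" "int p"] by fastforce
      then show ?thesis by simp
    next
      case 2
      then obtain c where c: "x + y = int p * c" by auto
      have pp: "int p > 0" using p prime_gt_0_nat by simp
      have "int p * c < int p * 2" using c x y by linarith
      then have "c < 2" using pp by (simp only: mult_less_cancel_left_pos)
      moreover have "0 \<le> int p * c" using c x y by linarith
      then have "0 \<le> c" using pp by (simp add: zero_le_mult_iff)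
      ultimately have "c = 0 \<or> c = 1" by auto
      then show ?thesis using c x y by auto
    qed
  qed
  then have "card {x \<in> {0..<int p}. int p dvd x^2 - t} \<le> card {y, int p - y}" by (rule card_mono[rotated]) simp
  also have "... \<le> 2" by (simp add: card_insert_if)
  finally show ?thesis .
next
  case True
  show ?thesis unfolding True by simp
qed

text \<open>When all coordinates but one are fixed, the last is a square root modulo p, for which
  there are at most two choices.\<close>

lemma card_quadric_mod_prime_le:
  assumes p: "prime p"
  shows "card {a \<in> (residue_box p :: (int ^ 'd::finite) set). int p dvd (\<Sum>i\<in>UNIV. (a $ i)^2) - t} \<le> 2 * p ^ (CARD('d) - 1)"
proof -
  let ?Q = "{a \<in> (residue_box p :: (int ^ 'd) set). int p dvd (\<Sum>i\<in>UNIV. (a $ i)^2) - t}"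
  define j where "j = (SOME i::'d. True)"
  define W where "W = PiE (UNIV - {j}) (\<lambda>_::'d. {0..<int p})"
  define f where "f = (\<lambda>g (x::int). (\<chi> i. if i = j then x else g i) :: int ^ 'd)"
  let ?R = "\<lambda>g. {x \<in> {0..<int p}. int p dvd x^2 - (t - (\<Sum>i\<in>UNIV - {j}. (g i)^2))}"
  have finW: "finite W" unfolding W_def by (intro finite_PiE) auto
  have finR: "finite (?R g)" for g
    by (rule finite_subset[of _ "{0..<int p}"]) auto
  have "?Q \<subseteq> (\<Union>g\<in>W. f g ` ?R g)"
  proof
    fix a assume a: "a \<in> ?Q"
    define g where "g = restrict (vec_nth a) (UNIV - {j})"
    have "g \<in> W" using a by (auto simp: W_def g_def residue_box_def)
    moreover have "a = f g (a $ j)" by (simp add: vec_eq_iff f_def g_def)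
    moreover have "a $ j \<in> ?R g"
    proof -
      have "(\<Sum>i\<in>UNIV. (a $ i)^2) = (a $ j)^2 + (\<Sum>i\<in>UNIV - {j}. (a $ i)^2)" by (rule sum.remove) auto
      moreover have "(\<Sum>i\<in>UNIV - {j}. (a $ i)^2) = (\<Sum>i\<in>UNIV - {j}. (g i)^2)"
        by (rule sum.cong) (auto simp: g_def)
      ultimately show ?thesis using a by (simp add: residue_box_def algebra_simps)
    qed
    ultimately show "a \<in> (\<Union>g\<in>W. f g ` ?R g)" by blast
  qed
  then have "card ?Q \<le> card (\<Union>g\<in>W. f g ` ?R g)"
    by (rule card_mono[rotated]) (intro finite_UN_I finW finite_imageI finR)
  also have "... \<le> (\<Sum>g\<in>W. card (f g ` ?R g))" by (rule card_UN_le[OF finW])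
  also have "... \<le> (\<Sum>g\<in>W. 2)"
  proof (rule sum_mono)
    fix g
    have "card (f g ` ?R g) \<le> card (?R g)" by (rule card_image_le[OF finR])
    also have "... \<le> 2" by (rule card_square_roots_mod_prime_le[OF p])
    finally show "card (f g ` ?R g) \<le> 2" .
  qed
  also have "... = 2 * p ^ (CARD('d) - 1)" by (simp add: W_def card_PiE card_Diff_subset)
  finally show ?thesis .
qed

text \<open>Since no residue with nonzero components is hit much more often than on average, many residues are
  popular.\<close>

definition popular_residues :: "nat \<Rightarrow> nat \<Rightarrow> (int ^ 'd) set" where
  "popular_residues p l = {a \<in> residue_box p. int p dvd (\<Sum>i\<in>UNIV. (a $ i)^2) - int l \<and>
     real (card (lattice_sphere l :: (int ^ 'd) set))
       \<le> 8 * real p ^ (CARD('d) - 1) * real (card (sphere_residue p l a))}"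

text \<open>The quotient of the constant in the lower bound for a sphere by four times the constant
  in the upper bound for a class; the 4 appears because a quarter of the sphere is left for the
  popular classes.\<close>

definition popular_const :: "nat \<Rightarrow> real" where
  "popular_const d = 4 / (8 * real d) ^ (d - 4) / (4 * sphere_const d)"

lemma popular_const_pos: "d \<ge> 1 \<Longrightarrow> popular_const d > 0"
  using sphere_const_pos[of d] by (simp add: popular_const_def)

text \<open>The power d - 1 undoes the saving p^(-1 / (d - 1)): beyond it, the d bounds for points
  with a component divisible by p add up to at most half of the sphere. The term 8 d supplies the
  size that the lower bound for the sphere demands of X.\<close>

definition popular_threshold :: "nat \<Rightarrow> real" where
  "popular_threshold d = max (8 * real d)
    ((2 * real d * sphere_const d / (4 / (8 * real d) ^ (d - 4))) powr (real d - 1))"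

text \<open>Let s be the size of the sphere. At least s / 2 points have no component divisible by p.
  At most 2 p^(d - 1) classes satisfy the congruence, and the unpopular ones hold less than s / (8
  p^(d - 1)) points each, so at most s / 4 together; this explains the 8 in the definition. The
  other s / 4 points lie in popular classes with nonzero components, and the upper bound for such a
  class forces them to be numerous.\<close>

proposition card_popular_residues_ge:
  assumes d: "CARD('d::finite) \<ge> 5" and p: "prime p" and pP: "real p \<ge> popular_threshold CARD('d)"
    and X: "p ^ 8 \<le> X" "X^2 \<le> l" "l < (X + 1)^2" and l: "even l"
  shows "popular_const CARD('d) * real p ^ (CARD('d) - 1) \<le> real (card (popular_residues p l :: (int ^ 'd) set))"
proof -
  define D where "D = CARD('d)"
  have D5: "D \<ge> 5" using d by (simp add: D_def)
  define c1 where "c1 = 4 / (8 * real D) ^ (D - 4)"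
  have c1: "c1 > 0" using D5 by (simp add: c1_def)
  define C where "C = sphere_const D"
  have C: "C > 0" unfolding C_def using D5 by (intro sphere_const_pos) simp
  define K where "K = 2 * real D * C / c1"
  have K: "K > 0" using C c1 D5 by (simp add: K_def)
  define P0 where "P0 = max (8 * real D) (K powr (real D - 1))"
  have pP: "real p \<ge> P0"
    using pP unfolding popular_threshold_def P0_def K_def C_def c1_def D_def .
  let ?S = "lattice_sphere l :: (int ^ 'd) set"
  let ?R = "sphere_residue p l"
  let ?G = "popular_residues p l :: (int ^ 'd) set"
  define s where "s = real (card ?S)"
  define Q where "Q = real p ^ (D - 1)"
  define A where "A = real X ^ (D - 2)"
  have pD: "8 * D \<le> p" using pP unfolding P0_def by (simp add: max_def split: if_splits)
  have p3: "p > 2" "p \<ge> 1" using pD D5 by linarith+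
  have "p ^ 1 \<le> p ^ 8" using p3 by (intro power_increasing) auto
  then have pX: "p \<le> X" using X by simp
  have X0: "real X > 0" using pX p3 by simp
  have A0: "A > 0" using X0 by (simp add: A_def)
  have Q0: "Q > 0" using p3 by (simp add: Q_def)
  have s1: "c1 * A \<le> s"
    using card_lattice_sphere_ge[where 'd = 'd, OF d l X(2)] pD pX by (simp add: s_def c1_def A_def D_def)
  define N1 where "N1 = {n \<in> ?S. \<forall>i. \<not> int p dvd n $ i}"
  have finS: "finite ?S" by (rule finite_lattice_sphere)
  have bad_sum: "real (card (?S - N1)) \<le> s / 2"
  proof -
    have "?S - N1 = (\<Union>j\<in>UNIV. {n \<in> ?S. int p dvd n $ j})" by (auto simp: N1_def)
    then have "card (?S - N1) \<le> (\<Sum>j\<in>(UNIV::'d set). card {n \<in> ?S. int p dvd n $ j})"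
      using card_UN_le[of "UNIV :: 'd set" "\<lambda>j. {n \<in> ?S. int p dvd n $ j}"] by simp
    then have "real (card (?S - N1)) \<le> (\<Sum>j\<in>(UNIV::'d set). real (card {n \<in> ?S. int p dvd n $ j}))"
      by (simp only: of_nat_le_iff of_nat_sum[symmetric])
    also have "... \<le> (\<Sum>j\<in>(UNIV::'d set). C * A * real p powr (- 1 / (real D - 1)))"
      unfolding A_def C_def D_def by (rule sum_mono, rule card_divisible_component_le[OF d p3(2) pX X(3)])
    also have "... = real D * C * A * real p powr (- 1 / (real D - 1))" by (simp add: D_def)
    also have "... \<le> real D * C * A * (1 / K)"
    proof (rule mult_left_mono)
      have D1: "real D - 1 > 0" using D5 by simp
      have "(K powr (real D - 1)) powr (1 / (real D - 1)) \<le> real p powr (1 / (real D - 1))"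
        using pP D1 by (intro powr_mono2) (auto simp: P0_def)
      then have "K \<le> real p powr (1 / (real D - 1))" using K D1 by (simp add: powr_powr)
      then have "1 / real p powr (1 / (real D - 1)) \<le> 1 / K" using K by (intro frac_le) auto
      then show "real p powr (- 1 / (real D - 1)) \<le> 1 / K" by (simp add: powr_minus_divide)
    qed (use C A0 in auto)
    also have "... = c1 * A / 2" using C c1 D5 by (simp add: K_def)
    finally show ?thesis using s1 by linarith
  qed
  have sub: "N1 \<subseteq> ?S" by (auto simp: N1_def)
  have "card (?S - N1) = card ?S - card N1" by (rule card_Diff_subset[OF finite_subset[OF sub finS] sub])
  moreover have "card N1 \<le> card ?S" by (rule card_mono[OF finS sub])
  ultimately have "card ?S = card N1 + card (?S - N1)" by linarith
  then have N1: "s / 2 \<le> real (card N1)" using bad_sum by (simp add: s_def)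
  define H where "H = {a \<in> (residue_box p :: (int ^ 'd) set). int p dvd (\<Sum>i\<in>UNIV. (a $ i)^2) - int l \<and> (\<forall>i. \<not> int p dvd a $ i)}"
  have finH: "finite H" unfolding H_def by (rule finite_subset[OF _ finite_residue_box]) auto
  have finG: "finite ?G" unfolding popular_residues_def by (rule finite_subset[OF _ finite_residue_box]) auto
  have "N1 \<subseteq> (\<Union>a\<in>H. ?R a)"
  proof
    fix n assume n: "n \<in> N1"
    define a :: "int ^ 'd" where "a = (\<chi> i. n $ i mod int p)"
    have dv: "int p dvd n $ i - a $ i" for i by (simp add: a_def)
    have "int p dvd (\<Sum>i\<in>UNIV. (a $ i)^2) - int l"
    proof -
      have "int p dvd (\<Sum>i\<in>UNIV. (n $ i)^2 - (a $ i)^2)"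
      proof (rule dvd_sum)
        fix i
        have "(n $ i)^2 - (a $ i)^2 = (n $ i - a $ i) * (n $ i + a $ i)" by (simp add: power2_eq_square algebra_simps)
        then show "int p dvd (n $ i)^2 - (a $ i)^2" using dv[of i] by simp
      qed
      then have "int p dvd int l - (\<Sum>i\<in>UNIV. (a $ i)^2)"
        using n by (simp add: sum_subtractf N1_def mem_lattice_sphere_iff)
      then show ?thesis by (simp add: dvd_diff_commute)
    qed
    moreover have "\<not> int p dvd a $ i" for i
    proof
      assume "int p dvd a $ i"
      then have "int p dvd (n $ i - a $ i) + a $ i" using dv by (intro dvd_add)
      then show False using n by (simp add: N1_def)
    qed
    moreover have "a \<in> residue_box p" using p3 by (simp add: residue_box_def a_def)
    ultimately have "a \<in> H" by (simp add: H_def)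
    then show "n \<in> (\<Union>a\<in>H. ?R a)" using n dv by (auto simp: N1_def)
  qed
  then have "card N1 \<le> card (\<Union>a\<in>H. ?R a)"
    by (rule card_mono[rotated]) (intro finite_UN_I finH finite_subset[OF _ finS], auto)
  also have "... \<le> (\<Sum>a\<in>H. card (?R a))" by (rule card_UN_le[OF finH])
  also have "... = (\<Sum>a\<in>H \<inter> ?G. card (?R a)) + (\<Sum>a\<in>H - ?G. card (?R a))"
    by (rule sum.Int_Diff[OF finH])
  finally have "real (card N1) \<le> (\<Sum>a\<in>H \<inter> ?G. real (card (?R a))) + (\<Sum>a\<in>H - ?G. real (card (?R a)))"
    by (simp only: of_nat_le_iff of_nat_sum[symmetric] of_nat_add[symmetric])
  also have "(\<Sum>a\<in>H - ?G. real (card (?R a))) \<le> (\<Sum>a\<in>H - ?G. s / (8 * Q))"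
  proof (rule sum_mono)
    fix a assume "a \<in> H - ?G"
    then have "8 * Q * real (card (?R a)) < s"
      unfolding H_def popular_residues_def s_def Q_def D_def by auto
    then show "real (card (?R a)) \<le> s / (8 * Q)" using Q0 by (simp add: field_simps)
  qed
  also have "... \<le> 2 * Q * (s / (8 * Q))"
  proof -
    have "H - ?G \<subseteq> {a \<in> (residue_box p :: (int ^ 'd) set). int p dvd (\<Sum>i\<in>UNIV. (a $ i)^2) - int l}"
      by (auto simp: H_def)
    then have "card (H - ?G) \<le> card {a \<in> (residue_box p :: (int ^ 'd) set). int p dvd (\<Sum>i\<in>UNIV. (a $ i)^2) - int l}"
      by (rule card_mono[rotated]) (rule finite_subset[OF _ finite_residue_box], auto)
    also have "... \<le> 2 * p ^ (D - 1)" unfolding D_def by (rule card_quadric_mod_prime_le[OF p])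
    finally have "real (card (H - ?G)) \<le> real (2 * p ^ (D - 1))" by (rule of_nat_mono)
    then have "real (card (H - ?G)) \<le> 2 * Q" by (simp add: Q_def)
    then have "real (card (H - ?G)) * (s / (8 * Q)) \<le> 2 * Q * (s / (8 * Q))"
      by (rule mult_right_mono) (use Q0 in \<open>simp add: s_def\<close>)
    then show ?thesis by simp
  qed
  also have "2 * Q * (s / (8 * Q)) = s / 4" using Q0 by simp
  also have "(\<Sum>a\<in>H \<inter> ?G. real (card (?R a))) \<le> (\<Sum>a\<in>H \<inter> ?G. C * A / Q)"
    unfolding A_def Q_def
  proof (rule sum_mono)
    fix a assume "a \<in> H \<inter> ?G"
    then have "\<not> int p dvd a $ i" for i by (auto simp: H_def)
    then show "real (card (?R a)) \<le> C * real X ^ (D - 2) / real p ^ (D - 1)" 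
      unfolding C_def D_def by (rule card_residue_class_le[OF d p p3(1) X(1) X(3)])
  qed
  also have "... = real (card (H \<inter> ?G)) * (C * A / Q)" by simp
  also have "... \<le> real (card ?G) * (C * A / Q)"
    by (intro mult_right_mono of_nat_mono card_mono finG) (use C A0 Q0 in auto)
  finally have "real (card N1) \<le> real (card ?G) * (C * A / Q) + s / 4" by simp
  then have "c1 * A / 4 \<le> real (card ?G) * (C * A / Q)" using N1 s1 by linarith
  then have "A * (c1 * Q) \<le> A * (4 * C * real (card ?G))" using Q0 by (simp add: field_simps)
  then have "c1 * Q \<le> 4 * C * real (card ?G)" using A0 by simp
  then have "c1 / (4 * C) * Q \<le> real (card ?G)" using C by (simp add: field_simps)
  moreover have "popular_const CARD('d) = c1 / (4 * C)" by (simp add: popular_const_def c1_def C_def D_def)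
  ultimately show ?thesis by (simp only: Q_def D_def)
qed

section \<open>The test function and the counting bound\<close>

lemma floor_square_root_exists:
  fixes l :: nat
  obtains X :: nat where "X^2 \<le> l" "l < (X + 1)^2"
proof -
  have "\<exists>X. X^2 \<le> l \<and> l < (X + 1)^2"
  proof (induction l)
    case 0
    then show ?case by (intro exI[of _ 0]) simp
  next
    case (Suc l)
    then obtain X where X: "X^2 \<le> l" "l < (X + 1)^2" by blast
    show ?case
    proof (cases "Suc l < (X + 1)^2")
      case True
      then show ?thesis using X by (intro exI[of _ X]) simp
    next
      case False
      have "(X + 1)^2 < (X + 1 + 1)^2" by (rule power_strict_mono) auto
      then show ?thesis using X False by (intro exI[of _ "X + 1"]) linarith
    qed
  qed
  then show ?thesis using that by blast
qed

lemma two_power_le_fact: "2 ^ (m - 1) \<le> (fact m :: nat)"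
proof (induction m)
  case (Suc m)
  show ?case
  proof (cases m)
    case (Suc j)
    have "2 * 2 ^ j \<le> Suc m * fact m" using Suc.IH \<open>m = Suc j\<close> by (intro mult_mono) auto
    then show ?thesis using Suc by simp
  qed simp
qed simp

section \<open>The test function and its large averages\<close>

text \<open>The support of the test function. The cube [0, p m)^d is enlarged by its side length in
  every direction, so that x - n stays inside for x in the cube and n with components bounded by
  m.\<close>

definition sublattice_box :: "nat \<Rightarrow> nat \<Rightarrow> (int ^ 'd) set" where
  "sublattice_box p m = {y. \<forall>i. int p dvd y $ i \<and> - int (p * m) \<le> y $ i \<and> y $ i < 2 * int (p * m)}"

lemma card_sublattice_box_le:
  assumes p: "p \<ge> 1"
  shows "finite (sublattice_box p m :: (int ^ 'd::finite) set)"
    and "card (sublattice_box p m :: (int ^ 'd) set) \<le> (3 * m) ^ CARD('d)"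
proof -
  define W where "W = PiE (UNIV :: 'd set) (\<lambda>_. {- int m..<2 * int m})"
  have finW: "finite W" unfolding W_def by (intro finite_PiE) auto
  have sub: "sublattice_box p m \<subseteq> (\<lambda>z. \<chi> i. int p * z i) ` W"
  proof
    fix y :: "int ^ 'd" assume y: "y \<in> sublattice_box p m"
    define z where "z = (\<lambda>i. y $ i div int p)"
    have pp: "int p > 0" using p by simp
    have yz: "y $ i = int p * z i" for i using y by (simp add: sublattice_box_def z_def)
    have "z i \<in> {- int m..<2 * int m}" for i
    proof -
      have "int p * (- int m) \<le> int p * z i" "int p * z i < int p * (2 * int m)"
        using y unfolding yz[symmetric] by (simp_all add: sublattice_box_def mult_ac)
      then show ?thesis using pp by (simp only: mult_le_cancel_left_pos mult_less_cancel_left_pos atLeastLessThan_iff)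
    qed
    then have "z \<in> W" unfolding W_def by (intro PiE_I) auto
    moreover have "y = (\<chi> i. int p * z i)" using yz by (simp add: vec_eq_iff)
    ultimately show "y \<in> (\<lambda>z. \<chi> i. int p * z i) ` W" by blast
  qed
  show "finite (sublattice_box p m :: (int ^ 'd) set)" by (rule finite_subset[OF sub finite_imageI[OF finW]])
  have "card (sublattice_box p m :: (int ^ 'd) set) \<le> card ((\<lambda>z. \<chi> i. int p * z i) ` W)"
    by (rule card_mono[OF finite_imageI[OF finW] sub])
  also have "... \<le> card W" by (rule card_image_le[OF finW])
  also have "... = (3 * m) ^ CARD('d)" by (simp add: W_def card_PiE nat_mult_distrib)
  finally show "card (sublattice_box p m :: (int ^ 'd) set) \<le> (3 * m) ^ CARD('d)" .
qed

definition popular_points :: "nat \<Rightarrow> nat \<Rightarrow> nat \<Rightarrow> (int ^ 'd) set" where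
  "popular_points p m l = {x. (\<forall>i. 0 \<le> x $ i \<and> x $ i < int (p * m)) \<and> (\<chi> i. x $ i mod int p) \<in> popular_residues p l}"

text \<open>Adding p times a vector of quotients between 0 and m - 1 to a popular residue gives m^d
  distinct points of the cube.\<close>

lemma card_popular_points_ge:
  assumes p: "p \<ge> 1"
  shows "finite (popular_points p m l :: (int ^ 'd::finite) set)"
    and "m ^ CARD('d) * card (popular_residues p l :: (int ^ 'd) set) \<le> card (popular_points p m l :: (int ^ 'd) set)"
proof -
  let ?G = "popular_residues p l :: (int ^ 'd) set"
  have pp: "int p > 0" using p by simp
  have "popular_points p m l \<subseteq> (residue_box (p * m) :: (int ^ 'd) set)" by (auto simp: popular_points_def residue_box_def)
  then show fin: "finite (popular_points p m l :: (int ^ 'd::finite) set)" by (rule finite_subset[OF _ finite_residue_box])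
  define W where "W = PiE (UNIV :: 'd set) (\<lambda>_. {0..<int m})"
  define f where "f = (\<lambda>(z, a). (\<chi> i. a $ i + int p * z i) :: int ^ 'd)"
  have G: "0 \<le> a $ i" "a $ i < int p" if "a \<in> ?G" for a i
    using that by (auto simp: popular_residues_def residue_box_def)
  have "card (W \<times> ?G) \<le> card (popular_points p m l :: (int ^ 'd) set)"
  proof (rule card_inj_on_le[OF _ _ fin])
    show "inj_on f (W \<times> ?G)"
    proof (rule inj_onI)
      fix u v assume uv: "u \<in> W \<times> ?G" "v \<in> W \<times> ?G" "f u = f v"
      obtain z a where u: "u = (z, a)" by (cases u)
      obtain w b where v: "v = (w, b)" by (cases v)
      have eq: "a $ i + int p * z i = b $ i + int p * w i" for i
      proof -
        have "f u $ i = f v $ i" using uv(3) by simp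
        then show ?thesis by (simp add: f_def u v)
      qed
      have ab: "a $ i = b $ i" for i
      proof -
        have "(a $ i + int p * z i) mod int p = (b $ i + int p * w i) mod int p" using eq by simp
        then show ?thesis using G[of a i] G[of b i] uv u v by simp
      qed
      moreover have "z i = w i" for i using eq[of i] ab[of i] pp by simp
      ultimately show "u = v" by (auto simp: u v vec_eq_iff)
    qed
    show "f ` (W \<times> ?G) \<subseteq> popular_points p m l"
    proof (rule image_subsetI)
      fix u assume u: "u \<in> W \<times> ?G"
      then obtain z a where za: "u = (z, a)" "z \<in> W" "a \<in> ?G" by auto
      have "(f u $ i) mod int p = a $ i" for i using G[OF za(3), of i] by (simp add: f_def za(1))
      moreover have "0 \<le> f u $ i \<and> f u $ i < int (p * m)" for i
      proof -
        have "z i \<in> {0..<int m}" using za(2) unfolding W_def by (rule PiE_mem) simp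
        then have z: "0 \<le> z i" "z i + 1 \<le> int m" by auto
        have "int p * (z i + 1) \<le> int p * int m" using z(2) by (intro mult_left_mono) auto
        moreover have "0 \<le> int p * z i" using z(1) by simp
        ultimately show ?thesis using G[OF za(3), of i] by (simp add: f_def za(1) distrib_left)
      qed
      ultimately show "f u \<in> popular_points p m l" using za(3) by (simp add: popular_points_def)
    qed
  qed
  then show "m ^ CARD('d) * card ?G \<le> card (popular_points p m l :: (int ^ 'd) set)"
    by (simp add: card_cartesian_product W_def card_PiE)
qed

text \<open>Membership fixes the sum of squares of x modulo p, so one point cannot serve two values
  of l that differ modulo p.\<close>

lemma popular_points_disjoint:
  assumes p: "p \<ge> 1" and x: "x \<in> popular_points p m l" "x \<in> popular_points p m' l'"
  shows "int p dvd int l - int l'"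
proof -
  let ?s = "\<Sum>i\<in>UNIV. ((\<chi> i. x $ i mod int p) $ i)^2"
  have l: "int p dvd ?s - int l" and l': "int p dvd ?s - int l'"
    using x unfolding popular_points_def popular_residues_def by blast+
  have "int p dvd (?s - int l') - (?s - int l)" by (rule dvd_diff[OF l' l])
  then show ?thesis by simp
qed

text \<open>If n has the same residue as x, then x - n is a multiple of p and contributes 1 to the
  sum; popularity says that such n make up at least the proportion 1 / (8 p^(d - 1)) of the
  sphere.\<close>

lemma norm_sphere_avg_popular_point:
  fixes x :: "int ^ 'd::finite"
  assumes p: "p \<ge> 1" and s: "card (lattice_sphere l :: (int ^ 'd) set) > 0"
    and X: "l < (X + 1)^2" "X \<le> m"
    and x: "x \<in> popular_points p m l"
  shows "norm (sphere_avg l (\<lambda>y. if y \<in> sublattice_box p m then 1 else 0) x) \<ge> 1 / (8 * real p ^ (CARD('d) - 1))"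
proof -
  let ?S = "lattice_sphere l :: (int ^ 'd) set"
  let ?E = "sublattice_box p m :: (int ^ 'd) set"
  define a :: "int ^ 'd" where "a = (\<chi> i. x $ i mod int p)"
  have pp: "int p > 0" using p by simp
  have a: "a \<in> popular_residues p l" and xb: "\<And>i. 0 \<le> x $ i" "\<And>i. x $ i < int (p * m)"
    using x by (auto simp: popular_points_def a_def)
  have sub: "sphere_residue p l a \<subseteq> {n \<in> ?S. x - n \<in> ?E}"
  proof
    fix n assume n: "n \<in> sphere_residue p l a"
    have "int p dvd (x - n) $ i \<and> - int (p * m) \<le> (x - n) $ i \<and> (x - n) $ i < 2 * int (p * m)" for i
    proof -
      have "\<bar>n $ i\<bar> \<le> int X" using n lattice_sphere_component_le[OF _ X(1)] by blast
      moreover have "int X \<le> int (p * m)"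
      proof -
        have "1 * m \<le> p * m" using p by (rule mult_le_mono1)
        then have "X \<le> p * m" using X(2) by linarith
        then show ?thesis by (simp only: of_nat_le_iff)
      qed
      moreover have "int p dvd (x $ i - a $ i) - (n $ i - a $ i)"
      proof (rule dvd_diff)
        show "int p dvd x $ i - a $ i" by (simp add: a_def)
        show "int p dvd n $ i - a $ i" using n by blast
      qed
      ultimately show ?thesis using xb[of i] by (auto simp: abs_le_iff)
    qed
    then show "n \<in> {n \<in> ?S. x - n \<in> ?E}" using n by (simp add: sublattice_box_def)
  qed
  have finS: "finite ?S" by (rule finite_lattice_sphere)
  have "(\<Sum>n\<in>?S. if x - n \<in> ?E then 1 else 0 :: complex) = of_nat (card {n \<in> ?S. x - n \<in> ?E})"
    using finS by (simp add: sum.inter_filter[symmetric])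
  then have "norm (sphere_avg l (\<lambda>y. if y \<in> ?E then 1 else 0) x) = real (card {n \<in> ?S. x - n \<in> ?E}) / real (card ?S)"
    by (simp add: sphere_avg_def norm_divide)
  also have "... \<ge> real (card (sphere_residue p l a)) / real (card ?S)"
    by (intro divide_right_mono of_nat_mono card_mono sub) (use finS in auto)
  finally have "norm (sphere_avg l (\<lambda>y. if y \<in> ?E then 1 else 0) x) \<ge> real (card (sphere_residue p l a)) / real (card ?S)" .
  moreover have "1 / (8 * real p ^ (CARD('d) - 1)) \<le> real (card (sphere_residue p l a)) / real (card ?S)"
  proof -
    have "real (card ?S) \<le> 8 * real p ^ (CARD('d) - 1) * real (card (sphere_residue p l a))"
      using a by (simp add: popular_residues_def)
    then show ?thesis using p s by (simp add: field_simps)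
  qed
  ultimately show ?thesis by linarith
qed

lemma infsum_LL_indicator:
  fixes E :: "(int ^ 'd::finite) set"
  assumes E: "finite E" and r: "r > 0"
  shows "(\<Sum>\<^sub>\<infinity>x\<in>UNIV. norm ((if x \<in> E then 1 else 0) :: complex) / r * LL (norm ((if x \<in> E then 1 else 0) :: complex) / r))
     = real (card E) * (1 / r * LL (1 / r))"
proof -
  have "(\<Sum>\<^sub>\<infinity>x\<in>UNIV. norm ((if x \<in> E then 1 else 0) :: complex) / r * LL (norm ((if x \<in> E then 1 else 0) :: complex) / r))
     = (\<Sum>\<^sub>\<infinity>x\<in>E. 1 / r * LL (1 / r))"
    by (rule infsum_cong_neutral) auto
  also have "... = (\<Sum>x\<in>E. 1 / r * LL (1 / r))" by (rule infsum_finite[OF E])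
  finally show ?thesis by simp
qed

lemma weak_LlogL_indicator:
  fixes E :: "(int ^ 'd::finite) set"
  assumes w: "weak_LlogL_bound TYPE('d) l C" and E: "finite E" and r: "r > 0"
  shows "finite {x. maximal_avg l (\<lambda>x. if x \<in> E then 1 else 0) x > ereal r}"
    and "real (card {x. maximal_avg l (\<lambda>x. if x \<in> E then 1 else 0) x > ereal r}) \<le> C * (real (card E) * (1 / r * LL (1 / r)))"
proof -
  let ?f = "\<lambda>x::int ^ 'd. (if x \<in> E then 1 else 0) :: complex"
  have "finite {x. ?f x \<noteq> 0}" using E by simp
  then have "card_le {x. maximal_avg l ?f x > ereal r}
          (C * (\<Sum>\<^sub>\<infinity>x\<in>UNIV. norm (?f x) / r * LL (norm (?f x) / r)))"
    by (rule w[unfolded weak_LlogL_bound_def, rule_format, OF r])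
  then show "finite {x. maximal_avg l ?f x > ereal r}"
    "real (card {x. maximal_avg l ?f x > ereal r}) \<le> C * (real (card E) * (1 / r * LL (1 / r)))"
    unfolding infsum_LL_indicator[OF E r] card_le_def by auto
qed

text \<open>Testing on the indicator of one point at level 1, where the right-hand side is the
  constant itself.\<close>

lemma weak_LlogL_constant_nonneg:
  assumes w: "weak_LlogL_bound TYPE('d::finite) l C"
  shows "C \<ge> 0"
proof -
  have "0 \<le> real (card {x :: int ^ 'd. maximal_avg l (\<lambda>x. if x \<in> {0} then 1 else 0) x > ereal 1})" by simp
  also have "... \<le> C * (real (card {0 :: int ^ 'd}) * (1 / 1 * LL (1 / 1)))"
    by (rule weak_LlogL_indicator(2)[OF w]) auto
  finally show ?thesis by (simp add: LL_def log_plus_def)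
qed

text \<open>The level of the test is p^(1 - d) / 16, 3 ^ d compares the support with the cube of
  popular points, and 5 + d absorbs the logarithm of 16 p^(d - 1).\<close>

definition distinct_const :: "nat \<Rightarrow> real" where
  "distinct_const d = 16 * 3 ^ d * (5 + real d) / popular_const d"

text \<open>The disjoint sets of popular points all lie in one superlevel set, so their sizes, each
  at least a constant times m^d p^(d - 1), add up. The right-hand side is at most C times (3 m)^d
  times 16 p^(d - 1) times the logarithmic factor. The powers of m and p cancel and only the
  logarithm survives.\<close>

proposition card_distinct_residues_le:
  fixes K :: "nat set"
  assumes d: "CARD('d::finite) \<ge> 5" and w: "weak_LlogL_bound TYPE('d) l C"
    and p: "prime p" and pP: "real p \<ge> popular_threshold CARD('d)" and K: "finite K" "K \<subseteq> {1..}"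
    and big: "\<And>k. k \<in> K \<Longrightarrow> even (l k) \<and> p ^ 16 \<le> l k"
    and dist: "\<And>j k. \<lbrakk>j \<in> K; k \<in> K; j \<noteq> k\<rbrakk> \<Longrightarrow> \<not> int p dvd int (l j) - int (l k)"
  shows "real (card K) \<le> distinct_const CARD('d) * C * (1 + ln (real p))"
proof -
  define D where "D = CARD('d)"
  have D5: "D \<ge> 5" using d by (simp add: D_def)
  define c where "c = popular_const D"
  have c: "c > 0" unfolding c_def using D5 by (intro popular_const_pos) simp
  have C0: "C \<ge> 0" by (rule weak_LlogL_constant_nonneg[OF w])
  have "real (8 * D) \<le> real p" using pP by (simp add: popular_threshold_def D_def)
  then have pD: "8 * D \<le> p" by (simp only: of_nat_le_iff)
  have p1: "p \<ge> 1" using pD D5 by linarith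
  \<comment> \<open>Any m that dominates every \<open>l k\<close> would do, since m^d cancels at the
    end; the summand 1 makes it positive.\<close>
  define m where "m = (\<Sum>k\<in>K. l k) + 1"
  have lm: "l k \<le> m" if "k \<in> K" for k
    using member_le_sum[OF that _ K(1), of l] by (simp add: m_def)
  define Q where "Q = real p ^ (D - 1)"
  have Q1: "Q \<ge> 1" using p1 by (simp add: Q_def)
  have "real m > 0" unfolding of_nat_0_less_iff by (simp add: m_def)
  then have mQ: "real m ^ D * Q > 0" using Q1 by (intro mult_pos_pos zero_less_power) simp_all
  \<comment> \<open>Half of the guaranteed average 1 / (8 Q), because the superlevel set is given by
    a strict inequality.\<close>
  define r where "r = 1 / (16 * Q)"
  have r: "r > 0" using Q1 by (simp add: r_def)
  define E where "E = (sublattice_box p m :: (int ^ 'd) set)"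
  let ?f = "\<lambda>y. (if y \<in> E then 1 else 0) :: complex"
  let ?M = "{x. maximal_avg l ?f x > ereal r}"
  let ?P = "\<lambda>k. popular_points p m (l k) :: (int ^ 'd) set"
  have finE: "finite E" unfolding E_def by (rule card_sublattice_box_le(1)[OF p1])
  have each: "?P k \<subseteq> ?M \<and> real m ^ D * (c * Q) \<le> real (card (?P k))" if k: "k \<in> K" for k
  proof -
    obtain X where X: "X^2 \<le> l k" "l k < (X + 1)^2" by (rule floor_square_root_exists)
    \<comment> \<open>Here p^16 <= \<open>l k\<close> is used: it is the square of the condition p^8
      <= X under which a residue class has the sharp bound.\<close>
    have pX: "p ^ 8 \<le> X"
    proof (rule ccontr)
      assume "\<not> ?thesis"
      then have "X + 1 \<le> p ^ 8" by simp
      then have "(X + 1)^2 \<le> (p ^ 8)^2" by (rule power_mono) simp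
      also have "... = p ^ 16" by (simp add: power_mult[symmetric])
      finally show False using X(2) big[OF k] by simp
    qed
    have "p ^ 1 \<le> p ^ 8" using p1 by (intro power_increasing) auto
    then have X8: "8 * D \<le> X" using pX pD by simp
    have Xm: "X \<le> m"
    proof -
      have "X \<le> X^2" by (simp add: power2_eq_square)
      then show ?thesis using X(1) lm[OF k] by linarith
    qed
    have "0 < 4 / (8 * real CARD('d)) ^ (CARD('d) - 4) * real X ^ (CARD('d) - 2)"
      using X8 D5 by (intro mult_pos_pos divide_pos_pos zero_less_power) auto
    also have "... \<le> real (card (lattice_sphere (l k) :: (int ^ 'd) set))"
      by (rule card_lattice_sphere_ge[OF d _ X(1)]) (use big[OF k] X8 D_def in auto)
    finally have s: "card (lattice_sphere (l k) :: (int ^ 'd) set) > 0" by simp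
    have "?P k \<subseteq> ?M"
    proof
      fix x assume x: "x \<in> ?P k"
      have "r < 1 / (8 * Q)" using Q1 by (simp add: r_def field_simps)
      also have "... \<le> norm (sphere_avg (l k) ?f x)"
        unfolding E_def Q_def D_def by (rule norm_sphere_avg_popular_point[OF p1 s X(2) Xm x])
      finally have "ereal r < ereal (norm (sphere_avg (l k) ?f x))" by simp
      also have "... \<le> maximal_avg l ?f x"
        unfolding maximal_avg_def by (rule SUP_upper) (use k K in auto)
      finally show "x \<in> ?M" by simp
    qed
    moreover have "real m ^ D * (c * Q) \<le> real (card (?P k))"
    proof -
      have "real m ^ D * (c * Q) \<le> real m ^ D * real (card (popular_residues p (l k) :: (int ^ 'd) set))"
        unfolding Q_def c_def D_def by (intro mult_left_mono card_popular_residues_ge[OF d p pP pX X]) (use big[OF k] in auto)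
      also have "... = real (m ^ D * card (popular_residues p (l k) :: (int ^ 'd) set))" by simp
      also have "... \<le> real (card (?P k))"
        unfolding D_def by (rule of_nat_mono[OF card_popular_points_ge(2)[OF p1]])
      finally show ?thesis .
    qed
    ultimately show ?thesis ..
  qed
  have "real (card K) * (real m ^ D * (c * Q)) = (\<Sum>k\<in>K. real m ^ D * (c * Q))" by simp
  also have "... \<le> (\<Sum>k\<in>K. real (card (?P k)))" by (rule sum_mono) (use each in auto)
  also have "... = real (card (\<Union>k\<in>K. ?P k))"
  proof -
    have "card (\<Union>k\<in>K. ?P k) = (\<Sum>k\<in>K. card (?P k))"
      by (rule card_UN_disjoint[OF K(1)])
        (use card_popular_points_ge(1)[OF p1] popular_points_disjoint[OF p1] dist in blast)+
    then show ?thesis by simp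
  qed
  also have "... \<le> real (card ?M)"
    by (intro of_nat_mono card_mono weak_LlogL_indicator(1)[OF w finE r]) (use each in blast)
  also have "... \<le> C * (real (card E) * (1 / r * LL (1 / r)))" by (rule weak_LlogL_indicator(2)[OF w finE r])
  also have "... \<le> C * (real ((3 * m) ^ D) * (16 * Q * (1 + ln (16 * Q))))"
  proof -
    have "1 / r * LL (1 / r) = 16 * Q * (1 + ln (16 * Q))"
      using Q1 by (simp add: r_def LL_def log_plus_def)
    moreover have "0 \<le> 16 * Q * (1 + ln (16 * Q))" using Q1 by simp
    moreover have "real (card E) \<le> real ((3 * m) ^ D)"
      unfolding E_def D_def by (rule of_nat_mono[OF card_sublattice_box_le(2)[OF p1]])
    ultimately show ?thesis using C0 by (simp add: mult_left_mono mult_right_mono)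
  qed
  also have "... = (real m ^ D * Q) * (C * (16 * 3 ^ D) * (1 + ln (16 * Q)))"
    by (simp add: power_mult_distrib)
  finally have "(real m ^ D * Q) * (real (card K) * c) \<le> (real m ^ D * Q) * (C * (16 * 3 ^ D) * (1 + ln (16 * Q)))"
    by (simp add: mult_ac)
  then have "real (card K) * c \<le> C * (16 * 3 ^ D) * (1 + ln (16 * Q))"
    by (rule mult_left_le_imp_le) (rule mQ)
  also have "... \<le> C * (16 * 3 ^ D) * ((5 + real D) * (1 + ln (real p)))"
  proof (rule mult_left_mono)
    have lp: "ln (real p) \<ge> 0" using p1 by simp
    have "ln (16::real) = ln (2 ^ 4)" by simp
    also have "... = 4 * ln 2" by (subst ln_realpow) auto
    also have "... \<le> 4" using ln_le_minus_one[of "2::real"] by simp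
    finally have "ln (16::real) \<le> 4" .
    moreover have "ln (16 * Q) = ln 16 + (real D - 1) * ln (real p)"
      using p1 D5 Q1 by (simp add: ln_mult Q_def ln_realpow of_nat_diff)
    ultimately have "1 + ln (16 * Q) \<le> 5 + real D * ln (real p)" using lp by (simp add: left_diff_distrib)
    also have "... \<le> (5 + real D) * (1 + ln (real p))" using lp by (simp add: algebra_simps)
    finally show "1 + ln (16 * Q) \<le> (5 + real D) * (1 + ln (real p))" .
  qed (use C0 in auto)
  finally show ?thesis
    using c unfolding distinct_const_def D_def[symmetric] c_def[symmetric] by (simp add: field_simps)
qed

section \<open>From distinct residues to the counting function\<close>

lemma counting_le_floor:
  fixes \<mu> :: "nat \<Rightarrow> nat"
  assumes mono: "strict_mono_on {1..} \<mu>" and pos: "\<And>k. k \<ge> 1 \<Longrightarrow> \<mu> k > 0"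
  shows "finite {k. k \<ge> 1 \<and> \<mu> k \<le> n}" and "card {k. k \<ge> 1 \<and> \<mu> k \<le> n} \<le> n"
proof -
  have inj: "inj_on \<mu> {k. k \<ge> 1 \<and> \<mu> k \<le> n}"
    using strict_mono_on_imp_inj_on[OF mono] by (rule inj_on_subset) auto
  have sub: "\<mu> ` {k. k \<ge> 1 \<and> \<mu> k \<le> n} \<subseteq> {1..n}" using pos by (auto simp: Suc_le_eq)
  show "finite {k. k \<ge> 1 \<and> \<mu> k \<le> n}" by (rule inj_on_finite[OF inj sub]) simp
  have "card {k. k \<ge> 1 \<and> \<mu> k \<le> n} \<le> card {1..n}" by (rule card_inj_on_le[OF inj sub]) simp
  then show "card {k. k \<ge> 1 \<and> \<mu> k \<le> n} \<le> n" by simp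
qed

text \<open>The positive differences of the factorials are all below n^n because n! <= n^n, and
  there are at most n^2 of them, as the choice of the prime requires.\<close>

lemma factorial_differences_prime:
  fixes \<mu> :: "nat \<Rightarrow> nat" and n :: nat
  assumes mono: "strict_mono_on {1..} \<mu>" and pos: "\<And>k. k \<ge> 1 \<Longrightarrow> \<mu> k > 0" and n: "n \<ge> 4"
  defines "K \<equiv> {k. k \<ge> 1 \<and> \<mu> k \<le> n}"
  shows "\<exists>p. prime p \<and> n < p \<and> p \<le> n ^ 7 \<and>
    (\<forall>j\<in>K. \<forall>k\<in>K. j \<noteq> k \<longrightarrow> \<not> int p dvd int (fact (\<mu> j)) - int (fact (\<mu> k)))"
proof -
  have K: "finite K" "card K \<le> n" unfolding K_def using counting_le_floor[OF mono pos] by blast+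
  define S where "S = (\<lambda>(j, k). fact (\<mu> k) - fact (\<mu> j) :: nat) ` {(j, k) \<in> K \<times> K. j < k}"
  have lt: "fact (\<mu> j) < (fact (\<mu> k) :: nat)" if "j \<in> K" "k \<in> K" "j < k" for j k
  proof (rule fact_less_mono)
    show "0 < \<mu> j" using that pos by (simp add: K_def)
    show "\<mu> j < \<mu> k" using strict_mono_onD[OF mono, of j k] that by (simp add: K_def)
  qed
  have sub: "{(j, k) \<in> K \<times> K. j < k} \<subseteq> K \<times> K" by auto
  have finKK: "finite (K \<times> K)" by (rule finite_cartesian_product[OF K(1) K(1)])
  have finS: "finite S" unfolding S_def by (rule finite_imageI[OF finite_subset[OF sub finKK]])
  have "card S \<le> card {(j, k) \<in> K \<times> K. j < k}"
    unfolding S_def by (rule card_image_le[OF finite_subset[OF sub finKK]])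
  also have "... \<le> card (K \<times> K)" by (rule card_mono[OF finKK sub])
  also have "... \<le> n^2" using K(2) by (simp add: card_cartesian_product power2_eq_square mult_le_mono)
  finally have cS: "card S \<le> n^2" .
  have rng: "0 < s \<and> s < n ^ n" if s: "s \<in> S" for s
  proof -
    obtain j k where jk: "j \<in> K" "k \<in> K" "j < k" "s = fact (\<mu> k) - fact (\<mu> j)"
      using s by (auto simp: S_def)
    have "(fact (\<mu> k) :: nat) \<le> fact n" using jk by (intro fact_mono) (simp add: K_def)
    also have "... \<le> n ^ n" using fact_le_power[of n, where 'a = nat] by simp
    finally have "fact (\<mu> k) \<le> n ^ n" .
    moreover have "fact (\<mu> j) > (0::nat)" by simp
    ultimately show ?thesis using jk(4) lt[OF jk(1-3)] by linarith
  qed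
  obtain p where p: "prime p" "n < p" "p \<le> n ^ 7" "\<forall>s\<in>S. \<not> p dvd s"
    using exists_prime_not_dividing[OF n finS cS rng] by blast
  have ord: "\<not> int p dvd int (fact (\<mu> k)) - int (fact (\<mu> j))" if "j \<in> K" "k \<in> K" "j < k" for j k
  proof -
    have "fact (\<mu> k) - fact (\<mu> j) \<in> S" using that by (force simp: S_def)
    then have "\<not> p dvd fact (\<mu> k) - fact (\<mu> j)" using p(4) by blast
    moreover have "int (fact (\<mu> k) - fact (\<mu> j)) = int (fact (\<mu> k)) - int (fact (\<mu> j))"
      by (rule of_nat_diff[OF less_imp_le[OF lt[OF that]]])
    ultimately show ?thesis by (metis of_nat_dvd_iff)
  qed
  have "\<not> int p dvd int (fact (\<mu> j)) - int (fact (\<mu> k))" if "j \<in> K" "k \<in> K" "j \<noteq> k" for j k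
  proof (cases "j < k")
    case True
    then show ?thesis using ord[OF that(1,2)] dvd_diff_commute by blast
  next
    case False
    then show ?thesis using ord[OF that(2,1)] that(3) by simp
  qed
  then show ?thesis using p(1-3) unfolding K_def by blast
qed

lemma ln_two_ge_half: "ln (2::real) \<ge> 1/2"
proof -
  have "exp (1/2 :: real) \<le> 2"
    using exp_bound_half[of "1/2 :: real"] by simp
  then show ?thesis by (subst ln_ge_iff) auto
qed

text \<open>The first summand covers N below the threshold, where counting integers is enough. The 7
  is the exponent in p <= n^7, and 226 exceeds the 224 produced by the small factorials.\<close>

definition counting_const :: "nat \<Rightarrow> real" where
  "counting_const d = real (nat \<lceil>max 4 (popular_threshold d)\<rceil>) + 7 * distinct_const d + 226"

proposition counting_le:
  fixes N :: real
  assumes d: "CARD('d::finite) \<ge> 5" and mono: "strict_mono_on {1..} \<mu>" and pos: "\<And>k. k \<ge> 1 \<Longrightarrow> \<mu> k > 0"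
    and w: "weak_LlogL_bound TYPE('d) (\<lambda>k. fact (\<mu> k)) C" and N: "N \<ge> 2"
  shows "real (counting \<mu> N) \<le> counting_const CARD('d) * (1 + C) * (1 + ln N)"
proof -
  define P0 B where "P0 = popular_threshold CARD('d)" and "B = distinct_const CARD('d)"
  have B: "B > 0"
    unfolding B_def distinct_const_def using d
    by (intro divide_pos_pos mult_pos_pos add_pos_nonneg popular_const_pos) simp_all
  define N0 where "N0 = nat \<lceil>max 4 P0\<rceil>"
  define A where "A = real N0 + 7 * B + 226"
  have A: "A > 0" using B by (simp add: A_def add_nonneg_pos)
  have Ac: "counting_const CARD('d) = A" by (simp add: counting_const_def A_def N0_def P0_def B_def)
  define n where "n = nat \<lfloor>N\<rfloor>"
  define K where "K = {k. k \<ge> 1 \<and> \<mu> k \<le> n}"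
  have cnt: "counting \<mu> N = card K"
  proof -
    have "real k \<le> N \<longleftrightarrow> k \<le> n" for k using N by (simp add: n_def le_nat_iff le_floor_iff)
    then show ?thesis by (simp add: counting_def K_def)
  qed
  have K: "finite K" "card K \<le> n" unfolding K_def using counting_le_floor[OF mono pos] by blast+
  have nN: "real n \<le> N" using N by (simp add: n_def)
  have C0: "C \<ge> 0" by (rule weak_LlogL_constant_nonneg[OF w])
  have lN: "ln N \<ge> 0" using N by simp
  show ?thesis
  proof (cases "n < N0")
    case True
    have "real (card K) \<le> real N0" using True K(2) by simp
    also have "... \<le> A" using B by (simp add: A_def)
    also have "... \<le> A * ((1 + C) * (1 + ln N))"
    proof -
      have "1 \<le> (1 + C) * (1 + ln N)" using C0 lN by (intro mult_ge1_I) auto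
      then show ?thesis using A by simp
    qed
    finally show ?thesis by (simp add: Ac cnt mult.assoc)
  next
    case False
    then have n0: "real n \<ge> max 4 P0" using real_nat_ceiling_ge[of "max 4 P0"] unfolding N0_def by linarith
    then have n4: "n \<ge> 4" by simp
    obtain p where p: "prime p" "n < p" "p \<le> n ^ 7" and dist:
      "\<forall>j\<in>K. \<forall>k\<in>K. j \<noteq> k \<longrightarrow> \<not> int p dvd int (fact (\<mu> j)) - int (fact (\<mu> k))"
      using factorial_differences_prime[OF mono pos n4] unfolding K_def by blast
    have lnN: "ln (real n) \<le> ln N" using nN n4 by simp
    define K' where "K' = {k \<in> K. p ^ 16 \<le> (fact (\<mu> k) :: nat)}"
    \<comment> \<open>A discarded index satisfies 2^(\<open>\<mu> k\<close> - 1) <=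
      \<open>\<mu> k\<close>! < p^16 <= n^112; since ln 2 >= 1/2, its \<open>\<mu> k\<close> is at
      most 1 + 224 ln n.\<close>
    define T where "T = nat \<lfloor>1 + 224 * ln (real n)\<rfloor>"
    have ln0: "ln (real n) \<ge> 0" using n4 by simp
    have "card (K - K') \<le> card {1..T}"
    proof (rule card_inj_on_le)
      show "inj_on \<mu> (K - K')" using strict_mono_on_imp_inj_on[OF mono] by (rule inj_on_subset) (auto simp: K_def)
      show "\<mu> ` (K - K') \<subseteq> {1..T}"
      proof (rule image_subsetI)
        fix k assume k: "k \<in> K - K'"
        then have m1: "\<mu> k \<ge> 1" using pos[of k] by (simp add: K_def)
        have "2 ^ (\<mu> k - 1) \<le> (fact (\<mu> k) :: nat)" by (rule two_power_le_fact)
        also have "... \<le> p ^ 16" using k by (auto simp: K'_def)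
        also have "... \<le> (n ^ 7) ^ 16" by (rule power_mono[OF p(3)]) simp
        also have "... = n ^ 112" by (simp add: power_mult[symmetric])
        finally have "real (2 ^ (\<mu> k - 1)) \<le> real (n ^ 112)" by (rule of_nat_mono)
        then have "ln ((2::real) ^ (\<mu> k - 1)) \<le> ln (real n ^ 112)" using n4 by simp
        then have "real (\<mu> k - 1) * ln 2 \<le> 112 * ln (real n)" using n4 by (simp add: ln_realpow)
        moreover have "real (\<mu> k - 1) * (1/2) \<le> real (\<mu> k - 1) * ln 2" by (intro mult_left_mono ln_two_ge_half) simp
        ultimately have "real (\<mu> k - 1) \<le> 224 * ln (real n)" by linarith
        then have "real (\<mu> k) \<le> 1 + 224 * ln (real n)" using m1 by simp
        then have "\<mu> k \<le> T" unfolding T_def by (rule le_nat_floor)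
        then show "\<mu> k \<in> {1..T}" using m1 by simp
      qed
    qed simp
    then have "real (card (K - K')) \<le> real T" by simp
    also have "... \<le> 1 + 224 * ln (real n)" using ln0 by (simp add: T_def)
    also have "... \<le> 224 * (1 + ln N)" using lnN by simp
    finally have small: "real (card (K - K')) \<le> 224 * (1 + ln N)" .
    have "real (card K') \<le> B * C * (1 + ln (real p))"
    proof (rule card_distinct_residues_le[OF d w p(1), folded P0_def B_def])
      show "real p \<ge> P0" using n0 p(2) by simp
      show "finite K'" unfolding K'_def by (rule finite_subset[OF _ K(1)]) blast
      show "K' \<subseteq> {1..}" by (auto simp: K'_def K_def)
      show "even (fact (\<mu> k) :: nat) \<and> p ^ 16 \<le> (fact (\<mu> k) :: nat)" if "k \<in> K'" for k
      proof
        show big: "p ^ 16 \<le> (fact (\<mu> k) :: nat)" using that by (simp add: K'_def)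
        have "2 \<le> p" "p \<le> p ^ 16" using p(2) n4 by (auto intro: self_le_power)
        \<comment> \<open>A factorial as large as p^16 is not 0! or 1!, hence it is even, as the
          lower bound for the sphere requires.\<close>
        have "\<mu> k \<ge> 2"
        proof (rule ccontr)
          assume "\<not> ?thesis"
          then have "\<mu> k = 0 \<or> \<mu> k = 1" by auto
          then have "(fact (\<mu> k) :: nat) = 1" by auto
          then show False using big \<open>2 \<le> p\<close> \<open>p \<le> p ^ 16\<close> by linarith
        qed
        then show "even (fact (\<mu> k) :: nat)" by (intro dvd_fact) auto
      qed
      show "\<not> int p dvd int (fact (\<mu> j)) - int (fact (\<mu> k))" if "j \<in> K'" "k \<in> K'" "j \<noteq> k" for j k
        using dist that unfolding K'_def by blast
    qed
    also have "... \<le> B * C * (7 * (1 + ln N))"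
    proof (rule mult_left_mono)
      have "ln (real p) \<le> ln (real (n ^ 7))" using p n4 by (subst ln_le_cancel_iff) (auto intro: of_nat_mono)
      also have "... = 7 * ln (real n)" using n4 by (simp add: ln_realpow)
      finally show "1 + ln (real p) \<le> 7 * (1 + ln N)" using lnN by simp
    qed (use B C0 in auto)
    finally have large: "real (card K') \<le> 7 * B * C * (1 + ln N)" by (simp only: mult_ac)
    have sub: "K' \<subseteq> K" by (auto simp: K'_def)
    have "card (K - K') = card K - card K'" by (rule card_Diff_subset[OF finite_subset[OF sub K(1)] sub])
    moreover have "card K' \<le> card K" by (rule card_mono[OF K(1) sub])
    ultimately have "real (card K) = real (card (K - K')) + real (card K')" by simp
    also have "... \<le> (224 + 7 * B * C) * (1 + ln N)" using small large by (simp add: distrib_right)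
    also have "... \<le> (A * (1 + C)) * (1 + ln N)"
    proof (rule mult_right_mono)
      have "0 \<le> real N0 * C" "0 \<le> C * 226" "0 \<le> 7 * B" using B C0 by auto
      then show "224 + 7 * B * C \<le> A * (1 + C)" by (simp add: A_def distrib_left distrib_right mult_ac)
    qed (use lN in simp)
    finally show ?thesis by (simp add: Ac cnt)
  qed
qed

theorem theorem1p5:
  assumes "CARD('d::finite) \<ge> 5"
  shows "\<exists>(C\<^sub>d :: real) (K :: real \<Rightarrow> real). \<forall>(C\<^sub>0 :: real) (\<mu> :: nat \<Rightarrow> nat).
    strict_mono_on {1..} \<mu> \<and> (\<forall>k\<ge>1. \<mu> k > 0) \<and>
    weak_LlogL_bound TYPE('d) (\<lambda>k. fact (\<mu> k)) C\<^sub>0 \<longrightarrow>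
      (\<forall>N::real. N \<ge> 2 \<longrightarrow> real (counting \<mu> N) \<le> K C\<^sub>0 * (1 + ln N)) \<and>
      C_log \<mu> \<le> ereal (C\<^sub>d * (1 + C\<^sub>0)) \<and> C_log \<mu> < \<infinity>"
proof -
  \<comment> \<open>Fixed before the constant of the inequality and the sequence are introduced, so
    it depends on the dimension alone; it serves both the bound for each N and the supremum.\<close>
  define A where "A = counting_const CARD('d)"
  show ?thesis
  proof (intro exI[of _ A] exI[of _ "\<lambda>C. A * (1 + C)"] allI impI)
    fix C\<^sub>0 :: real and \<mu> :: "nat \<Rightarrow> nat"
    assume h: "strict_mono_on {1..} \<mu> \<and> (\<forall>k\<ge>1. \<mu> k > 0) \<and> weak_LlogL_bound TYPE('d) (\<lambda>k. fact (\<mu> k)) C\<^sub>0"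
    have bound: "real (counting \<mu> N) \<le> A * (1 + C\<^sub>0) * (1 + ln N)" if "N \<ge> 2" for N
      unfolding A_def by (rule counting_le[OF assms]) (use h that in auto)
    have "C_log \<mu> \<le> ereal (A * (1 + C\<^sub>0))"
      unfolding C_log_def
    proof (rule SUP_least)
      fix N :: real assume "N \<in> {2..}"
      then have N: "N \<ge> 2" by simp
      then have "1 + ln N > 0" by (simp add: add_pos_nonneg)
      then show "ereal (real (counting \<mu> N) / (1 + ln N)) \<le> ereal (A * (1 + C\<^sub>0))"
        using bound[OF N] by (simp add: pos_divide_le_eq)
    qed
    moreover from this have "C_log \<mu> < \<infinity>" by (rule le_less_trans) simp
    ultimately show "(\<forall>N::real. N \<ge> 2 \<longrightarrow> real (counting \<mu> N) \<le> A * (1 + C\<^sub>0) * (1 + ln N)) \<and>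
      C_log \<mu> \<le> ereal (A * (1 + C\<^sub>0)) \<and> C_log \<mu> < \<infinity>"
      using bound by blast
  qed
qed

end
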